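(* Let $U$ be a subspace of $W$ with $\dim U=d$ (so $d\le k\le n$). Let $\mathcal{I}=(p_1,\ldots,p_k)$ be a $k$-tuple of invariant factors with $\deg\prod_{i=1}^k p_i=d$. Then $$N(V,W,U;\mathcal{I})=\frac{|\mathrm{GL}_d(\mathbb{F}_q)|}{\prod_{f\in S(\mathcal{I})}c_f(\Phi_{\mathcal{I}}(f))}\prod_{i=d+1}^{k}(q^n-q^i),$$ where $N(V,W,U;\mathcal{I})=\#\{T\in L(W,V):\mathfrak{I}(T)=U\text{ and }\mathcal{I}_T=\mathcal{I}\}$ (with the conventions $|\mathrm{GL}_0(\mathbb{F}_q)|=1$ and empty products equal to $1$).
   Context: Let $\mathbb{F}_q$ be the finite field with $q$ elements and let $n\ge k$ be positive integers. Let $V$ be an $n$-dimensional $\mathbb{F}_q$-vector space and $W\subseteq V$ a $k$-dimensional subspace. Fix an ordered basis $\mathcal{B}_1=(v_1,\ldots,v_k)$ of $W$ and extend it to an ordered basis $\mathcal{B}_2=(v_1,\ldots,v_n)$ of $V$. $L(W,V)$ denotes the space of $\mathbb{F}_q$-linear maps $W\to V$. $I_{n,k}\in M_{n,k}(\mathbb{F}_q)$ is the matrix whose $(i,j)$ entry is $1$ if $i=j$ and $0$ otherwise. For a nonzero polynomial matrix $A\in M_{n,k}(\mathbb{F}_q[x])$, its $i$-th determinantal divisor $\delta_i(A)$ is the monic gcd of all $i\times i$ minors of $A$ (with $\delta_0=1$), and its invariant factors are the monic polynomials $p_i=\delta_i(A)/\delta_{i-1}(A)$; they are the diagonal entries of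 the Smith normal form of $A$. For $T\in L(W,V)$ with matrix $B\in M_{n,k}(\mathbb{F}_q)$ with respect to $\mathcal{B}_1,\mathcal{B}_2$, the matrix $xI_{n,k}-B$ has exactly $k$ invariant factors $p_1\mid\cdots\mid p_k$, called the invariant factors of $T$; write $\mathcal{I}_T=(p_1,\ldots,p_k)$. A $k$-tuple of invariant factors is a tuple $(p_1,\ldots,p_k)$ of monic polynomials in $\mathbb{F}_q[x]$ with $p_i\mid p_{i+1}$ for $1\le i<k$. $\mathfrak{I}(T)$ denotes the maximal $T$-invariant subspace contained in $W$ (the largest subspace $U\subseteq W$ with $T(U)\subseteq U$). Partition notation: for a partition $\lambda$ with conjugate $\lambda'=(\lambda_1',\lambda_2',\ldots)$, let $m_i=\lambda_i'-\lambda_{i+1}'$ (number of parts equal to $i$) and $h_i=\lambda_1'+\cdots+\lambda_i'$. For an irreducible $f\in\mathbb{F}_q[x]$ of degree $\deg f=e$, set $c_f(\lambda)=\prod_{i\ge1}\prod_{j=1}^{m_i}\left(q^{e h_i}-q^{e(h_i-j)}\right)$. For irreducible $f$ and nonzero $g$, $\nu_f(g)=\max\{e: f^e\mid g\}$. For $\mathcal{I}=(p_1,\ldots,p_k)$ with $P=\prod p_i$, $S(\mathcal{I})$ is the set of monic irreducible divisors of $P$, and for $f\in S(\mathcal{I})$, $\Phi_{\mathcal{I}}(f)$ is the partition $(\nu_f(p_k),\nu_f(p_{k-1}),\ldots,\nu_f(p_r))$ of $\nu_f(P)$, where $r=\min\{i:\nu_f(p_i)>0\}$. *)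

theory Defs
  imports "Jordan_Normal_Form.Determinant" "Jordan_Normal_Form.DL_Submatrix"
    "HOL-Computational_Algebra.Polynomial_Factorial"
begin

text \<open>Linear maps W -> V (with V, W subspaces of the ambient space of type 'v),
  represented extensionally: T is zero outside W.\<close>
definition lin_WV :: "('a::field \<Rightarrow> 'v::ab_group_add \<Rightarrow> 'v) \<Rightarrow> 'v set \<Rightarrow> 'v set \<Rightarrow> ('v \<Rightarrow> 'v) \<Rightarrow> bool" where
  "lin_WV s W V T \<longleftrightarrow> (\<forall>x\<in>W. T x \<in> V) \<and> (\<forall>x\<in>W. \<forall>y\<in>W. T (x + y) = T x + T y)
     \<and> (\<forall>c. \<forall>x\<in>W. T (s c x) = s c (T x)) \<and> (\<forall>x. x \<notin> W \<longrightarrow> T x = 0)"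

definition mat_of_map :: "('a::field \<Rightarrow> 'v::ab_group_add \<Rightarrow> 'v) \<Rightarrow> 'v list \<Rightarrow> 'v list \<Rightarrow> ('v \<Rightarrow> 'v) \<Rightarrow> 'a mat" where
  "mat_of_map s B1 B2 T = mat (length B2) (length B1)
     (\<lambda>(i,j). module.representation s (set B2) (T (B1 ! j)) (B2 ! i))"

definition char_mat :: "'a::field_gcd mat \<Rightarrow> 'a poly mat" where
  "char_mat B = mat (dim_row B) (dim_col B)
     (\<lambda>(i,j). (if i = j then [:0, 1:] else 0) - [:B $$ (i,j):])"

definition det_divisor :: "'a::field_gcd poly mat \<Rightarrow> nat \<Rightarrow> 'a poly" where
  "det_divisor A i = Gcd {det (submatrix A R C) | R C.
      R \<subseteq> {..<dim_row A} \<and> C \<subseteq> {..<dim_col A} \<and> card R = i \<and> card C = i}"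

definition invariant_factors :: "'a::field_gcd poly mat \<Rightarrow> 'a poly list" where
  "invariant_factors A = map (\<lambda>i. det_divisor A i div det_divisor A (i - 1)) [1..<dim_col A + 1]"

definition inv_factor_tuple :: "nat \<Rightarrow> 'a::field_gcd poly list \<Rightarrow> bool" where
  "inv_factor_tuple k ps \<longleftrightarrow> length ps = k \<and> (\<forall>p\<in>set ps. lead_coeff p = 1)
     \<and> (\<forall>i. Suc i < k \<longrightarrow> ps ! i dvd ps ! Suc i)"

definition is_max_inv_sub :: "('a::field \<Rightarrow> 'v::ab_group_add \<Rightarrow> 'v) \<Rightarrow> 'v set \<Rightarrow> ('v \<Rightarrow> 'v) \<Rightarrow> 'v set \<Rightarrow> bool" where
  "is_max_inv_sub s W T U \<longleftrightarrow> module.subspace s U \<and> U \<subseteq> W \<and> T ` U \<subseteq> U \<and>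
     (\<forall>U'. module.subspace s U' \<and> U' \<subseteq> W \<and> T ` U' \<subseteq> U' \<longrightarrow> U' \<subseteq> U)"

text \<open>Partitions as weakly decreasing lists of positive naturals.
  conj_part lam i = lam'_i (for i >= 1).\<close>
definition conj_part :: "nat list \<Rightarrow> nat \<Rightarrow> nat" where
  "conj_part lam i = card {j. j < length lam \<and> i \<le> lam ! j}"

definition mult_part :: "nat list \<Rightarrow> nat \<Rightarrow> nat" where
  "mult_part lam i = conj_part lam i - conj_part lam (Suc i)"

definition h_part :: "nat list \<Rightarrow> nat \<Rightarrow> nat" where
  "h_part lam i = (\<Sum>l\<in>{1..i}. conj_part lam l)"

text \<open>c_f(lambda) with q the field size and e = deg f; parts exceeding sum_list lam
  contribute empty products (m_i = 0 there).\<close>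
definition c_part :: "nat \<Rightarrow> nat \<Rightarrow> nat list \<Rightarrow> nat" where
  "c_part q e lam = (\<Prod>i\<in>{1..sum_list lam}. \<Prod>j\<in>{1..mult_part lam i}.
      (q ^ (e * h_part lam i) - q ^ (e * (h_part lam i - j))))"

definition S_set :: "'a::field_gcd poly list \<Rightarrow> 'a poly set" where
  "S_set ps = {f. lead_coeff f = 1 \<and> irreducible f \<and> f dvd prod_list ps}"

definition Phi :: "'a::field_gcd poly list \<Rightarrow> 'a poly \<Rightarrow> nat list" where
  "Phi ps f = (let r = (LEAST i. 1 \<le> i \<and> 0 < multiplicity f (ps ! (i - 1)))
     in map (\<lambda>i. multiplicity f (ps ! (i - 1))) (rev [r..<length ps + 1]))"

definition GL_card :: "nat \<Rightarrow> 'a::field itself \<Rightarrow> nat" where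
  "GL_card d _ = card {A :: 'a mat. A \<in> carrier_mat d d \<and> invertible_mat A}"

end

theory Submission
  imports Defs
begin

text \<open>
  A solution \<open>v\<close> of \<open>(x I - B) v = 0\<close> modulo a monic polynomial \<open>g\<close> has coefficient vectors spanning a
  \<open>T\<close>-invariant subspace of \<open>W\<close>; so it lives in the maximal invariant subspace \<open>U\<close>, and the solutions
  correspond to the kernel of \<open>g(T)\<close> on \<open>U\<close>. By the Smith normal form the number of solutions is
  \<open>q\<close> to the power of the sum of the degrees of \<open>gcd p\<^sub>i g\<close>. Hence the invariant factors of \<open>T\<close> are determined
  by the numbers of elements of the kernels of \<open>f\<^sup>i(T)\<close> on \<open>U\<close>, \<open>f\<close> irreducible.

  For \<open>T\<close> on \<open>U\<close> with prescribed kernel sizes, choose generators of the cyclic summands one after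
  another: this gives the product of the \<open>c\<^sub>f\<close>. A map together with such generators amounts to a basis
  of \<open>U\<close>, and there are as many bases as elements of \<open>GL\<^sub>d\<close>.

  Finally, extend \<open>T\<close> from \<open>U\<close> to \<open>W\<close> one basis vector \<open>w\<close> at a time. If the maximal invariant subspace
  inside a hyperplane \<open>H\<close> of \<open>H + \<langle>w\<rangle>\<close> is \<open>U\<close>, exactly \<open>q |H|\<close> values of \<open>T w\<close> enlarge it.
\<close>

section \<open>Smith normal form by transvections\<close>

text \<open>The quotient |GL_d| / prod c_f has the shape of orbit and stabiliser: prod c_f is the
  number of automorphisms of the F_q[x]-module on U, since an automorphism is fixed by the images of
  the generators. The proof uses no conjugation, canonical form or structure theorem for modules; it
  counts in two ways the pairs of an endomorphism of U and an adapted family of generators. Every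
  endomorphism with the prescribed kernel sizes has exactly prod c_f such families, every other one
  has none, and the pairs together correspond to the bases of U. No operator with given invariant
  factors has to be exhibited. The kernel condition looks at T on U only, so it is carried unchanged
  through the extension from U to W. This is why the invariant factors, which are defined by the n x
  k matrix of T on all of W, are first translated into kernel sizes on U.\<close>

definition rowop :: "(nat \<Rightarrow> 'a) \<Rightarrow> nat \<Rightarrow> (nat \<Rightarrow> nat \<Rightarrow> 'a::comm_ring_1) \<Rightarrow> nat \<Rightarrow> nat \<Rightarrow> 'a" where
  "rowop c p A = (\<lambda>i j. A i j + c i * A p j)"

definition colop :: "(nat \<Rightarrow> 'a) \<Rightarrow> nat \<Rightarrow> (nat \<Rightarrow> nat \<Rightarrow> 'a::comm_ring_1) \<Rightarrow> nat \<Rightarrow> nat \<Rightarrow> 'a" where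
  "colop c p A = (\<lambda>i j. A i j + c j * A i p)"

text \<open>Swaps and scalings are left out: every kind of operation must later be checked against
  minors and solution counts, and transvections suffice to place a pivot. The condition
  \<open>c p = 0\<close> keeps the source line fixed and so makes the operation invertible. Changing
  all other lines at once clears a whole column or row in one step.\<close>

inductive mat_equiv :: "nat \<Rightarrow> nat \<Rightarrow> (nat \<Rightarrow> nat \<Rightarrow> 'a::comm_ring_1) \<Rightarrow> (nat \<Rightarrow> nat \<Rightarrow> 'a) \<Rightarrow> bool"
  for n k A where
  base: "mat_equiv n k A A"
| row: "mat_equiv n k A B \<Longrightarrow> p < n \<Longrightarrow> c p = 0 \<Longrightarrow> mat_equiv n k A (rowop c p B)"
| col: "mat_equiv n k A B \<Longrightarrow> p < k \<Longrightarrow> c p = 0 \<Longrightarrow> mat_equiv n k A (colop c p B)"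

lemma rowop_inverse: "c p = 0 \<Longrightarrow> rowop (\<lambda>i. - c i) p (rowop c p A) = A"
  by (simp add: rowop_def fun_eq_iff)

lemma colop_inverse: "c p = 0 \<Longrightarrow> colop (\<lambda>i. - c i) p (colop c p A) = A"
  by (simp add: colop_def fun_eq_iff)

lemma mat_equiv_trans: "mat_equiv n k B C \<Longrightarrow> mat_equiv n k A B \<Longrightarrow> mat_equiv n k A C"
  by (induction rule: mat_equiv.induct) (auto intro: mat_equiv.intros)

text \<open>Each finished pivot divides the entire remaining block and not only the next pivot. This
  form survives later operations on the block, whose entries become combinations of old
  ones.\<close>

definition snf_upto :: "nat \<Rightarrow> nat \<Rightarrow> nat \<Rightarrow> (nat \<Rightarrow> nat \<Rightarrow> 'a::comm_ring_1) \<Rightarrow> bool" where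
  "snf_upto n k s A \<longleftrightarrow> (\<forall>i<n. \<forall>j<k. i \<noteq> j \<and> (i < s \<or> j < s) \<longrightarrow> A i j = 0)
     \<and> (\<forall>t<s. \<forall>i<n. \<forall>j<k. t \<le> i \<and> t \<le> j \<longrightarrow> A t t dvd A i j)"

lemma snf_upto_rowop:
  assumes "snf_upto n k s A" "s \<le> p" "p < n" "\<And>i. i < s \<Longrightarrow> c i = 0"
  shows "snf_upto n k s (rowop c p A)"
  unfolding snf_upto_def
proof (intro conjI allI impI)
  fix i j assume ij: "i < n" "j < k" "i \<noteq> j \<and> (i < s \<or> j < s)"
  then have "A i j = 0" using assms(1) by (simp add: snf_upto_def)
  moreover have "c i = 0 \<or> A p j = 0"
    using ij assms unfolding snf_upto_def by (metis not_less)
  ultimately show "rowop c p A i j = 0" by (auto simp: rowop_def)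
next
  fix t i j assume t: "t < s" "i < n" "j < k" "t \<le> i \<and> t \<le> j"
  then have "A t t dvd A i j" "A t t dvd A p j"
    using assms(1-3) unfolding snf_upto_def by auto
  moreover have "rowop c p A t t = A t t" using assms(4)[OF t(1)] by (simp add: rowop_def)
  ultimately show "rowop c p A t t dvd rowop c p A i j" by (simp add: rowop_def)
qed

lemma snf_upto_transpose: "snf_upto n k s A \<longleftrightarrow> snf_upto k n s (\<lambda>i j. A j i)"
  unfolding snf_upto_def by auto

lemma colop_transpose: "colop c p A = (\<lambda>i j. rowop c p (\<lambda>i j. A j i) j i)"
  by (simp add: colop_def rowop_def)

lemma snf_upto_colop:
  assumes "snf_upto n k s A" "s \<le> p" "p < k" "\<And>i. i < s \<Longrightarrow> c i = 0"
  shows "snf_upto n k s (colop c p A)"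
  using snf_upto_rowop[of k n s "\<lambda>i j. A j i" p c] assms
  by (simp add: snf_upto_transpose[of n k] colop_transpose)

text \<open>Moves a pivot of minimal degree into another row or column without a swap.\<close>
lemma degree_eq_reduce:
  fixes b e :: "'a::field_gcd poly"
  assumes "b \<noteq> 0"
  shows "e + (1 - e div b) * b \<noteq> 0 \<and> degree (e + (1 - e div b) * b) = degree b"
proof -
  have eq: "e + (1 - e div b) * b = e mod b + b"
    by (simp add: algebra_simps minus_div_mult_eq_mod[symmetric])
  show ?thesis
  proof (cases "e mod b = 0")
    case False
    then have "degree (e mod b) < degree b" using assms degree_mod_less by blast
    then show ?thesis unfolding eq using degree_add_eq_right degree_0 by (metis less_nat_zero_code)
  qed (use assms eq in auto)
qed

text \<open>Minimality replaces the Euclidean algorithm: among the nonzero entries of the remaining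
  block, over all equivalent matrices that keep the first \<open>s\<close> pivots, one of least
  degree \<open>m\<close> is chosen. A nonzero remainder of another entry would be an entry of
  smaller degree in an equivalent matrix.\<close>

lemma snf_step:
  fixes A :: "nat \<Rightarrow> nat \<Rightarrow> 'a::field_gcd poly"
  assumes A: "snf_upto n k s A" and sn: "s < k" "k \<le> n"
  shows "\<exists>B. mat_equiv n k A B \<and> snf_upto n k (Suc s) B"
proof (cases "\<forall>i<n. \<forall>j<k. s \<le> i \<and> s \<le> j \<longrightarrow> A i j = 0")
  case True
  have "snf_upto n k (Suc s) A"
    unfolding snf_upto_def
  proof (intro conjI allI impI)
    fix i j assume "i < n" "j < k" "i \<noteq> j \<and> (i < Suc s \<or> j < Suc s)"
    then show "A i j = 0" using A True unfolding snf_upto_def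
      by (metis less_Suc_eq_le le_neq_implies_less not_less)
  next
    fix t i j assume "t < Suc s" "i < n" "j < k" "t \<le> i \<and> t \<le> j"
    then show "A t t dvd A i j" using A True unfolding snf_upto_def
      by (metis dvd_0_right less_Suc_eq_le le_neq_implies_less)
  qed
  then show ?thesis using mat_equiv.base by blast
next
  case False
  have sn': "s < n" using sn by simp
  define M where "M = {B. mat_equiv n k A B \<and> snf_upto n k s B}"
  define piv where "piv = (\<lambda>(m::nat) B i j. B \<in> M \<and> i < n \<and> j < k \<and> s \<le> i \<and> s \<le> j \<and> B i j \<noteq> 0 \<and> degree (B i j) = m)"
  define m where "m = (LEAST m. \<exists>B i j. piv m B i j)"
  have "A \<in> M" using A mat_equiv.base by (auto simp: M_def)
  then have "\<exists>m B i j. piv m B i j" using False unfolding piv_def by blast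
  then have "\<exists>B i j. piv m B i j" unfolding m_def by (rule LeastI_ex)
  then obtain B0 i0 j0 where B0: "piv m B0 i0 j0" by blast
  have min: "m \<le> degree (B i j)" if "B \<in> M" "i < n" "j < k" "s \<le> i" "s \<le> j" "B i j \<noteq> 0" for B i j
    unfolding m_def by (rule Least_le) (use that in \<open>auto simp: piv_def\<close>)
  have rowM: "rowop c p B \<in> M" if "B \<in> M" "p < n" "s \<le> p" "c p = 0" "\<And>i. i < s \<Longrightarrow> c i = 0" for B c p
    using that by (auto simp: M_def intro: mat_equiv.row snf_upto_rowop)
  have colM: "colop c p B \<in> M" if "B \<in> M" "p < k" "s \<le> p" "c p = 0" "\<And>i. i < s \<Longrightarrow> c i = 0" for B c p
    using that by (auto simp: M_def intro: mat_equiv.col snf_upto_colop)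
  obtain B1 where B1: "piv m B1 s j0"
  proof (cases "i0 = s")
    case False
    let ?B = "rowop (\<lambda>i. if i = s then 1 - B0 s j0 div B0 i0 j0 else 0) i0 B0"
    have "?B \<in> M" using B0 False by (intro rowM) (auto simp: piv_def)
    moreover have "?B s j0 \<noteq> 0 \<and> degree (?B s j0) = m"
      using B0 degree_eq_reduce[of "B0 i0 j0" "B0 s j0"] by (simp add: rowop_def piv_def)
    ultimately show ?thesis using that[of ?B] B0 sn' by (simp add: piv_def)
  qed (use B0 that in auto)
  obtain B2 where B2: "piv m B2 s s"
  proof (cases "j0 = s")
    case False
    let ?B = "colop (\<lambda>j. if j = s then 1 - B1 s s div B1 s j0 else 0) j0 B1"
    have "?B \<in> M" using B1 False by (intro colM) (auto simp: piv_def)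
    moreover have "?B s s \<noteq> 0 \<and> degree (?B s s) = m"
      using B1 degree_eq_reduce[of "B1 s j0" "B1 s s"] by (simp add: colop_def piv_def)
    ultimately show ?thesis using that[of ?B] B1 sn by (simp add: piv_def)
  qed (use B1 that in auto)
  have dvd_col: "B s s dvd B i s" if B: "piv m B s s" and i: "s \<le> i" "i < n" for B i
  proof (cases "i = s")
    case False
    let ?B = "rowop (\<lambda>i'. if i' = i then - (B i s div B s s) else 0) s B"
    have "?B \<in> M" using B i False by (intro rowM) (auto simp: piv_def)
    moreover have "?B i s = B i s mod B s s"
      by (simp add: rowop_def minus_div_mult_eq_mod[symmetric])
    ultimately have "B i s mod B s s = 0"
      using min[of ?B i s] degree_mod_less[of "B s s" "B i s"] B i sn by (fastforce simp: piv_def)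
    then show ?thesis by presburger
  qed simp
  have dvd_row: "B s s dvd B s j" if B: "piv m B s s" and j: "s \<le> j" "j < k" for B j
  proof (cases "j = s")
    case False
    let ?B = "colop (\<lambda>j'. if j' = j then - (B s j div B s s) else 0) s B"
    have "?B \<in> M" using B j False by (intro colM) (auto simp: piv_def)
    moreover have "?B s j = B s j mod B s s"
      by (simp add: colop_def minus_div_mult_eq_mod[symmetric])
    ultimately have "B s j mod B s s = 0"
      using min[of ?B s j] degree_mod_less[of "B s s" "B s j"] B j sn' by (fastforce simp: piv_def)
    then show ?thesis by presburger
  qed simp
  define B3 where "B3 = rowop (\<lambda>i. if s < i then - (B2 i s div B2 s s) else 0) s B2"
  have B3s: "B3 s s = B2 s s" by (simp add: B3_def rowop_def)
  have "B3 \<in> M" unfolding B3_def using B2 by (intro rowM) (auto simp: piv_def)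
  then have B3: "piv m B3 s s" using B2 B3s by (simp add: piv_def)
  have B3c: "B3 i s = 0" if "s < i" "i < n" for i
    using that dvd_col[OF B2, of i] by (simp add: B3_def rowop_def)
  define B4 where "B4 = colop (\<lambda>j. if s < j then - (B3 s j div B3 s s) else 0) s B3"
  have B4s: "B4 s s = B3 s s" by (simp add: B4_def colop_def)
  have B4M: "B4 \<in> M" unfolding B4_def using B3 by (intro colM) (auto simp: piv_def)
  then have B4: "piv m B4 s s" using B3 B4s by (simp add: piv_def)
  have B4c: "B4 i s = 0" if "s < i" "i < n" for i
    using that B3c by (simp add: B4_def colop_def)
  have B4r: "B4 s j = 0" if "s < j" "j < k" for j
    using that dvd_row[OF B3, of j] by (simp add: B4_def colop_def)
  have B4d: "B4 s s dvd B4 i j" if ij: "s \<le> i" "i < n" "s \<le> j" "j < k" for i j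
  proof (cases "i = s \<or> j = s")
    case True
    then show ?thesis using dvd_row[OF B4] dvd_col[OF B4] ij by auto
  next
    case False
    \<comment> \<open>Adding row \<open>i\<close> to row \<open>s\<close> brings the entry at
      \<open>(i, j)\<close> into the pivot row, where \<open>dvd_row\<close> applies. The pivot and
      its minimal degree stay, because column \<open>s\<close> is already clear.\<close>
    let ?B = "rowop (\<lambda>i'. if i' = s then 1 else 0) i B4"
    have "?B \<in> M" using B4M ij False by (intro rowM) auto
    moreover have "?B s s = B4 s s" using B4c[of i] ij False by (simp add: rowop_def)
    ultimately have "piv m ?B s s" using B4 by (simp add: piv_def)
    moreover have "?B s j = B4 i j" using B4r[of j] ij False by (simp add: rowop_def)
    ultimately show ?thesis using dvd_row[of ?B j] ij \<open>?B s s = B4 s s\<close> by simp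
  qed
  have st: "snf_upto n k s B4" using B4M by (simp add: M_def)
  have "snf_upto n k (Suc s) B4"
    unfolding snf_upto_def
  proof (intro conjI allI impI)
    fix i j assume "i < n" "j < k" "i \<noteq> j \<and> (i < Suc s \<or> j < Suc s)"
    then consider "i < s \<or> j < s" "i \<noteq> j" "i < n" "j < k" | "i = s" "s < j" "j < k" | "j = s" "s < i" "i < n" by linarith
    then show "B4 i j = 0" using st B4r B4c unfolding snf_upto_def by cases auto
  next
    fix t i j assume "t < Suc s" "i < n" "j < k" "t \<le> i \<and> t \<le> j"
    then show "B4 t t dvd B4 i j" using st B4d unfolding snf_upto_def
      by (cases "t = s") auto
  qed
  then show ?thesis using B4M by (auto simp: M_def)
qed

lemma snf_exists:
  fixes A :: "nat \<Rightarrow> nat \<Rightarrow> 'a::field_gcd poly"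
  assumes "k \<le> n"
  shows "\<exists>B. mat_equiv n k A B \<and> snf_upto n k k B"
proof -
  have "s \<le> k \<Longrightarrow> \<exists>B. mat_equiv n k A B \<and> snf_upto n k s B" for s
  proof (induction s)
    case 0
    then show ?case using mat_equiv.base[of n k A] by (auto simp: snf_upto_def)
  next
    case (Suc s)
    then obtain B where "mat_equiv n k A B" "snf_upto n k s B" by auto
    then show ?case using snf_step[of n k s B] Suc.prems assms mat_equiv_trans by (metis Suc_le_lessD)
  qed
  then show ?thesis by blast
qed

section \<open>Determinantal divisors\<close>

text \<open>The index functions may repeat and disorder lines, since expanding a combination of rows
  produces such minors. The determinantal divisor is then handled only through the polynomials
  \<open>m\<close> dividing all of them, never as an explicit gcd.\<close>

definition minor :: "nat \<Rightarrow> (nat \<Rightarrow> nat) \<Rightarrow> (nat \<Rightarrow> nat) \<Rightarrow> (nat \<Rightarrow> nat \<Rightarrow> 'a::comm_ring_1) \<Rightarrow> 'a" where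
  "minor i r c A = det (mat i i (\<lambda>(a, b). A (r a) (c b)))"

definition dvd_minors :: "nat \<Rightarrow> nat \<Rightarrow> nat \<Rightarrow> (nat \<Rightarrow> nat \<Rightarrow> 'a::comm_ring_1) \<Rightarrow> 'a \<Rightarrow> bool" where
  "dvd_minors n k i A m \<longleftrightarrow> (\<forall>r c. (\<forall>a<i. r a < n) \<longrightarrow> (\<forall>b<i. c b < k) \<longrightarrow> m dvd minor i r c A)"

lemma minor_transpose: "minor i r c A = minor i c r (\<lambda>a b. A b a)"
proof -
  have "mat i i (\<lambda>(a, b). A (r b) (c a)) = transpose_mat (mat i i (\<lambda>(a, b). A (r a) (c b)))"
    by (intro eq_matI) auto
  then show ?thesis unfolding minor_def by (simp add: det_transpose[of _ i])
qed

lemma dvd_minors_transpose: "dvd_minors n k i A m \<longleftrightarrow> dvd_minors k n i (\<lambda>a b. A b a) m"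
  unfolding dvd_minors_def minor_transpose[of i _ _ A] by blast

lemma permutes_atLeast0_less: "p permutes {0..<i} \<Longrightarrow> a < i \<Longrightarrow> p a < (i :: nat)"
  using permutes_in_image[of p "{0..<i}" a] by simp

lemma minor_leibniz:
  "minor i r c A = (\<Sum>p | p permutes {0..<i}. signof p * (\<Prod>a = 0..<i. A (r a) (c (p a))))"
  unfolding minor_def
  by (subst det_def'[of _ i]) (auto intro!: sum.cong prod.cong simp: permutes_atLeast0_less)

text \<open>The Leibniz expansion distributes over the sum, as in the Cauchy--Binet formula.\<close>
lemma minor_row_combination:
  assumes "\<And>a b. a < i \<Longrightarrow> b < i \<Longrightarrow> B (r a) (c b) = (\<Sum>l<n. P (r a) l * A l (c b))"
  shows "minor i r c B = (\<Sum>f\<in>{0..<i} \<rightarrow>\<^sub>E {..<n}. (\<Prod>a = 0..<i. P (r a) (f a)) * minor i f c A)"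
proof -
  have "minor i r c B = (\<Sum>p | p permutes {0..<i}. signof p * (\<Prod>a = 0..<i. \<Sum>l<n. P (r a) l * A l (c (p a))))"
    unfolding minor_leibniz using assms by (auto intro!: sum.cong prod.cong simp: permutes_atLeast0_less)
  also have "\<dots> = (\<Sum>p | p permutes {0..<i}. \<Sum>f\<in>{0..<i} \<rightarrow>\<^sub>E {..<n}.
      (\<Prod>a = 0..<i. P (r a) (f a)) * (signof p * (\<Prod>a = 0..<i. A (f a) (c (p a)))))"
    by (subst prod_sum_PiE) (auto simp: prod.distrib sum_distrib_left ac_simps)
  finally show ?thesis
    by (subst (asm) sum.swap) (simp add: minor_leibniz sum_distrib_left)
qed

lemma dvd_minors_rowop:
  assumes "dvd_minors n k i A m" "p < n"
  shows "dvd_minors n k i (rowop c p A) m"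
  unfolding dvd_minors_def
proof (intro allI impI)
  fix r s assume rs: "\<forall>a<i. r a < n" "\<forall>b<i. s b < k"
  \<comment> \<open>The matrix of the row operation: the identity with the vector \<open>c\<close>
    added to column \<open>p\<close>.\<close>
  define P where "P = (\<lambda>a l. (if l = a then 1 else 0) + (if l = p then c a else 0))"
  have "minor i r s (rowop c p A) = (\<Sum>f\<in>{0..<i} \<rightarrow>\<^sub>E {..<n}. (\<Prod>a = 0..<i. P (r a) (f a)) * minor i f s A)"
  proof (rule minor_row_combination)
    fix a b assume "a < i"
    then have "r a < n" using rs by blast
    moreover have "P (r a) l * A l (s b) = (if l = r a then A (r a) (s b) else 0) + (if l = p then c (r a) * A p (s b) else 0)" for l
      by (simp add: P_def distrib_right)
    ultimately show "rowop c p A (r a) (s b) = (\<Sum>l<n. P (r a) l * A l (s b))"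
      using assms(2) by (simp add: rowop_def sum.distrib)
  qed
  also have "m dvd \<dots>"
  proof (rule dvd_sum)
    fix f assume "f \<in> {0..<i} \<rightarrow>\<^sub>E {..<n}"
    then show "m dvd (\<Prod>a = 0..<i. P (r a) (f a)) * minor i f s A"
      using assms(1) rs unfolding dvd_minors_def by (intro dvd_mult) (auto simp: PiE_def Pi_def)
  qed
  finally show "m dvd minor i r s (rowop c p A)" .
qed

lemma dvd_minors_colop:
  assumes "dvd_minors n k i A m" "p < k"
  shows "dvd_minors n k i (colop c p A) m"
  using dvd_minors_rowop[of k n i "\<lambda>a b. A b a" m p c] assms
  by (simp add: dvd_minors_transpose[of n k] colop_transpose)

lemma dvd_minors_mat_equiv:
  assumes "mat_equiv n k A B"
  shows "dvd_minors n k i B m \<longleftrightarrow> dvd_minors n k i A m"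
  using assms
proof (induction rule: mat_equiv.induct)
  case (row B p c)
  then show ?case using dvd_minors_rowop rowop_inverse[of c p B] by metis
next
  case (col B p c)
  then show ?case using dvd_minors_colop colop_inverse[of c p B] by metis
qed simp

lemma pick_bij_betw:
  assumes "finite R"
  shows "bij_betw (pick R) {..<card R} R"
  unfolding bij_betw_def
proof
  show inj: "inj_on (pick R) {..<card R}"
    by (rule linorder_inj_onI) (use pick_mono_le[of _ R] in \<open>force+\<close>)
  have "pick R ` {..<card R} \<subseteq> R" using pick_in_set_le by auto
  then show "pick R ` {..<card R} = R"
    using assms inj by (intro card_subset_eq) (auto simp: card_image)
qed

lemma pick_ge: "a < card R \<Longrightarrow> a \<le> pick R a"
proof (induction a)
  case (Suc a)
  then have "pick R a < pick R (Suc a)" by (intro pick_mono_le) auto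
  then show ?case using Suc by simp
qed simp

text \<open>A minor with arbitrary row indices vanishes or is, up to sign, one with increasing row indices.\<close>
lemma dvd_minor_rows:
  assumes dvd: "\<And>R. R \<subseteq> {..<n} \<Longrightarrow> card R = i \<Longrightarrow> m dvd minor i (pick R) c A"
    and r: "\<And>a. a < i \<Longrightarrow> r a < n"
  shows "m dvd minor i r c A"
proof (cases "inj_on r {..<i}")
  case True
  define R where "R = r ` {..<i}"
  have R: "R \<subseteq> {..<n}" "card R = i" "finite R" using r True by (auto simp: R_def card_image)
  define s where "s = inv_into {..<i} (pick R)"
  have s: "bij_betw s R {..<i}"
    using bij_betw_inv_into[OF pick_bij_betw[OF R(3)]] by (simp add: R(2) s_def)
  have pick_s: "pick R (s x) = x" if "x \<in> R" for x
    using bij_betw_inv_into_right[OF pick_bij_betw[OF R(3)] that] by (simp add: R(2) s_def)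
  define p where "p = (\<lambda>a. if a < i then s (r a) else a)"
  have "bij_betw (s \<circ> r) {..<i} {..<i}"
    using True s by (intro bij_betw_trans[of _ _ R]) (auto simp: R_def bij_betw_def)
  then have "bij_betw p {0..<i} {0..<i}"
    by (subst bij_betw_cong[where g = "s \<circ> r"]) (auto simp: p_def lessThan_atLeast0)
  then have p: "p permutes {0..<i}" by (rule bij_imp_permutes) (auto simp: p_def)
  have "minor i r c A = det (mat i i (\<lambda>(a, b). mat i i (\<lambda>(a, b). A (pick R a) (c b)) $$ (p a, b)))"
    unfolding minor_def
  proof (intro arg_cong[where f = det] eq_matI)
    fix a b assume ab: "a < dim_row (mat i i (\<lambda>(a, b). mat i i (\<lambda>(a, b). A (pick R a) (c b)) $$ (p a, b)))"
      "b < dim_col (mat i i (\<lambda>(a, b). mat i i (\<lambda>(a, b). A (pick R a) (c b)) $$ (p a, b)))"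
    have "p a < i" using permutes_atLeast0_less[OF p] ab by simp
    moreover have "pick R (p a) = r a" using ab pick_s by (simp add: p_def R_def)
    ultimately show "mat i i (\<lambda>(a, b). A (r a) (c b)) $$ (a, b) =
        mat i i (\<lambda>(a, b). mat i i (\<lambda>(a, b). A (pick R a) (c b)) $$ (p a, b)) $$ (a, b)"
      using ab by simp
  qed auto
  also have "\<dots> = signof p * minor i (pick R) c A"
    unfolding minor_def by (rule det_permute_rows[OF _ p]) simp
  finally show ?thesis using dvd[OF R(1,2)] by simp
next
  case False
  then obtain a b where ab: "a < i" "b < i" "a \<noteq> b" "r a = r b" by (auto simp: inj_on_def)
  have "minor i r c A = 0"
    unfolding minor_def by (rule det_identical_rows[of _ i a b]) (use ab in \<open>auto intro!: eq_vecI\<close>)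
  then show ?thesis by simp
qed

lemma det_submatrix_mat:
  assumes "R \<subseteq> {..<n}" "C \<subseteq> {..<k}" "card R = i" "card C = i"
  shows "det (submatrix (mat n k (\<lambda>(i, j). A i j)) R C) = minor i (pick R) (pick C) A"
proof -
  have *: "{i. i < n \<and> i \<in> R} = R" "{j. j < k \<and> j \<in> C} = C" using assms by auto
  have "pick R a < n" "pick C a < k" if "a < i" for a
    using that assms pick_in_set_le[of a R] pick_in_set_le[of a C] by auto
  then show ?thesis
    unfolding submatrix_def minor_def using assms
    by (intro arg_cong[where f = det] eq_matI) (auto simp: *)
qed

text \<open>The definition selects increasing rows and columns. Arbitrary index functions are
  reached by \<open>dvd_minor_rows\<close>, applied once to the rows and, after transposition, once
  to the columns.\<close>

lemma dvd_det_divisor_iff: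
  fixes A :: "nat \<Rightarrow> nat \<Rightarrow> 'a::field_gcd poly"
  shows "m dvd det_divisor (mat n k (\<lambda>(i, j). A i j)) i \<longleftrightarrow> dvd_minors n k i A m"
proof -
  let ?Q = "\<forall>R C. R \<subseteq> {..<n} \<longrightarrow> C \<subseteq> {..<k} \<longrightarrow> card R = i \<longrightarrow> card C = i \<longrightarrow> m dvd minor i (pick R) (pick C) A"
  have "m dvd det_divisor (mat n k (\<lambda>(i, j). A i j)) i \<longleftrightarrow>
      ?Q"
  proof -
    have all: "(\<forall>y\<in>{f R C | R C. Q R C}. m dvd y) \<longleftrightarrow> (\<forall>R C. Q R C \<longrightarrow> m dvd f R C)"
      for f :: "nat set \<Rightarrow> nat set \<Rightarrow> 'a poly" and Q by blast
    have "m dvd det_divisor (mat n k (\<lambda>(i, j). A i j)) i \<longleftrightarrow>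
      (\<forall>R C. R \<subseteq> {..<n} \<longrightarrow> C \<subseteq> {..<k} \<longrightarrow> card R = i \<longrightarrow> card C = i \<longrightarrow>
        m dvd det (submatrix (mat n k (\<lambda>(i, j). A i j)) R C))"
      unfolding det_divisor_def dvd_Gcd_iff all by simp blast
    then show ?thesis by (simp add: det_submatrix_mat)
  qed
  also have "\<dots> \<longleftrightarrow> dvd_minors n k i A m"
  proof
    assume *: "?Q"
    show "dvd_minors n k i A m"
      unfolding dvd_minors_def
    proof (intro allI impI)
      fix r c assume rc: "\<forall>a<i. r a < n" "\<forall>b<i. c b < k"
      show "m dvd minor i r c A"
      proof (rule dvd_minor_rows[of n])
        fix R assume R: "R \<subseteq> {..<n}" "card R = i"
        show "m dvd minor i (pick R) c A"
          unfolding minor_transpose[of i "pick R"]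
        proof (rule dvd_minor_rows[of k])
          fix C assume "C \<subseteq> {..<k}" "card C = i"
          then show "m dvd minor i (pick C) (pick R) (\<lambda>a b. A b a)"
            using * R by (simp flip: minor_transpose[of i "pick R"])
        qed (use rc in auto)
      qed (use rc in auto)
    qed
  next
    assume *: "dvd_minors n k i A m"
    have "pick R a < n" if "R \<subseteq> {..<n}" "card R = i" "a < i" for R n a
      using that pick_in_set_le[of a R] by auto
    then show "?Q"
      using *[unfolded dvd_minors_def, THEN spec, THEN spec] by simp
  qed
  finally show ?thesis .
qed

lemma det_divisor_mat_equiv:
  fixes A B :: "nat \<Rightarrow> nat \<Rightarrow> 'a::field_gcd poly"
  assumes "mat_equiv n k A B"
  shows "det_divisor (mat n k (\<lambda>(i, j). A i j)) i = det_divisor (mat n k (\<lambda>(i, j). B i j)) i"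
proof (rule associated_eqI)
  have *: "m dvd det_divisor (mat n k (\<lambda>(i, j). A i j)) i \<longleftrightarrow> m dvd det_divisor (mat n k (\<lambda>(i, j). B i j)) i" for m
    by (simp only: dvd_det_divisor_iff dvd_minors_mat_equiv[OF assms])
  show "det_divisor (mat n k (\<lambda>(i, j). A i j)) i dvd det_divisor (mat n k (\<lambda>(i, j). B i j)) i"
    by (simp only: *[symmetric] dvd_refl)
  show "det_divisor (mat n k (\<lambda>(i, j). B i j)) i dvd det_divisor (mat n k (\<lambda>(i, j). A i j)) i"
    by (simp only: * dvd_refl)
qed (simp_all add: det_divisor_def)

text \<open>The leading principal minor is the product of the first \<open>i\<close> diagonal
  entries. Conversely, each factor of a Leibniz term is 0 or some \<open>D b b\<close> with
  \<open>b = pick R a\<close>; the \<open>a\<close>-th smallest element of \<open>R\<close> is at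
  least \<open>a\<close>, so \<open>D a a\<close> divides it.\<close>

lemma det_divisor_diagonal:
  fixes D :: "nat \<Rightarrow> nat \<Rightarrow> 'a::field_gcd poly"
  assumes D: "snf_upto n k k D" and ik: "i \<le> k" "k \<le> n"
  shows "det_divisor (mat n k (\<lambda>(i, j). D i j)) i = normalize (\<Prod>a<i. D a a)"
proof (rule associated_eqI)
  let ?g = "det_divisor (mat n k (\<lambda>(i, j). D i j)) i"
  have diag: "D a b = 0" if "a < n" "b < k" "a \<noteq> b" for a b
    using D that by (auto simp: snf_upto_def)
  have chain: "D a a dvd D b b" if "a \<le> b" "b < k" for a b
    using D that ik by (auto simp: snf_upto_def)
  have "?g dvd minor i id id D"
    using dvd_det_divisor_iff[of ?g n k D i] ik by (auto simp: dvd_minors_def)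
  also have "minor i id id D = (\<Prod>a<i. D a a)"
  proof -
    have "upper_triangular (mat i i (\<lambda>(a, b). D a b))" using diag ik by auto
    then show ?thesis unfolding minor_def
      by (simp add: det_upper_triangular[of _ i] prod_list_diag_prod lessThan_atLeast0)
  qed
  finally show "?g dvd normalize (\<Prod>a<i. D a a)" by simp
  have "(\<Prod>a<i. D a a) dvd det (submatrix (mat n k (\<lambda>(i, j). D i j)) R C)"
    if RC: "R \<subseteq> {..<n}" "C \<subseteq> {..<k}" "card R = i" "card C = i" for R C
    unfolding det_submatrix_mat[OF RC] minor_leibniz
  proof (intro dvd_sum dvd_mult)
    fix p assume "p \<in> {p. p permutes {0..<i}}"
    then have p: "p a < i" if "a < i" for a using that permutes_atLeast0_less by blast
    have R': "pick R a < n" "pick C a < k" if "a < i" for a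
      using that RC pick_in_set_le[of a R] pick_in_set_le[of a C] by auto
    show "(\<Prod>a<i. D a a) dvd (\<Prod>a = 0..<i. D (pick R a) (pick C (p a)))"
      unfolding lessThan_atLeast0
    proof (rule prod_dvd_prod)
      fix a assume "a \<in> {0..<i}"
      then have a: "a < i" by simp
      show "D a a dvd D (pick R a) (pick C (p a))"
      proof (cases "pick R a = pick C (p a)")
        case True
        then show ?thesis using chain[of a "pick R a"] pick_ge[of a R] a RC R'(2)[OF p[OF a]] by simp
      qed (use diag R' a p in auto)
    qed
  qed
  then show "normalize (\<Prod>a<i. D a a) dvd ?g"
    unfolding det_divisor_def by (auto intro!: Gcd_greatest)
qed (simp_all add: det_divisor_def)

section \<open>Solutions of polynomial systems modulo a polynomial\<close>

text \<open>The canonical residues modulo a polynomial of degree \<open>D\<close>. Stated by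
  coefficients because the condition \<open>degree p < D\<close> would lose the zero polynomial when
  \<open>D = 0\<close>.\<close>

definition polys_below :: "nat \<Rightarrow> 'a::zero poly set" where
  "polys_below D = {p. \<forall>i\<ge>D. coeff p i = 0}"

lemma polys_below_iff: "p \<in> polys_below D \<longleftrightarrow> p = 0 \<or> degree p < D"
proof -
  have "coeff p i = 0" if "degree p < D" "i \<ge> D" for i using that by (intro coeff_eq_0) simp
  moreover have "degree p < D" if "\<forall>i\<ge>D. coeff p i = 0" "p \<noteq> 0"
    using that leading_coeff_0_iff not_less by blast
  ultimately show ?thesis by (auto simp: polys_below_def)
qed

lemma mod_polys_below: "g \<noteq> 0 \<Longrightarrow> p mod g \<in> polys_below (degree g)" for g :: "'a::field poly"
  using degree_mod_less[of g p] by (auto simp: polys_below_iff)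

lemma polys_below_mod: "p \<in> polys_below (degree g) \<Longrightarrow> p mod g = p" for g :: "'a::field poly"
  by (auto simp: polys_below_iff mod_poly_less)

lemma polys_below_bij_betw:
  "bij_betw (\<lambda>p. restrict (coeff p) {..<D}) (polys_below D) ({..<D} \<rightarrow>\<^sub>E (UNIV :: 'a::comm_monoid_add set))"
proof -
  have c: "coeff (\<Sum>i<D. monom (f i) i) j = (if j < D then f j else 0)" for f :: "nat \<Rightarrow> 'a" and j
    by (simp add: coeff_sum)
  show ?thesis
    unfolding bij_betw_def
  proof
    show "inj_on (\<lambda>p. restrict (coeff p) {..<D}) (polys_below D :: 'a poly set)"
    proof (rule inj_onI)
      fix p r :: "'a poly"
      assume *: "p \<in> polys_below D" "r \<in> polys_below D" "restrict (coeff p) {..<D} = restrict (coeff r) {..<D}"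
      show "p = r"
      proof (rule poly_eqI)
        fix i show "coeff p i = coeff r i"
          using *(1,2) fun_cong[OF *(3), of i] by (cases "i < D") (auto simp: polys_below_def)
      qed
    qed
    have "f \<in> (\<lambda>p. restrict (coeff p) {..<D}) ` polys_below D" if f: "f \<in> {..<D} \<rightarrow>\<^sub>E (UNIV :: 'a set)" for f
    proof
      have "f i = restrict (coeff (\<Sum>i<D. monom (f i) i)) {..<D} i" for i
        using f PiE_arb[OF f, of i] by (simp add: c)
      then show "f = restrict (coeff (\<Sum>i<D. monom (f i) i)) {..<D}" by blast
      show "(\<Sum>i<D. monom (f i) i) \<in> polys_below D" by (simp add: polys_below_def c)
    qed
    moreover have "restrict (coeff p) {..<D} \<in> {..<D} \<rightarrow>\<^sub>E (UNIV :: 'a set)" for p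
      by (simp add: restrict_PiE_iff)
    ultimately show "(\<lambda>p. restrict (coeff p) {..<D}) ` polys_below D = {..<D} \<rightarrow>\<^sub>E (UNIV :: 'a set)" by blast
  qed
qed

lemma card_polys_below:
  "card (polys_below D :: 'a::{comm_monoid_add,finite} poly set) = card (UNIV :: 'a set) ^ D"
  using bij_betw_same_card[OF polys_below_bij_betw[where 'a = 'a], of D] by (simp add: card_PiE)

text \<open>With \<open>h = gcd g m\<close>, the condition says that \<open>m / h\<close> divides
  \<open>a\<close>. The multiples of \<open>m / h\<close> of degree below \<open>degree m\<close>
  are parametrised by their cofactors, the polynomials of degree below
  \<open>degree h\<close>.\<close>

lemma card_annihilator:
  fixes m g :: "'a::{field_gcd,finite} poly"
  assumes "m \<noteq> 0"
  shows "card {a \<in> polys_below (degree m). m dvd g * a} = card (UNIV :: 'a set) ^ degree (gcd g m)"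
proof -
  define h where "h = gcd g m"
  have "h \<noteq> 0" using assms by (simp add: h_def)
  obtain g' m' where gm: "g = g' * h" "m = m' * h" "coprime g' m'"
    using gcd_coprime_exists[of g m] \<open>h \<noteq> 0\<close> unfolding h_def by blast
  have m': "m' \<noteq> 0" using assms gm by auto
  have deg: "degree m = degree m' + degree h" using gm(2) m' \<open>h \<noteq> 0\<close> by (simp add: degree_mult_eq)
  have iff: "m dvd g * a \<longleftrightarrow> m' dvd a" for a
  proof -
    have "m dvd g * a \<longleftrightarrow> m' * h dvd (g' * a) * h" by (simp add: gm(1,2) ac_simps)
    also have "\<dots> \<longleftrightarrow> m' dvd g' * a" using \<open>h \<noteq> 0\<close> dvd_mult_cancel_right[of m' h "g' * a"] by simp
    also have "\<dots> \<longleftrightarrow> m' dvd a" using gm(3) by (simp add: coprime_commute coprime_dvd_mult_right_iff)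
    finally show ?thesis .
  qed
  have "{a \<in> polys_below (degree m). m dvd g * a} = (*) m' ` polys_below (degree h)"
  proof (intro subset_antisym subsetI)
    fix a assume a: "a \<in> {a \<in> polys_below (degree m). m dvd g * a}"
    then obtain b where b: "a = m' * b" using iff by (auto elim: dvdE)
    then show "a \<in> (*) m' ` polys_below (degree h)"
      using a m' deg by (cases "b = 0") (auto simp: polys_below_iff degree_mult_eq)
  next
    fix a assume "a \<in> (*) m' ` polys_below (degree h)"
    then obtain b where "a = m' * b" "b \<in> polys_below (degree h)" by blast
    then show "a \<in> {a \<in> polys_below (degree m). m dvd g * a}"
      using m' deg iff by (cases "b = 0") (auto simp: polys_below_iff degree_mult_eq)
  qed
  moreover have "inj_on ((*) m') (polys_below (degree h))" using m' by (auto intro: inj_onI)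
  ultimately show ?thesis by (simp add: card_image card_polys_below h_def)
qed

text \<open>The kernel of \<open>A\<close> over the ring of polynomials modulo \<open>g\<close>,
  with residues as representatives so that the set is finite.\<close>

definition mod_solutions :: "nat \<Rightarrow> nat \<Rightarrow> 'a::field_gcd poly \<Rightarrow> (nat \<Rightarrow> nat \<Rightarrow> 'a poly) \<Rightarrow> (nat \<Rightarrow> 'a poly) set" where
  "mod_solutions n k g A =
     {v \<in> {..<k} \<rightarrow>\<^sub>E polys_below (degree g). \<forall>i<n. g dvd (\<Sum>j<k. A i j * v j)}"

lemma mod_solutions_rowop:
  assumes "p < n" "c p = 0"
  shows "mod_solutions n k g (rowop c p A) = mod_solutions n k g A"
proof -
  have sub: "mod_solutions n k g A \<subseteq> mod_solutions n k g (rowop c p A)"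
    if "c p = 0" for c and A :: "nat \<Rightarrow> nat \<Rightarrow> 'a poly"
  proof
    fix v assume v: "v \<in> mod_solutions n k g A"
    have "g dvd (\<Sum>j<k. rowop c p A i j * v j)" if "i < n" for i
    proof -
      have "(\<Sum>j<k. rowop c p A i j * v j) = (\<Sum>j<k. A i j * v j) + c i * (\<Sum>j<k. A p j * v j)"
        by (simp add: rowop_def algebra_simps sum.distrib sum_distrib_left)
      then show ?thesis using v that assms(1) by (simp add: mod_solutions_def)
    qed
    then show "v \<in> mod_solutions n k g (rowop c p A)" using v by (simp add: mod_solutions_def)
  qed
  show ?thesis
    using sub[of c A] sub[of "\<lambda>i. - c i" "rowop c p A"] assms(2) rowop_inverse[of c p A] by auto
qed

text \<open>A column operation is a change of variables: \<open>v p\<close> is replaced by the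
  residue of \<open>v p\<close> plus the combination of the other variables given by
  \<open>c\<close>. As \<open>c p = 0\<close>, that combination is not affected by the change, and
  the operation with \<open>- c\<close> is the inverse.\<close>

lemma card_mod_solutions_colop:
  fixes A :: "nat \<Rightarrow> nat \<Rightarrow> 'a::field_gcd poly"
  assumes p: "p < k" "c p = 0" and g: "g \<noteq> 0"
  shows "card (mod_solutions n k g (colop c p A)) = card (mod_solutions n k g A)"
proof -
  define F where "F = (\<lambda>(c :: nat \<Rightarrow> 'a poly) (v :: nat \<Rightarrow> 'a poly). v(p := (v p + (\<Sum>j<k. c j * v j)) mod g))"
  have sum_F: "(\<Sum>j<k. B j * F d v j) mod g = (\<Sum>j<k. (B j + d j * B p) * v j) mod g"
    for B d v
  proof -
    have "(\<Sum>j<k. B j * F d v j) = B p * ((v p + (\<Sum>j<k. d j * v j)) mod g) + (\<Sum>j\<in>{..<k}-{p}. B j * v j)"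
      using p by (subst sum.remove[of _ p]) (auto simp: F_def)
    also have "\<dots> mod g = (B p * (v p + (\<Sum>j<k. d j * v j)) + (\<Sum>j\<in>{..<k}-{p}. B j * v j)) mod g"
      by (intro mod_add_cong mod_mult_cong) simp_all
    also have "B p * (v p + (\<Sum>j<k. d j * v j)) + (\<Sum>j\<in>{..<k}-{p}. B j * v j) =
        (\<Sum>j<k. B j * v j) + B p * (\<Sum>j<k. d j * v j)"
      using p sum.remove[of "{..<k}" p "\<lambda>j. B j * v j"] by (simp add: distrib_left)
    also have "\<dots> = (\<Sum>j<k. (B j + d j * B p) * v j)"
      by (simp add: algebra_simps sum.distrib sum_distrib_left)
    finally show ?thesis .
  qed
  have F_in: "F d v \<in> {..<k} \<rightarrow>\<^sub>E polys_below (degree g)" if "v \<in> {..<k} \<rightarrow>\<^sub>E polys_below (degree g)" for d v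
    using that p mod_polys_below[OF g] by (auto simp: F_def PiE_def Pi_def extensional_def)
  have F_F: "F (\<lambda>j. - d j) (F d v) = v" if v: "v \<in> {..<k} \<rightarrow>\<^sub>E polys_below (degree g)" and d: "d p = 0" for d v
  proof -
    have "(\<Sum>j<k. d j * F d v j) = (\<Sum>j<k. d j * v j)"
      using d by (intro sum.cong) (auto simp: F_def)
    then have "F (\<lambda>j. - d j) (F d v) p = v p mod g"
      by (simp add: F_def sum_negf mod_diff_left_eq)
    also have "\<dots> = v p" using v p by (intro polys_below_mod) auto
    finally show ?thesis by (auto simp: F_def)
  qed
  have "bij_betw (F c) (mod_solutions n k g (colop c p A)) (mod_solutions n k g A)"
  proof (rule bij_betw_byWitness[where f' = "F (\<lambda>j. - c j)"])
    show "\<forall>v\<in>mod_solutions n k g (colop c p A). F (\<lambda>j. - c j) (F c v) = v"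
      using F_F p by (simp add: mod_solutions_def)
    show "\<forall>v\<in>mod_solutions n k g A. F c (F (\<lambda>j. - c j) v) = v"
      using F_F[of _ "\<lambda>j. - c j"] p by (simp add: mod_solutions_def)
    have e1: "(\<Sum>j<k. A i j * F c v j) mod g = (\<Sum>j<k. colop c p A i j * v j) mod g" for i v
      using sum_F[of "A i" c v] by (simp add: colop_def)
    show "F c ` mod_solutions n k g (colop c p A) \<subseteq> mod_solutions n k g A"
      by (simp add: image_subset_iff mod_solutions_def dvd_eq_mod_eq_0 e1 F_in)
    have e2: "(\<Sum>j<k. colop c p A i j * F (\<lambda>j. - c j) v j) mod g = (\<Sum>j<k. A i j * v j) mod g" for i v
      using sum_F[of "colop c p A i" "\<lambda>j. - c j" v] p by (simp add: colop_def)
    show "F (\<lambda>j. - c j) ` mod_solutions n k g A \<subseteq> mod_solutions n k g (colop c p A)"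
      by (simp add: image_subset_iff mod_solutions_def dvd_eq_mod_eq_0 e2 F_in)
  qed
  then show ?thesis by (rule bij_betw_same_card)
qed

lemma card_mod_solutions_mat_equiv:
  fixes A B :: "nat \<Rightarrow> nat \<Rightarrow> 'a::field_gcd poly"
  assumes "mat_equiv n k A B" "g \<noteq> 0"
  shows "card (mod_solutions n k g B) = card (mod_solutions n k g A)"
  using assms(1)
  by (induction rule: mat_equiv.induct) (simp_all add: mod_solutions_rowop card_mod_solutions_colop assms(2))

text \<open>The system decouples into \<open>g dvd D j j * v j\<close> for each \<open>j\<close>,
  and the rows from \<open>k\<close> on are empty. Each condition is counted by
  \<open>card_annihilator\<close>, the modulus now being \<open>g\<close>.\<close>

lemma card_mod_solutions_diagonal:
  fixes D :: "nat \<Rightarrow> nat \<Rightarrow> 'a::{field_gcd,finite} poly"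
  assumes D: "snf_upto n k k D" and kn: "k \<le> n" and g: "g \<noteq> 0"
  shows "card (mod_solutions n k g D) = card (UNIV :: 'a set) ^ (\<Sum>j<k. degree (gcd (D j j) g))"
proof -
  have row: "(\<Sum>j<k. D i j * v j) = (if i < k then D i i * v i else 0)" if "i < n" for i v
  proof -
    have "(\<Sum>j<k. D i j * v j) = (\<Sum>j<k. if j = i then D i i * v i else 0)"
      using D that by (intro sum.cong) (auto simp: snf_upto_def)
    then show ?thesis by simp
  qed
  have "mod_solutions n k g D = (\<Pi>\<^sub>E j\<in>{..<k}. {a \<in> polys_below (degree g). g dvd D j j * a})"
    using kn unfolding mod_solutions_def by (auto simp: row PiE_def Pi_def)
  then show ?thesis by (simp add: card_PiE card_annihilator g power_sum)
qed

section \<open>Subspaces and maximal invariant subspaces\<close>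

locale finite_field_space = vector_space scale
  for scale :: "'a::{field_gcd,finite} \<Rightarrow> 'v::ab_group_add \<Rightarrow> 'v" +
  fixes q :: nat
  assumes q: "q = card (UNIV :: 'a set)"
begin

lemma q_ge_2: "q \<ge> 2"
proof -
  have "card {0::'a, 1} \<le> q" unfolding q by (rule card_mono) auto
  then show ?thesis by simp
qed

lemma scale_diff_in_span_insert:
  assumes "subspace W" "x \<in> span (insert w W)"
  obtains c where "x - scale c w \<in> W"
  using assms by (auto simp: span_insert span_eq_iff[THEN iffD2])

lemma scale_diff_unique:
  assumes "subspace W" "w \<notin> W" "x - scale c w \<in> W" "x - scale c' w \<in> W"
  shows "c = c'"
proof (rule ccontr)
  assume "c \<noteq> c'"
  have "(x - scale c' w) - (x - scale c w) \<in> W" using assms by (metis subspace_diff)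
  then have "scale (c - c') w \<in> W" by (simp add: algebra_simps)
  then have "scale (inverse (c - c')) (scale (c - c') w) \<in> W" using assms(1) by (rule subspace_scale[rotated])
  then show False using \<open>c \<noteq> c'\<close> assms(2) by simp
qed

text \<open>On the span of \<open>W\<close> and \<open>w\<close> this is the linear functional with
  kernel \<open>W\<close> and value 1 at \<open>w\<close>.\<close>

definition coord :: "'v set \<Rightarrow> 'v \<Rightarrow> 'v \<Rightarrow> 'a" where
  "coord W w x = (THE c. x - scale c w \<in> W)"

lemma coord_eqI:
  assumes "subspace W" "w \<notin> W" "x - scale c w \<in> W"
  shows "coord W w x = c"
  unfolding coord_def using assms scale_diff_unique by blast

lemma coord_mem:
  assumes "subspace W" "w \<notin> W" "x \<in> span (insert w W)"
  shows "x - scale (coord W w x) w \<in> W"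
  using assms coord_eqI scale_diff_in_span_insert by metis

lemma coord_add:
  assumes "subspace W" "w \<notin> W" "x \<in> span (insert w W)" "y \<in> span (insert w W)"
  shows "coord W w (x + y) = coord W w x + coord W w y"
proof (rule coord_eqI[OF assms(1,2)])
  have "(x - scale (coord W w x) w) + (y - scale (coord W w y) w) \<in> W"
    by (intro subspace_add coord_mem assms)
  then show "x + y - scale (coord W w x + coord W w y) w \<in> W" by (simp add: algebra_simps)
qed

lemma coord_scale:
  assumes "subspace W" "w \<notin> W" "x \<in> span (insert w W)"
  shows "coord W w (scale c x) = c * coord W w x"
proof (rule coord_eqI[OF assms(1,2)])
  have "scale c (x - scale (coord W w x) w) \<in> W"
    by (intro subspace_scale coord_mem assms)
  then show "scale c x - scale (c * coord W w x) w \<in> W" by (simp add: algebra_simps)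
qed

lemma coord_of_mem: "subspace W \<Longrightarrow> w \<notin> W \<Longrightarrow> x \<in> W \<Longrightarrow> coord W w x = 0"
  by (rule coord_eqI) auto

lemma coord_eq_0_iff:
  assumes "subspace W" "w \<notin> W" "x \<in> span (insert w W)"
  shows "coord W w x = 0 \<longleftrightarrow> x \<in> W"
  using coord_mem[OF assms] coord_of_mem[OF assms(1,2)] by fastforce

lemma coord_self: "subspace W \<Longrightarrow> w \<notin> W \<Longrightarrow> coord W w w = 1"
  by (rule coord_eqI) (auto simp: subspace_0)

text \<open>The \<open>q\<close> level sets of the functional on \<open>X\<close> are translates of
  each other by multiples of \<open>x1\<close>.\<close>

lemma card_subspace_hyperplane:
  assumes X: "subspace X" "X \<subseteq> span (insert w W)" and W: "subspace W" "w \<notin> W" and x1: "x1 \<in> X" "coord W w x1 = 1"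
  shows "card X = q * card {x\<in>X. coord W w x = 1}"
proof -
  note inS = subsetD[OF X(2)]
  define f where "f = (\<lambda>(c, x). x - x1 + scale c x1)"
  have co: "coord W w (x - x1 + scale c x1) = c" if "x \<in> X" "coord W w x = 1" for x c
  proof -
    have "coord W w (x + scale (c - 1) x1) = c"
      using that x1 inS X(1) W by (simp add: coord_add coord_scale span_scale)
    then show ?thesis by (simp add: algebra_simps)
  qed
  have "bij_betw f (UNIV \<times> {x\<in>X. coord W w x = 1}) X"
  proof (rule bij_betw_byWitness[where f' = "\<lambda>z. (coord W w z, z - scale (coord W w z) x1 + x1)"])
    show "\<forall>a\<in>UNIV \<times> {x \<in> X. coord W w x = 1}. (coord W w (f a), f a - scale (coord W w (f a)) x1 + x1) = a"
      by (auto simp: f_def co)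
    show "\<forall>a'\<in>X. f (coord W w a', a' - scale (coord W w a') x1 + x1) = a'"
      by (auto simp: f_def)
    show "f ` (UNIV \<times> {x \<in> X. coord W w x = 1}) \<subseteq> X"
      using x1 X(1) by (auto simp: f_def intro!: subspace_add subspace_diff subspace_scale)
    have "coord W w (z - scale (coord W w z) x1 + x1) = 1" if "z \<in> X" for z
    proof -
      have "coord W w (z + scale (1 - coord W w z) x1) = 1"
        using that x1 inS X(1) W by (simp add: coord_add coord_scale span_scale)
      then show ?thesis by (simp add: algebra_simps)
    qed
    then show "(\<lambda>z. (coord W w z, z - scale (coord W w z) x1 + x1)) ` X \<subseteq> UNIV \<times> {x \<in> X. coord W w x = 1}"
      using x1 X(1) by (auto intro!: subspace_add subspace_diff subspace_scale)
  qed
  from bij_betw_same_card[OF this] show ?thesis by (simp add: card_cartesian_product q)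
qed

lemma finite_span_insert:
  assumes "subspace W" "finite W" "w \<notin> W"
  shows "finite (span (insert w W))"
proof (rule finite_surj[where f = "\<lambda>(c, x). x + scale c w" and A = "UNIV \<times> W"])
  show "span (insert w W) \<subseteq> (\<lambda>(c, x). x + scale c w) ` (UNIV \<times> W)"
  proof
    fix z assume "z \<in> span (insert w W)"
    then have "z - scale (coord W w z) w \<in> W" using assms coord_mem by blast
    then show "z \<in> (\<lambda>(c, x). x + scale c w) ` (UNIV \<times> W)"
      by (intro rev_image_eqI[of "(coord W w z, z - scale (coord W w z) w)"]) auto
  qed
qed (use assms in auto)

lemma card_coord_1:
  assumes "subspace W" "w \<notin> W"
  shows "card {x \<in> span (insert w W). coord W w x = 1} = card W"
proof -
  have "bij_betw (\<lambda>x. x + w) W {x \<in> span (insert w W). coord W w x = 1}"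
  proof (rule bij_betw_byWitness[where f' = "\<lambda>x. x - w"])
    show "(\<lambda>x. x + w) ` W \<subseteq> {x \<in> span (insert w W). coord W w x = 1}"
      using assms by (auto intro!: coord_eqI) (metis insertCI span_add span_base)
    show "(\<lambda>x. x - w) ` {x \<in> span (insert w W). coord W w x = 1} \<subseteq> W"
      using coord_mem[OF assms] by force
  qed auto
  from bij_betw_same_card[OF this] show ?thesis by simp
qed

lemma card_span_insert:
  assumes "subspace W" "w \<notin> W"
  shows "card (span (insert w W)) = q * card W"
  using card_subspace_hyperplane[OF subspace_span order_refl assms, of w] card_coord_1[OF assms]
    coord_self[OF assms] by (simp add: span_base)

lemma card_span_independent:
  assumes "finite B" "independent B"
  shows "finite (span B) \<and> card (span B) = q ^ card B"
  using assms
proof (induction B)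
  case (insert b B)
  from insert have "independent B" "b \<notin> span B"
    using independent_insert by auto
  moreover have "span (insert b B) = span (insert b (span B))"
    by (simp add: span_insert span_span)
  ultimately show ?case using insert.IH insert.hyps
    by (simp add: card_span_insert finite_span_insert)
qed auto

lemma subspace_card_dim:
  assumes "subspace V" "finite V"
  shows "card V = q ^ dim V"
proof -
  obtain B where B: "B \<subseteq> V" "independent B" "V \<subseteq> span B" "card B = dim V"
    using basis_exists by blast
  then have "span B = V" using assms(1) span_minimal by blast
  moreover have "finite B" using B(1) assms(2) finite_subset by blast
  ultimately show ?thesis using card_span_independent B by metis
qed

text \<open>The orbit description makes it evident that a largest invariant subspace exists.\<close>
definition inv_part :: "'v set \<Rightarrow> ('v \<Rightarrow> 'v) \<Rightarrow> 'v set" where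
  "inv_part W T = {x. \<forall>i. (T ^^ i) x \<in> W}"

lemma lin_WV_simps:
  assumes "lin_WV scale W V T"
  shows "x \<in> W \<Longrightarrow> T x \<in> V" "x \<in> W \<Longrightarrow> y \<in> W \<Longrightarrow> T (x + y) = T x + T y"
    "x \<in> W \<Longrightarrow> T (scale c x) = scale c (T x)" "x \<notin> W \<Longrightarrow> T x = 0"
  using assms unfolding lin_WV_def by blast+

lemma lin_WV_0: "subspace W \<Longrightarrow> lin_WV scale W V T \<Longrightarrow> T 0 = 0"
  by (metis lin_WV_simps(3) scale_zero_left subspace_0)

lemma finite_lin_WV:
  assumes "finite W" "finite V"
  shows "finite {T. lin_WV scale W V T}"
proof (rule inj_on_finite[where f = "\<lambda>T. restrict T W" and B = "W \<rightarrow>\<^sub>E V"])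
  show "inj_on (\<lambda>T. restrict T W) {T. lin_WV scale W V T}"
  proof (rule inj_onI, rule ext)
    fix T T' x
    assume *: "T \<in> {T. lin_WV scale W V T}" "T' \<in> {T. lin_WV scale W V T}" "restrict T W = restrict T' W"
    show "T x = T' x"
      using *(1,2) fun_cong[OF *(3), of x] lin_WV_simps(4)[of W V T x] lin_WV_simps(4)[of W V T' x]
      by (cases "x \<in> W") auto
  qed
  show "(\<lambda>T. restrict T W) ` {T. lin_WV scale W V T} \<subseteq> W \<rightarrow>\<^sub>E V" by (auto simp: lin_WV_def)
  show "finite (W \<rightarrow>\<^sub>E V)" using assms by (intro finite_PiE) auto
qed

lemma inv_part_subset: "inv_part W T \<subseteq> W"
  unfolding inv_part_def by (auto dest: spec[of _ 0])

lemma inv_part_invariant: "T ` inv_part W T \<subseteq> inv_part W T"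
proof
  fix y assume "y \<in> T ` inv_part W T"
  then obtain x where x: "\<And>i. (T ^^ i) x \<in> W" "y = T x" by (auto simp: inv_part_def)
  have "(T ^^ i) y \<in> W" for i using x(1)[of "Suc i"] x(2) by (simp add: funpow_swap1)
  then show "y \<in> inv_part W T" by (simp add: inv_part_def)
qed

lemma subset_inv_part:
  assumes "T ` U \<subseteq> U" "U \<subseteq> W" shows "U \<subseteq> inv_part W T"
proof
  fix x assume "x \<in> U"
  then have "(T ^^ i) x \<in> U" for i using assms(1) by (induction i) auto
  then show "x \<in> inv_part W T" using assms(2) by (auto simp: inv_part_def)
qed

lemma subspace_inv_part:
  assumes "subspace W" "lin_WV scale W V T"
  shows "subspace (inv_part W T)"
proof (rule subspaceI)
  have "(T ^^ i) 0 = 0" for i using lin_WV_0[OF assms] by (induction i) auto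
  then show "0 \<in> inv_part W T" using subspace_0[OF assms(1)] by (simp add: inv_part_def)
next
  fix x y assume xy: "x \<in> inv_part W T" "y \<in> inv_part W T"
  have "(T ^^ i) (x + y) = (T ^^ i) x + (T ^^ i) y" for i
    using xy lin_WV_simps(2)[OF assms(2)] by (induction i) (auto simp: inv_part_def)
  then show "x + y \<in> inv_part W T" using xy assms(1) by (auto simp: inv_part_def intro: subspace_add)
next
  fix c x assume x: "x \<in> inv_part W T"
  have "(T ^^ i) (scale c x) = scale c ((T ^^ i) x)" for i
    using x lin_WV_simps(3)[OF assms(2)] by (induction i) (auto simp: inv_part_def)
  then show "scale c x \<in> inv_part W T" using x assms(1) by (auto simp: inv_part_def intro: subspace_scale)
qed

lemma is_max_inv_sub_iff:
  assumes "subspace W" "lin_WV scale W V T"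
  shows "is_max_inv_sub scale W T U \<longleftrightarrow> U = inv_part W T"
proof -
  note * = inv_part_subset inv_part_invariant subspace_inv_part[OF assms]
  show ?thesis
  proof
    assume U: "is_max_inv_sub scale W T U"
    show "U = inv_part W T"
    proof
      show "inv_part W T \<subseteq> U"
        using U * unfolding is_max_inv_sub_def by simp
      show "U \<subseteq> inv_part W T"
        using U by (intro subset_inv_part) (simp_all add: is_max_inv_sub_def)
    qed
  next
    assume "U = inv_part W T"
    then show "is_max_inv_sub scale W T U"
      unfolding is_max_inv_sub_def using * subset_inv_part by simp
  qed
qed

end

section \<open>Extending a map by one vector\<close>

locale hyperplane_extension = finite_field_space scale q
  for scale :: "'a::{field_gcd,finite} \<Rightarrow> 'v::ab_group_add \<Rightarrow> 'v" and q :: nat +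
  fixes V H :: "'v set" and w :: 'v
  assumes V: "subspace V" "finite V" and H: "subspace H" "H \<subseteq> V" and w: "w \<in> V" "w \<notin> H"
begin

abbreviation W :: "'v set" where "W \<equiv> span (insert w H)"

abbreviation \<kappa> :: "'v \<Rightarrow> 'a" where "\<kappa> \<equiv> coord H w"

definition ext :: "('v \<Rightarrow> 'v) \<Rightarrow> 'v \<Rightarrow> 'v \<Rightarrow> 'v" where
  "ext T v z = (if z \<in> W then T (z - scale (\<kappa> z) w) + scale (\<kappa> z) v else 0)"

lemma H_subset: "H \<subseteq> W" and w_in: "w \<in> W"
  by (auto intro: span_base)

lemma W_subset: "W \<subseteq> V"
  using V H w by (intro span_minimal) auto

lemma ext_H: "z \<in> H \<Longrightarrow> ext T v z = T z"
  using H_subset coord_of_mem[OF H(1) w(2)] by (auto simp: ext_def)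

lemma ext_w: "T 0 = 0 \<Longrightarrow> ext T v w = v"
  using w_in coord_self[OF H(1) w(2)] by (simp add: ext_def)

lemma ext_change: "z \<in> W \<Longrightarrow> ext T v' z = ext T v z + scale (\<kappa> z) (v' - v)"
  by (simp add: ext_def scale_right_diff_distrib)

lemma lin_WV_ext:
  assumes T: "lin_WV scale H V T" and v: "v \<in> V"
  shows "lin_WV scale W V (ext T v)"
  unfolding lin_WV_def
proof (intro conjI ballI allI impI)
  note c = coord_mem[OF H(1) w(2)]
  note T' = lin_WV_simps[OF T]
  fix x assume x: "x \<in> W"
  show "ext T v x \<in> V"
    using x v V(1) T'(1)[OF c[OF x]] by (simp add: ext_def subspace_add subspace_scale)
  fix y assume y: "y \<in> W"
  have "T ((x - scale (\<kappa> x) w) + (y - scale (\<kappa> y) w)) = T (x - scale (\<kappa> x) w) + T (y - scale (\<kappa> y) w)"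
    by (intro T' c x y)
  then show "ext T v (x + y) = ext T v x + ext T v y"
    using x y coord_add[OF H(1) w(2) x y] by (simp add: ext_def span_add algebra_simps)
next
  note c = coord_mem[OF H(1) w(2)]
  note T' = lin_WV_simps[OF T]
  fix a x assume x: "x \<in> W"
  have "T (scale a (x - scale (\<kappa> x) w)) = scale a (T (x - scale (\<kappa> x) w))"
    by (intro T' c x)
  then show "ext T v (scale a x) = scale a (ext T v x)"
    using x coord_scale[OF H(1) w(2) x] by (simp add: ext_def span_scale algebra_simps)
qed (simp add: ext_def)

lemma ext_eqI:
  assumes "lin_WV scale W V T"
  shows "ext (\<lambda>x. if x \<in> H then T x else 0) (T w) = T"
proof
  fix z
  show "ext (\<lambda>x. if x \<in> H then T x else 0) (T w) z = T z"
  proof (cases "z \<in> W")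
    case True
    have "T (z - scale (\<kappa> z) w + scale (\<kappa> z) w) = T (z - scale (\<kappa> z) w) + T (scale (\<kappa> z) w)"
      using True w_in by (intro lin_WV_simps(2)[OF assms] span_diff span_scale)
    also have "T (scale (\<kappa> z) w) = scale (\<kappa> z) (T w)"
      using w_in by (intro lin_WV_simps(3)[OF assms])
    finally show ?thesis using True coord_mem[OF H(1) w(2) True] by (simp add: ext_def)
  qed (use lin_WV_simps(4)[OF assms] in \<open>simp add: ext_def\<close>)
qed

lemma lin_WV_restrict: "lin_WV scale W V T \<Longrightarrow> lin_WV scale H V (\<lambda>x. if x \<in> H then T x else 0)"
  using H_subset H(1) by (auto simp: lin_WV_def subspace_add subspace_scale subset_iff)

context
  fixes T :: "'v \<Rightarrow> 'v"
  assumes T: "lin_WV scale H V T"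
begin

abbreviation J :: "'v \<Rightarrow> 'v set" where "J v \<equiv> inv_part W (ext T v)"

definition bad :: "'v set" where "bad = {v \<in> V. J v \<noteq> inv_part H T}"

lemma inv_part_H_subset_J: "inv_part H T \<subseteq> J v"
proof (rule subset_inv_part)
  show "ext T v ` inv_part H T \<subseteq> inv_part H T"
    using inv_part_invariant[of T H] inv_part_subset[of H T] ext_H[of _ T v] by fastforce
qed (use inv_part_subset H_subset in blast)

lemma subspace_J: "v \<in> V \<Longrightarrow> subspace (J v)"
  by (intro subspace_inv_part[OF _ lin_WV_ext[OF T]]) auto

text \<open>On \<open>H\<close> the extended map agrees with \<open>T\<close>. So an invariant
  subspace inside \<open>H\<close> is already counted in \<open>inv_part H T\<close>, and growth can
  only happen outside \<open>H\<close>.\<close>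

lemma bad_iff: "v \<in> bad \<longleftrightarrow> v \<in> V \<and> \<not> J v \<subseteq> H"
proof -
  have "J v = inv_part H T" if "J v \<subseteq> H"
  proof
    have "T ` J v \<subseteq> J v"
      using inv_part_invariant[of "ext T v" W] ext_H[of _ T v] that by fastforce
    then show "J v \<subseteq> inv_part H T" using that by (rule subset_inv_part)
  qed (rule inv_part_H_subset_J)
  then show ?thesis using inv_part_subset[of H T] by (auto simp: bad_def)
qed

lemma bad_witness:
  assumes "v \<in> bad"
  obtains x where "x \<in> J v" "\<kappa> x = 1"
proof -
  from assms obtain x where x: "x \<in> J v" "x \<notin> H" by (auto simp: bad_iff)
  then have xW: "x \<in> W" using inv_part_subset by blast
  then have "\<kappa> x \<noteq> 0" using x coord_eq_0_iff[OF H(1) w(2)] by blast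
  then have "\<kappa> (scale (inverse (\<kappa> x)) x) = 1" using coord_scale[OF H(1) w(2) xW] by simp
  moreover have "scale (inverse (\<kappa> x)) x \<in> J v"
    using assms x subspace_J by (auto simp: bad_iff intro: subspace_scale)
  ultimately show ?thesis using that by blast
qed

text \<open>Changing the value at \<open>w\<close> by \<open>y\<close> changes the map everywhere by
  multiples of \<open>y\<close>. A subspace containing \<open>y\<close> is therefore invariant for
  both maps or for neither; this is used in both directions.\<close>

lemma J_translate:
  assumes v: "v \<in> V" and y: "y \<in> J v"
  shows "J (v + y) = J v"
proof -
  note sub = inv_part_subset[of W]
  have inv: "ext T v2 ` X \<subseteq> X"
    if "subspace X" "X \<subseteq> W" "ext T v1 ` X \<subseteq> X" "v2 - v1 \<in> X" for v1 v2 X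
  proof (rule image_subsetI)
    fix z assume "z \<in> X"
    then have "ext T v1 z + scale (\<kappa> z) (v2 - v1) \<in> X" "z \<in> W"
      using that by (auto intro!: subspace_add subspace_scale)
    then show "ext T v2 z \<in> X" using ext_change[of z T v2 v1] by simp
  qed
  have vy: "v + y \<in> V" using v y sub W_subset V(1) by (blast intro: subspace_add)
  have le: "J v \<subseteq> J (v + y)"
    by (rule subset_inv_part[OF inv[OF subspace_J[OF v] sub inv_part_invariant] sub]) (simp add: y)
  then have "- y \<in> J (v + y)" using y subspace_neg[OF subspace_J[OF vy]] by blast
  then have "J (v + y) \<subseteq> J v"
    by (intro subset_inv_part[OF inv[OF subspace_J[OF vy] sub inv_part_invariant] sub]) simp
  with le show ?thesis by blast
qed

text \<open>An \<open>x\<close> in the common invariant part with coordinate 1 recovers the change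
  of the value at \<open>w\<close>: the two maps send \<open>x\<close> to vectors of that part whose
  difference is \<open>v' - v\<close>.\<close>

lemma J_class:
  assumes v: "v \<in> bad"
  shows "{v' \<in> bad. J v' = J v} = (\<lambda>y. v + y) ` J v"
proof (intro subset_antisym subsetI)
  fix v' assume v': "v' \<in> {v' \<in> bad. J v' = J v}"
  obtain x where x: "x \<in> J v" "\<kappa> x = 1" using bad_witness[OF v] .
  then have "ext T v' x - ext T v x \<in> J v"
    using v v' inv_part_invariant[of "ext T v'" W] inv_part_invariant[of "ext T v" W] subspace_J
    by (intro subspace_diff) (auto simp: bad_iff)
  moreover have "ext T v' x = ext T v x + scale (\<kappa> x) (v' - v)"
    using x inv_part_subset by (intro ext_change) blast
  ultimately have "v' - v \<in> J v" using x by simp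
  then show "v' \<in> (\<lambda>y. v + y) ` J v" by (intro rev_image_eqI[of "v' - v"]) auto
next
  fix v' assume "v' \<in> (\<lambda>y. v + y) ` J v"
  then obtain y where y: "y \<in> J v" "v' = v + y" by blast
  then have "J v' = J v" using v J_translate by (auto simp: bad_iff)
  moreover have "v' \<in> V" using v y inv_part_subset[of W] W_subset V(1)
    by (auto simp: bad_iff intro!: subspace_add)
  ultimately show "v' \<in> {v' \<in> bad. J v' = J v}" using v by (simp add: bad_iff)
qed

text \<open>Double counting: each class of bad values with a common invariant part \<^term>\<open>X\<close> is a coset of
  \<^term>\<open>X\<close>, while the pairs below see only the \<^term>\<open>q\<close>-th part \<^term>\<open>{x \<in> X. \<kappa> x = 1}\<close> of it;
  over all classes, the pairs are parametrised by the affine hyperplane \<^term>\<open>{x \<in> W. \<kappa> x = 1}\<close>.\<close>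
definition kernel_pairs :: "('v \<times> 'v) set" where
  "kernel_pairs = {(v, x). v \<in> V \<and> x \<in> W \<and> \<kappa> x = 1 \<and> ext T v x = 0}"

lemma kernel_pairs_bad:
  assumes "(v, x) \<in> kernel_pairs"
  shows "x \<in> J v" "v \<in> bad"
proof -
  from assms have x: "v \<in> V" "x \<in> W" "\<kappa> x = 1" "ext T v x = 0" by (auto simp: kernel_pairs_def)
  have "ext T v 0 = 0" using x lin_WV_0[OF _ lin_WV_ext[OF T]] by blast
  \<comment> \<open>\<open>subset_inv_part\<close> accepts any invariant set, not only subspaces. As
    \<open>x\<close> is sent to 0, this two-element set suffices.\<close>
  then have "{x, 0} \<subseteq> J v" using x by (intro subset_inv_part) (auto simp: span_zero)
  then show "x \<in> J v" by simp
  moreover have "x \<notin> H" using x coord_of_mem[OF H(1) w(2)] by auto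
  ultimately show "v \<in> bad" using x by (auto simp: bad_iff)
qed

text \<open>For \<open>x\<close> with coordinate 1 the equation \<open>ext T v x = 0\<close> reads
  \<open>T (x - w) + v = 0\<close>, so \<open>x\<close> determines \<open>v\<close>
  uniquely.\<close>

lemma card_kernel_pairs: "card kernel_pairs = card H"
proof -
  have Hinv: "x - w \<in> H" if "x \<in> W" "\<kappa> x = 1" for x
    using coord_mem[OF H(1) w(2) that(1)] that(2) by simp
  have "bij_betw snd kernel_pairs {x \<in> W. \<kappa> x = 1}"
  proof (rule bij_betw_byWitness[where f' = "\<lambda>x. (- T (x - w), x)"])
    show "\<forall>a\<in>kernel_pairs. (- T (snd a - w), snd a) = a"
      by (auto simp: kernel_pairs_def ext_def add_eq_0_iff)
    show "(\<lambda>x. (- T (x - w), x)) ` {x \<in> W. \<kappa> x = 1} \<subseteq> kernel_pairs"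
      using Hinv lin_WV_simps(1)[OF T] V(1) by (auto simp: kernel_pairs_def ext_def subspace_neg)
  qed (auto simp: kernel_pairs_def)
  from bij_betw_same_card[OF this] show ?thesis using card_coord_1[OF H(1) w(2)] by simp
qed

text \<open>Every \<open>x\<close> in the slice of \<open>J v\<close> is killed by exactly one map
  of the class, the one with value \<open>v - ext T v x\<close> at \<open>w\<close>. It belongs to
  the class by \<open>J_translate\<close>, because \<open>ext T v x\<close> lies in
  \<open>J v\<close>.\<close>

lemma card_kernel_pairs_class:
  assumes v: "v \<in> bad"
  shows "card {p \<in> kernel_pairs. J (fst p) = J v} = card {x \<in> J v. \<kappa> x = 1}"
proof -
  let ?K = "{p \<in> kernel_pairs. J (fst p) = J v}"
  have vV: "v \<in> V" using v by (simp add: bad_iff)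
  have JW: "x \<in> W" if "x \<in> J v'" for x v' using that inv_part_subset by blast
  have "bij_betw snd ?K {x \<in> J v. \<kappa> x = 1}"
  proof (rule bij_betw_byWitness[where f' = "\<lambda>x. (v - ext T v x, x)"])
    show "\<forall>a\<in>?K. (v - ext T v (snd a), snd a) = a"
    proof (rule ballI)
      fix p assume "p \<in> ?K"
      then have "snd p \<in> W" "\<kappa> (snd p) = 1" "ext T (fst p) (snd p) = 0" by (auto simp: kernel_pairs_def)
      then have "ext T v (snd p) = v - fst p" using ext_change[of "snd p" T v "fst p"] by simp
      then show "(v - ext T v (snd p), snd p) = p" by simp
    qed
    show "snd ` ?K \<subseteq> {x \<in> J v. \<kappa> x = 1}"
    proof (rule image_subsetI)
      fix p assume p: "p \<in> ?K"
      then have "snd p \<in> J (fst p)" using kernel_pairs_bad(1)[of "fst p" "snd p"] by simp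
      then show "snd p \<in> {x \<in> J v. \<kappa> x = 1}" using p by (auto simp: kernel_pairs_def)
    qed
    show "(\<lambda>x. (v - ext T v x, x)) ` {x \<in> J v. \<kappa> x = 1} \<subseteq> ?K"
    proof (rule image_subsetI)
      fix x assume x: "x \<in> {x \<in> J v. \<kappa> x = 1}"
      then have "- ext T v x \<in> J v"
        using inv_part_invariant[of "ext T v" W] subspace_J[OF vV] by (auto intro: subspace_neg)
      then have J: "J (v + - ext T v x) = J v" and "- ext T v x \<in> V"
        using J_translate[OF vV] JW W_subset by blast+
      then have "v + - ext T v x \<in> V" using vV V(1) subspace_add by blast
      moreover note J
      moreover have "ext T (v + - ext T v x) x = 0"
        using x JW[of x v] by (subst ext_change[of _ _ _ v]) auto
      ultimately show "(v - ext T v x, x) \<in> ?K"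
        using x JW by (auto simp: kernel_pairs_def)
    qed
  qed (auto simp: kernel_pairs_def)
  from bij_betw_same_card[OF this] show ?thesis .
qed

lemma card_bad: "card bad = q * card H"
proof -
  have fin: "finite bad" using V by (simp add: bad_def)
  have finW: "finite W" using W_subset V finite_subset by blast
  have "kernel_pairs \<subseteq> V \<times> W" by (auto simp: kernel_pairs_def)
  then have finK: "finite kernel_pairs" using V finW finite_subset by blast
  have cls: "card {v' \<in> bad. J v' = X} = q * card {p \<in> kernel_pairs. J (fst p) = X}" if X: "X \<in> J ` bad" for X
  proof -
    obtain v where v: "v \<in> bad" "X = J v" using X by blast
    obtain x where x: "x \<in> J v" "\<kappa> x = 1" using bad_witness[OF v(1)] .
    have "card {v' \<in> bad. J v' = X} = card (J v)"
      unfolding v(2) J_class[OF v(1)] by (rule card_image) auto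
    also have "\<dots> = q * card {x \<in> J v. \<kappa> x = 1}"
      using v x H(1) w(2) subspace_J inv_part_subset by (intro card_subspace_hyperplane) (auto simp: bad_iff)
    finally show ?thesis using card_kernel_pairs_class[OF v(1)] v(2) by simp
  qed
  have "card bad = (\<Sum>X\<in>J ` bad. card {v' \<in> bad. J v' = X})"
    using sum.group[OF fin _ order_refl, of J "\<lambda>_. 1::nat"] fin by simp
  also have "\<dots> = q * (\<Sum>X\<in>J ` bad. card {p \<in> kernel_pairs. J (fst p) = X})"
    by (simp add: cls sum_distrib_left)
  also have "(\<Sum>X\<in>J ` bad. card {p \<in> kernel_pairs. J (fst p) = X}) = card kernel_pairs"
    using sum.group[OF finK _ , of "J ` bad" "\<lambda>p. J (fst p)" "\<lambda>_. 1::nat"] fin kernel_pairs_bad(2) by force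
  finally show ?thesis by (simp add: card_kernel_pairs)
qed

end

text \<open>A map on \<open>W\<close> is its restriction to \<open>H\<close> together with its value
  at \<open>w\<close>. Because \<open>U\<close> lies in \<open>H\<close>, the restriction again has
  invariant part \<open>U\<close>, and then the value must avoid \<open>bad\<close>. The predicate
  \<open>P\<close> sees only the values on \<open>U\<close>, so it is the same for the map and its
  restriction.\<close>

lemma card_extensions:
  assumes P: "\<And>T T'. (\<forall>u\<in>U. T u = T' u) \<Longrightarrow> P T \<longleftrightarrow> P T'" and U: "U \<subseteq> H"
  shows "card {T. lin_WV scale W V T \<and> inv_part W T = U \<and> P T} =
    (card V - q * card H) * card {T. lin_WV scale H V T \<and> inv_part H T = U \<and> P T}"
    (is "card ?L = _ * card ?R")
proof -
  let ?res = "\<lambda>T x. if x \<in> H then T x else 0"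
  let ?S = "SIGMA T:?R. V - bad T"
  have restr: "inv_part H (?res T) = U" if "lin_WV scale W V T" "inv_part W T = U" for T
  proof
    have "?res T ` U \<subseteq> U" using inv_part_invariant[of T W] that U by fastforce
    then show "U \<subseteq> inv_part H (?res T)" using U by (rule subset_inv_part)
    show "inv_part H (?res T) \<subseteq> U"
      using inv_part_H_subset_J[OF lin_WV_restrict[OF that(1)], of "T w"] ext_eqI[OF that(1)] that(2) by simp
  qed
  have "bij_betw (\<lambda>(T, v). ext T v) ?S ?L"
  proof (rule bij_betw_byWitness[where f' = "\<lambda>T. (?res T, T w)"])
    show "\<forall>a\<in>?S. (?res (case a of (T, v) \<Rightarrow> ext T v), (case a of (T, v) \<Rightarrow> ext T v) w) = a"
    proof (rule ballI)
      fix p assume "p \<in> ?S"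
      then obtain T v where p: "p = (T, v)" and T: "lin_WV scale H V T" by blast
      have "?res (ext T v) = T" using ext_H lin_WV_simps(4)[OF T] by auto
      moreover have "ext T v w = v" using lin_WV_0[OF H(1) T] by (rule ext_w)
      ultimately show "(?res (case p of (T, v) \<Rightarrow> ext T v), (case p of (T, v) \<Rightarrow> ext T v) w) = p"
        unfolding p prod.case by simp
    qed
    show "\<forall>a'\<in>?L. (case (?res a', a' w) of (T, v) \<Rightarrow> ext T v) = a'" using ext_eqI by simp
    show "(\<lambda>(T, v). ext T v) ` ?S \<subseteq> ?L"
    proof clarify
      fix T v assume T: "lin_WV scale H V T" and *: "P T" "U = inv_part H T" "v \<in> V" "v \<notin> bad T"
      moreover have "P (ext T v) \<longleftrightarrow> P T" using U by (intro P) (auto simp: ext_H)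
      ultimately show "lin_WV scale W V (ext T v) \<and> inv_part W (ext T v) = inv_part H T \<and> P (ext T v)"
        using lin_WV_ext[OF T] by (auto simp: bad_def[OF T])
    qed
    show "(\<lambda>T. (?res T, T w)) ` ?L \<subseteq> ?S"
    proof (rule image_subsetI)
      fix T assume T: "T \<in> ?L"
      then have r: "lin_WV scale H V (?res T)" and "inv_part H (?res T) = U"
        using lin_WV_restrict restr by auto
      moreover have "P (?res T)" using T U by (subst P[of "?res T" T]) auto
      moreover have "T w \<in> V" using T w_in lin_WV_simps(1) by blast
      moreover have "T w \<notin> bad (?res T)" using T ext_eqI[of T] calculation by (simp add: bad_def)
      ultimately show "(?res T, T w) \<in> ?S" by simp
    qed
  qed
  from bij_betw_same_card[OF this] have "card ?L = card ?S" by simp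
  also have "\<dots> = (\<Sum>T\<in>?R. card V - q * card H)"
  proof (subst card_SigmaI)
    show "finite ?R"
      by (rule finite_subset[OF _ finite_lin_WV[OF finite_subset[OF H(2) V(2)] V(2)]]) blast
    have "card (V - bad T) = card V - q * card H" if "T \<in> ?R" for T
      using that V card_bad[of T] by (subst card_Diff_subset) (auto simp: bad_def finite_subset)
    then show "(\<Sum>T\<in>?R. card (V - bad T)) = (\<Sum>T\<in>?R. card V - q * card H)" by simp
  qed (use V in auto)
  finally show ?thesis by simp
qed

end

section \<open>Extension from U to W along a basis\<close>

context finite_field_space
begin

text \<open>A hyperplane with q^m elements leaves q^n - q^(m+1) admissible values for the next basis
  vector. With m running from d to d + |A| - 1, the exponents are d+1, ..., d + |A|, which explains
  the shifted range of the product. Before the first step \<open>W\<close> equals \<open>U\<close>,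
  and having \<open>U\<close> as invariant part means being an endomorphism of
  \<open>U\<close>.\<close>

lemma card_extensions_chain:
  assumes V: "subspace V" "finite V" "card V = q ^ n" and U: "subspace U" "card U = q ^ d"
    and A: "finite A" "independent (B \<union> A)" "B \<inter> A = {}" "span B = U" "B \<union> A \<subseteq> V" "finite B"
    and P: "\<And>T T'. (\<forall>u\<in>U. T u = T' u) \<Longrightarrow> P T \<longleftrightarrow> P T'"
  shows "card {T. lin_WV scale (span (B \<union> A)) V T \<and> inv_part (span (B \<union> A)) T = U \<and> P T} =
    card {T. lin_WV scale U U T \<and> P T} * (\<Prod>i\<in>{d+1..d + card A}. q ^ n - q ^ i)"
  using A
proof (induction A)
  case empty
  have "lin_WV scale U V T \<and> inv_part U T = U \<longleftrightarrow> lin_WV scale U U T" for T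
  proof
    assume *: "lin_WV scale U V T \<and> inv_part U T = U"
    then have "T ` U \<subseteq> U" using inv_part_invariant[of T U] by simp
    then show "lin_WV scale U U T" using * by (auto simp: lin_WV_def)
  next
    assume *: "lin_WV scale U U T"
    moreover have "U \<subseteq> V" using empty V(1) span_minimal[of B V] by auto
    ultimately have "lin_WV scale U V T" by (auto simp: lin_WV_def)
    moreover have "U \<subseteq> inv_part U T" using * by (intro subset_inv_part) (auto simp: lin_WV_def)
    ultimately show "lin_WV scale U V T \<and> inv_part U T = U" using inv_part_subset[of U T] by blast
  qed
  then show ?case using empty by (simp flip: conj_assoc)
next
  case (insert w A)
  let ?H = "span (B \<union> A)"
  have ind: "independent (B \<union> A)" "w \<notin> ?H"
    using insert.prems(1,2) insert.hyps independent_insert[of w "B \<union> A"] by (auto split: if_splits)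
  have sub: "?H \<subseteq> V" using insert.prems V(1) by (intro span_minimal) auto
  interpret hyperplane_extension scale q V ?H w
    by unfold_locales (use V sub insert.prems ind in auto)
  have Weq: "span (insert w ?H) = span (B \<union> insert w A)"
    by (simp add: span_insert span_span)
  have "card (B \<union> A) = d + card A"
  proof -
    have "q ^ card B = q ^ d" using card_span_independent[of B] insert.prems U ind(1) independent_mono by auto
    then have "card B = d" using q_ge_2 by (simp add: power_inject_exp)
    then show ?thesis using insert by (subst card_Un_disjoint) auto
  qed
  then have "card ?H = q ^ (d + card A)"
    using card_span_independent[of "B \<union> A"] ind(1) insert.hyps(1) insert.prems(5) by simp
  moreover have "U \<subseteq> ?H" using span_mono[of B "B \<union> A"] insert.prems(3) by simp
  moreover have "card {T. lin_WV scale ?H V T \<and> inv_part ?H T = U \<and> P T} =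
    card {T. lin_WV scale U U T \<and> P T} * (\<Prod>i\<in>{d+1..d + card A}. q ^ n - q ^ i)"
    by (rule insert.IH) (use insert.prems ind(1) in blast)+
  moreover have "card {T. lin_WV scale (span (insert w ?H)) V T \<and> inv_part (span (insert w ?H)) T = U \<and> P T} =
    (card V - q * card ?H) * card {T. lin_WV scale ?H V T \<and> inv_part ?H T = U \<and> P T}"
  proof (rule card_extensions)
    show "P T \<longleftrightarrow> P T'" if "\<forall>u\<in>U. T u = T' u" for T T' using that by (rule P)
  qed fact
  ultimately have "card {T. lin_WV scale (span (B \<union> insert w A)) V T \<and> inv_part (span (B \<union> insert w A)) T = U \<and> P T}
    = (q ^ n - q * q ^ (d + card A)) *
      (card {T. lin_WV scale U U T \<and> P T} * (\<Prod>i\<in>{d+1..d + card A}. q ^ n - q ^ i))"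
    unfolding Weq assms(3) by presburger
  also have "\<dots> = card {T. lin_WV scale U U T \<and> P T} * (\<Prod>i\<in>{d+1..d + card (insert w A)}. q ^ n - q ^ i)"
    using insert.hyps(1,2) by simp
  finally show ?case .
qed

end

section \<open>Invariant factors read off from numbers of solutions\<close>

lemma degree_normalize_field: "degree (normalize p) = degree p" for p :: "'a::field_gcd poly"
  by (cases "p = 0") (auto intro!: antisym dvd_imp_degree_le)

lemma lead_coeff_normalize_field:
  fixes p :: "'a::field_gcd poly"
  assumes "p \<noteq> 0"
  shows "lead_coeff (normalize p) = 1"
proof -
  have "lead_coeff (normalize p) = normalize (lead_coeff p)"
    by (simp add: degree_normalize_field)
  then show ?thesis using assms by (simp add: is_unit_normalize dvd_field_iff)
qed

text \<open>One modulus \<open>g0\<close> with few solutions guarantees that the normal form has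
  full rank, so that the quotients of determinantal divisors really are the normalized diagonal
  entries. The same diagonal then governs the solution count for every modulus
  \<open>g\<close>.\<close>

lemma invariant_factors_mod_solutions:
  fixes A :: "nat \<Rightarrow> nat \<Rightarrow> 'a::{field_gcd,finite} poly" and n k :: nat
  defines "ps \<equiv> invariant_factors (mat n k (\<lambda>(i, j). A i j))"
  assumes kn: "k \<le> n" and g0: "g0 \<noteq> 0" "card (mod_solutions n k g0 A) < card (UNIV :: 'a set) ^ degree g0"
  shows "inv_factor_tuple k ps"
    and "g \<noteq> 0 \<Longrightarrow> card (mod_solutions n k g A) = card (UNIV :: 'a set) ^ (\<Sum>j<k. degree (gcd (ps ! j) g))"
proof -
  obtain D where eqv: "mat_equiv n k A D" and D: "snf_upto n k k D" using snf_exists[OF kn] by blast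
  have sols: "card (mod_solutions n k g A) = card (UNIV :: 'a set) ^ (\<Sum>j<k. degree (gcd (D j j) g))" if "g \<noteq> 0" for g
    using card_mod_solutions_mat_equiv[OF eqv that] card_mod_solutions_diagonal[OF D kn that] by simp
  have nz: "D j j \<noteq> 0" if "j < k" for j
  proof
    assume "D j j = 0"
    then have "degree g0 = degree (gcd (D j j) g0)" by (simp add: degree_normalize_field)
    also have "\<dots> \<le> (\<Sum>j<k. degree (gcd (D j j) g0))"
      using that by (intro member_le_sum) auto
    finally have "card (UNIV :: 'a set) ^ degree g0 \<le> card (mod_solutions n k g0 A)"
      unfolding sols[OF g0(1)] by (intro power_increasing) (auto simp: Suc_le_eq card_gt_0_iff)
    then show False using g0(2) by simp
  qed
  have div: "det_divisor (mat n k (\<lambda>(i, j). A i j)) i = normalize (\<Prod>a<i. D a a)" if "i \<le> k" for i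
    unfolding det_divisor_mat_equiv[OF eqv] using D that kn by (rule det_divisor_diagonal)
  have ps: "length ps = k" "ps ! j = normalize (D j j)" if "j < k" for j
  proof -
    have "ps ! j = normalize (\<Prod>a<Suc j. D a a) div normalize (\<Prod>a<j. D a a)"
      using that by (simp add: ps_def invariant_factors_def div del: prod.lessThan_Suc upt_Suc)
    also have "\<dots> = normalize (D j j)"
      using nz that by (simp add: normalize_mult)
    finally show "ps ! j = normalize (D j j)" .
  qed (simp add: ps_def invariant_factors_def)
  have len: "length ps = k" by (simp add: ps_def invariant_factors_def)
  show "inv_factor_tuple k ps"
    unfolding inv_factor_tuple_def
  proof (intro conjI ballI allI impI len)
    fix p assume "p \<in> set ps"
    then obtain j where "j < k" "p = normalize (D j j)" using ps(2) len by (metis in_set_conv_nth)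
    then show "lead_coeff p = 1" using nz lead_coeff_normalize_field[of "D j j"] by simp
  next
    fix i assume "Suc i < k"
    then show "ps ! i dvd ps ! Suc i" using D kn ps(2) by (simp add: snf_upto_def)
  qed
  show "card (mod_solutions n k g A) = card (UNIV :: 'a set) ^ (\<Sum>j<k. degree (gcd (ps ! j) g))" if "g \<noteq> 0"
    unfolding sols[OF that] using ps(2) by simp
qed

text \<open>The value of p(T) at u by Horner's rule. The empty coefficient list gives 0, so the
  recursion for \<open>pCons 0 0\<close> amounts to \<open>T 0 = 0\<close>; this is where that
  assumption of \<open>poly_act_pCons\<close> comes from.\<close>

definition poly_act :: "('a::field \<Rightarrow> 'v::ab_group_add \<Rightarrow> 'v) \<Rightarrow> ('v \<Rightarrow> 'v) \<Rightarrow> 'a poly \<Rightarrow> 'v \<Rightarrow> 'v" where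
  "poly_act s T p u = fold_coeffs (\<lambda>a x. s a u + T x) p 0"

locale poly_module =
  fixes act :: "'a::{field_gcd,finite} poly \<Rightarrow> 'v::ab_group_add \<Rightarrow> 'v" and U :: "'v set"
  assumes zero_mem: "0 \<in> U" and add_mem: "u \<in> U \<Longrightarrow> v \<in> U \<Longrightarrow> u + v \<in> U"
    and act_mem: "u \<in> U \<Longrightarrow> act p u \<in> U"
    and act_add: "u \<in> U \<Longrightarrow> act (p + r) u = act p u + act r u"
    and act_vadd: "u \<in> U \<Longrightarrow> v \<in> U \<Longrightarrow> act p (u + v) = act p u + act p v"
    and act_mult: "u \<in> U \<Longrightarrow> act (p * r) u = act p (act r u)"
    and act_1: "u \<in> U \<Longrightarrow> act 1 u = u"
    and finite_U: "finite U"

section \<open>The polynomial module defined by an endomorphism\<close>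

context finite_field_space
begin

lemma poly_act_0 [simp]: "poly_act scale T 0 u = 0"
  by (simp add: poly_act_def)

lemma poly_act_pCons: "T 0 = 0 \<Longrightarrow> poly_act scale T (pCons a p) u = scale a u + T (poly_act scale T p u)"
  by (cases "p = 0 \<and> a = 0") (auto simp: poly_act_def)

lemma poly_act_mem:
  assumes T: "lin_WV scale U U T" and U: "subspace U" and u: "u \<in> U"
  shows "poly_act scale T p u \<in> U"
  using lin_WV_0[OF U T] lin_WV_simps[OF T] U u
  by (induction p) (auto simp: poly_act_pCons subspace_0 subspace_add subspace_scale)

lemma poly_module_poly_act:
  assumes T: "lin_WV scale U U T" and U: "subspace U" "finite U"
  shows "poly_module (poly_act scale T) U"
proof
  note T0 = lin_WV_0[OF U(1) T] and T' = lin_WV_simps[OF T]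
  note [simp] = poly_act_pCons[where T = T, OF T0]
  show mem: "poly_act scale T p u \<in> U" if "u \<in> U" for p u
    using T U(1) that by (rule poly_act_mem)
  show add: "poly_act scale T (p + r) u = poly_act scale T p u + poly_act scale T r u" if u: "u \<in> U" for p r u
  proof (induction p arbitrary: r)
    case (pCons a p)
    obtain b s where r: "r = pCons b s" by (cases r)
    have "T (poly_act scale T (p + s) u) = T (poly_act scale T p u) + T (poly_act scale T s u)"
      unfolding pCons(2) by (intro T' mem u)
    then show ?case by (simp add: r scale_left_distrib)
  qed simp
  have sm: "poly_act scale T (smult c p) u = scale c (poly_act scale T p u)" if u: "u \<in> U" for c p u
    using mem[OF u] by (induction p) (simp_all add: T' scale_right_distrib)
  show "poly_act scale T p (u + v) = poly_act scale T p u + poly_act scale T p v" if "u \<in> U" "v \<in> U" for p u v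
    using mem that by (induction p) (simp_all add: T' scale_right_distrib algebra_simps)
  show "poly_act scale T (p * r) u = poly_act scale T p (poly_act scale T r u)" if u: "u \<in> U" for p r u
  proof (induction p)
    case (pCons a p)
    then show ?case using mem u by (simp add: add[OF u] sm[OF u])
  qed simp
  show "poly_act scale T 1 u = u" if "u \<in> U" for u
    by (simp add: one_pCons T0)
qed (use U in \<open>auto simp: subspace_0 subspace_add\<close>)

lemma poly_act_sum:
  assumes T: "lin_WV scale U U T" and U: "subspace U" and u: "u \<in> U"
    and p: "p \<in> polys_below D"
  shows "poly_act scale T p u = (\<Sum>a<D. scale (coeff p a) ((T ^^ a) u))"
  using p
proof (induction p arbitrary: D)
  case 0
  then show ?case by simp
next
  case (pCons a p)
  note T0 = lin_WV_0[OF U T] and T' = lin_WV_simps[OF T]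
  from pCons obtain D' where D: "D = Suc D'" by (cases D) (auto simp: polys_below_iff)
  have "p \<in> polys_below D'" using pCons.prems unfolding polys_below_def D by (auto dest: spec[of _ "Suc _"])
  then have IH: "poly_act scale T p u = (\<Sum>a<D'. scale (coeff p a) ((T ^^ a) u))" by (rule pCons.IH)
  have mem: "(T ^^ a) u \<in> U" for a using u T'(1) by (induction a) auto
  have "T (\<Sum>a<m. scale (coeff p a) ((T ^^ a) u)) = (\<Sum>a<m. scale (coeff p a) ((T ^^ Suc a) u))" for m
  proof (induction m)
    case (Suc m)
    have "(\<Sum>a<m. scale (coeff p a) ((T ^^ a) u)) \<in> U" using mem U by (intro subspace_sum subspace_scale)
    then show ?case using Suc mem U by (simp add: T' subspace_scale)
  qed (simp add: T0)
  then show ?case unfolding poly_act_pCons[where T = T, OF T0] IH D sum.lessThan_Suc_shift by simp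
qed

end

section \<open>Adapted families of a finite module\<close>

context poly_module
begin

lemma act_0: "u \<in> U \<Longrightarrow> act 0 u = 0"
  using act_add[of u 0 0] by simp

lemma act_vzero: "act p 0 = 0"
  using act_vadd[OF zero_mem zero_mem, of p] by simp

lemma act_uminus: "u \<in> U \<Longrightarrow> act (- p) u = - act p u"
  using act_add[of u p "- p"] act_0[of u] by (simp add: add_eq_0_iff)

lemma act_diff: "u \<in> U \<Longrightarrow> act (p - r) u = act p u - act r u"
  using act_add[of u p "- r"] by (simp add: act_uminus)

lemma uminus_mem: "u \<in> U \<Longrightarrow> - u \<in> U"
  using act_mem[of u "- 1"] by (simp add: act_uminus act_1)

lemma diff_mem: "u \<in> U \<Longrightarrow> v \<in> U \<Longrightarrow> u - v \<in> U"
  using add_mem[of u "- v"] by (simp add: uminus_mem)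

lemma act_vdiff: "u \<in> U \<Longrightarrow> v \<in> U \<Longrightarrow> act p (u - v) = act p u - act p v"
  using act_vadd[of "u - v" v p] by (simp add: diff_mem)

lemma sum_mem: "(\<And>i. i \<in> I \<Longrightarrow> x i \<in> U) \<Longrightarrow> sum x I \<in> U"
  by (induction I rule: infinite_finite_induct) (auto simp: zero_mem add_mem)

lemma act_vsum: "(\<And>i. i \<in> I \<Longrightarrow> x i \<in> U) \<Longrightarrow> act p (sum x I) = (\<Sum>i\<in>I. act p (x i))"
  by (induction I rule: infinite_finite_induct) (auto simp: act_vzero act_vadd sum_mem)

lemma act_dvd_0: "u \<in> U \<Longrightarrow> act m u = 0 \<Longrightarrow> m dvd p \<Longrightarrow> act p u = 0"
  by (auto elim!: dvdE simp: mult.commute[of m] act_mult act_vzero)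

lemma act_mod: "u \<in> U \<Longrightarrow> act m u = 0 \<Longrightarrow> act (p mod m) u = act p u"
  using act_dvd_0[of u m "p - p mod m"] act_diff[of u p "p mod m"] by (simp add: dvd_minus_mod)

lemma act_vuminus: "u \<in> U \<Longrightarrow> act p (- u) = - act p u"
  using act_vdiff[OF zero_mem, of u p] by (simp add: act_vzero)

definition ker :: "'a poly \<Rightarrow> 'v set" where
  "ker p = {u \<in> U. act p u = 0}"

text \<open>The family spans a direct sum of cyclic submodules, the \<open>t\<close>-th generator
  having annihilator exactly \<open>ms t\<close>. That the sum is all of \<open>U\<close> follows by
  counting once the degrees of the \<open>ms t\<close> add up to the dimension of
  \<open>U\<close>.\<close>

definition adapted :: "(nat \<Rightarrow> 'a poly) \<Rightarrow> nat \<Rightarrow> (nat \<Rightarrow> 'v) \<Rightarrow> bool" where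
  "adapted ms N us \<longleftrightarrow> (\<forall>t<N. us t \<in> ker (ms t)) \<and>
     (\<forall>a. (\<Sum>t<N. act (a t) (us t)) = 0 \<longrightarrow> (\<forall>t<N. ms t dvd a t))"

lemma adaptedD:
  assumes "adapted ms N us" "t < N"
  shows "us t \<in> U" "act (ms t) (us t) = 0" "(\<Sum>t<N. act (a t) (us t)) = 0 \<Longrightarrow> ms t dvd a t"
  using assms by (auto simp: adapted_def ker_def)

lemma adapted_cong: "(\<And>t. t < N \<Longrightarrow> us t = us' t) \<Longrightarrow> adapted ms N us \<longleftrightarrow> adapted ms N us'"
  unfolding adapted_def by auto

lemma adapted_inj_on:
  assumes us: "adapted ms N us" and ms: "\<And>t. t < N \<Longrightarrow> ms t \<noteq> 0"
  shows "inj_on (\<lambda>a. \<Sum>t<N. act (a t) (us t)) (\<Pi>\<^sub>E t\<in>{..<N}. polys_below (degree (ms t)))"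
proof (rule inj_onI)
  fix a b assume a: "a \<in> (\<Pi>\<^sub>E t\<in>{..<N}. polys_below (degree (ms t)))"
    and b: "b \<in> (\<Pi>\<^sub>E t\<in>{..<N}. polys_below (degree (ms t)))"
    and eq: "(\<Sum>t<N. act (a t) (us t)) = (\<Sum>t<N. act (b t) (us t))"
  have "(\<Sum>t<N. act (a t - b t) (us t)) = (\<Sum>t<N. act (a t) (us t)) - (\<Sum>t<N. act (b t) (us t))"
    using adaptedD(1)[OF us] by (simp add: act_diff sum_subtractf)
  then have 0: "(\<Sum>t<N. act (a t - b t) (us t)) = 0" using eq by simp
  show "a = b"
  proof (rule PiE_ext[OF a b])
    fix t assume t: "t \<in> {..<N}"
    then have "a t mod ms t = b t mod ms t"
      using adaptedD(3)[OF us, of t "\<lambda>t. a t - b t"] 0 by (simp add: mod_eq_dvd_iff)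
    moreover have "a t \<in> polys_below (degree (ms t))" "b t \<in> polys_below (degree (ms t))"
      using a b t by auto
    ultimately show "a t = b t" by (simp add: polys_below_mod)
  qed
qed

text \<open>The injective map from tuples of residues to \<open>U\<close> is onto because both sides
  have the same number of elements. The kernel of \<open>g\<close> can then be computed coordinate
  by coordinate with \<open>card_annihilator\<close>.\<close>

lemma card_ker_adapted:
  assumes us: "adapted ms N us" and ms: "\<And>t. t < N \<Longrightarrow> ms t \<noteq> 0"
    and U: "card U = card (UNIV :: 'a set) ^ (\<Sum>t<N. degree (ms t))"
  shows "card (ker g) = card (UNIV :: 'a set) ^ (\<Sum>t<N. degree (gcd g (ms t)))"
proof -
  let ?S = "\<Pi>\<^sub>E t\<in>{..<N}. polys_below (degree (ms t)) :: 'a poly set"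
  let ?\<phi> = "\<lambda>a. \<Sum>t<N. act (a t) (us t)"
  let ?K = "\<Pi>\<^sub>E t\<in>{..<N}. {a \<in> polys_below (degree (ms t)). ms t dvd g * a}"
  note inj = adapted_inj_on[OF us ms]
  have mem: "act p (us t) \<in> U" if "t < N" for t p using adaptedD(1)[OF us] that by (auto intro: act_mem)
  have "?\<phi> ` ?S \<subseteq> U" using mem by (auto intro!: sum_mem)
  moreover have "card (?\<phi> ` ?S) = card U"
    by (subst card_image[OF inj]) (auto simp: U card_PiE card_polys_below power_sum)
  ultimately have img: "?\<phi> ` ?S = U" using finite_U by (simp add: card_subset_eq)
  have g: "act g (?\<phi> a) = 0 \<longleftrightarrow> (\<forall>t<N. ms t dvd g * a t)" for a
  proof -
    have eq: "act g (?\<phi> a) = (\<Sum>t<N. act (g * a t) (us t))"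
      using mem adaptedD(1)[OF us] by (subst act_vsum) (auto simp: act_mult)
    show ?thesis
    proof
      assume "act g (?\<phi> a) = 0"
      then show "\<forall>t<N. ms t dvd g * a t" using adaptedD(3)[OF us, of _ "\<lambda>t. g * a t"] eq by simp
    next
      assume "\<forall>t<N. ms t dvd g * a t"
      then have "act (g * a t) (us t) = 0" if "t < N" for t
        using that by (intro act_dvd_0[OF adaptedD(1,2)[OF us that]]) simp
      then show "act g (?\<phi> a) = 0" by (simp add: eq)
    qed
  qed
  have KS: "?K = {a \<in> ?S. \<forall>t<N. ms t dvd g * a t}" by (auto simp: PiE_def Pi_def)
  have "ker g = {u \<in> ?\<phi> ` ?S. act g u = 0}" by (simp add: ker_def img)
  also have "\<dots> = ?\<phi> ` ?K" unfolding KS using g by blast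
  finally have "ker g = ?\<phi> ` ?K" .
  moreover have "inj_on ?\<phi> ?K" using inj by (rule inj_on_subset) (auto simp: KS)
  ultimately show ?thesis
    using ms by (simp add: card_image card_PiE card_annihilator power_sum)
qed

end

text \<open>The exponents belonging to one prime are listed in decreasing order. Earlier generators
  then have at least the exponent of the new one, and every element of the socle is
  \<open>f N ^ (l N - 1)\<close> times an element killed by \<open>f N ^ l N\<close>; otherwise the
  number of choices would depend on more than the number of earlier generators.\<close>

locale prime_powers = poly_module act U
  for act :: "'a::{field_gcd,finite} poly \<Rightarrow> 'v::ab_group_add \<Rightarrow> 'v" and U +
  fixes f :: "nat \<Rightarrow> 'a poly" and l :: "nat \<Rightarrow> nat"
  assumes irreducible: "irreducible (f t)" and coprime: "f s \<noteq> f t \<Longrightarrow> coprime (f s) (f t)"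
    and l_pos: "0 < l t" and l_mono: "s \<le> t \<Longrightarrow> f s = f t \<Longrightarrow> l t \<le> l s"
begin

abbreviation ms :: "nat \<Rightarrow> 'a poly" where "ms t \<equiv> f t ^ l t"

text \<open>For an adapted family and one of its primes \<open>p\<close>, these are the elements
  killed by \<open>p\<close> in the submodule spanned by the first \<open>N\<close> generators. A
  generator of exponent \<open>l\<close> contributes its multiples by p^(l-1), generators of other
  primes contribute nothing.\<close>

definition socle :: "nat \<Rightarrow> (nat \<Rightarrow> 'v) \<Rightarrow> 'a poly \<Rightarrow> 'v set" where
  "socle N us p = range (\<lambda>c. \<Sum>t | t < N \<and> f t = p. act (c t * p ^ (l t - 1)) (us t))"

lemma f_nonzero: "f t \<noteq> 0" and f_power: "f t ^ l t = f t * f t ^ (l t - 1)"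
  using irreducible[of t] l_pos[of t] power_eq_if[of "f t" "l t"] by (auto simp: irreducible_def)

text \<open>For the third claim: membership in the socle would be a relation whose coefficient at
  \<open>N\<close> is minus \<open>f N ^ (l N - 1)\<close>, which \<open>f N ^ l N\<close> does not
  divide.\<close>

lemma adapted_SucD:
  assumes us: "adapted ms (Suc N) us"
  shows "adapted ms N us" "us N \<in> ker (f N ^ l N)" "act (f N ^ (l N - 1)) (us N) \<notin> socle N us (f N)"
proof -
  show "adapted ms N us"
    unfolding adapted_def
  proof (intro conjI allI impI)
    fix a t assume a: "(\<Sum>t<N. act (a t) (us t)) = 0" and t: "t < N"
    have "(\<Sum>t<Suc N. act ((a(N := 0)) t) (us t)) = 0"
      using a adaptedD(1)[OF us, of N] by (simp add: act_0)
    then show "ms t dvd a t" using adaptedD(3)[OF us, of t "a(N := 0)"] t by simp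
  qed (use us in \<open>simp add: adapted_def\<close>)
  show "us N \<in> ker (f N ^ l N)" using us by (simp add: adapted_def)
  show "act (f N ^ (l N - 1)) (us N) \<notin> socle N us (f N)"
  proof
    assume "act (f N ^ (l N - 1)) (us N) \<in> socle N us (f N)"
    then obtain c where c: "act (f N ^ (l N - 1)) (us N) =
        (\<Sum>t | t < N \<and> f t = f N. act (c t * f N ^ (l t - 1)) (us t))" unfolding socle_def by blast
    define a where "a = (\<lambda>t. if t = N then - (f N ^ (l N - 1))
      else if f t = f N then c t * f N ^ (l t - 1) else 0)"
    have "(\<Sum>t<N. act (a t) (us t)) = (\<Sum>t<N. if f t = f N then act (c t * f N ^ (l t - 1)) (us t) else 0)"
      using adaptedD(1)[OF us] by (intro sum.cong) (auto simp: a_def act_0)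
    also have "\<dots> = act (f N ^ (l N - 1)) (us N)"
      unfolding c using sum.inter_filter[of "{..<N}" "\<lambda>t. act (c t * f N ^ (l t - 1)) (us t)" "\<lambda>t. f t = f N"]
      by simp
    finally have "(\<Sum>t<Suc N. act (a t) (us t)) = 0"
      using adaptedD(1)[OF us, of N] by (simp add: a_def act_uminus)
    then have "f N ^ l N dvd f N ^ (l N - 1)"
      using adaptedD(3)[OF us, of N a] by (simp add: a_def)
    then show False
      using f_nonzero[of N] irreducible[of N] l_pos[of N] by (simp add: dvd_power_iff irreducible_def)
  qed
qed

text \<open>In a relation that violates the condition at \<open>N\<close>, multiplication by a
  suitable \<open>r\<close> turns the coefficient of \<open>us N\<close> into
  \<open>f N ^ (l N - 1)\<close> modulo its annihilator and erases the generators of other primes.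
  So \<open>f N ^ (l N - 1)\<close> times \<open>us N\<close> is a combination of generators of the
  same prime; being killed by \<open>f N\<close>, it lies in the socle, against
  \<open>soc\<close>.\<close>

lemma adapted_SucI:
  assumes us: "adapted ms N us" and u: "us N \<in> ker (f N ^ l N)"
    and soc: "act (f N ^ (l N - 1)) (us N) \<notin> socle N us (f N)"
  shows "adapted ms (Suc N) us"
proof -
  let ?p = "f N" and ?I = "{t. t < N \<and> f t = f N}"
  have mem: "us t \<in> U" if "t \<le> N" for t
    using adaptedD(1)[OF us] u that by (cases "t = N") (auto simp: ker_def)
  have key: "?p ^ l N dvd a N" if a: "(\<Sum>t<Suc N. act (a t) (us t)) = 0" for a
  proof (rule ccontr)
    assume nd: "\<not> ?p ^ l N dvd a N"
    then have aN: "a N \<noteq> 0" by auto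
    define m where "m = multiplicity ?p (a N)"
    have m: "m < l N" using nd multiplicity_dvd' not_less unfolding m_def by blast
    have pp: "prime_elem ?p" using irreducible[of N] by (simp add: irreducible_imp_prime_elem)
    obtain a' where a': "a N = ?p ^ m * a'" "\<not> ?p dvd a'"
      using multiplicity_decompose'[of "a N" ?p] aN pp unfolding m_def
      by (metis prime_elem_not_unit)
    \<comment> \<open>\<open>g\<close> kills every earlier generator that belongs to another prime
      and is still coprime to \<open>?p\<close>.\<close>
    define g where "g = (\<Prod>t | t < N \<and> f t \<noteq> ?p. ms t)"
    have "coprime ?p g" unfolding g_def
      using coprime[of N] by (intro prod_coprime_right) auto
    moreover have "coprime ?p a'" using pp a'(2) by (simp add: prime_elem_imp_coprime)
    ultimately have "coprime ?p (g * a')" by simp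
    then obtain x y where xy: "x * ?p + y * (g * a') = 1"
      using bezout_coefficients[of ?p "g * a'"] by (metis coprime_imp_gcd_eq_1 prod.exhaust)
    \<comment> \<open>\<open>a N\<close> has exactly \<open>m\<close> factors \<open>?p\<close>. The
      power supplies the missing ones up to \<open>l N - 1\<close>, and by Bezout
      \<open>y * g\<close> inverts the coprime part \<open>a'\<close> modulo
      \<open>?p\<close>.\<close>
    define r where "r = ?p ^ (l N - 1 - m) * y * g"
    have r: "?p ^ (l N - 1) = r * a N + x * ?p ^ l N"
    proof -
      have "?p ^ (l N - 1) = ?p ^ (l N - 1) * (x * ?p + y * (g * a'))" using xy by simp
      also have "\<dots> = ?p ^ (l N - 1 - m) * ?p ^ m * (y * (g * a')) + x * (?p * ?p ^ (l N - 1))"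
        using m by (simp add: power_add[symmetric] algebra_simps)
      also have "\<dots> = r * a N + x * ?p ^ l N"
        unfolding f_power r_def a'(1) by (simp add: algebra_simps)
      finally show ?thesis .
    qed
    have mem': "act b (us t) \<in> U" if "t \<le> N" for t b using mem[OF that] by (rule act_mem)
    have "act r (\<Sum>t<Suc N. act (a t) (us t)) = (\<Sum>t<N. act (r * a t) (us t)) + act (r * a N) (us N)"
      using mem by (subst act_vsum) (auto simp: act_mult act_mem)
    then have neg: "act (r * a N) (us N) = - (\<Sum>t<N. act (r * a t) (us t))"
      using a by (simp add: act_vzero add_eq_0_iff2)
    have part: "(\<Sum>t<N. act (r * a t) (us t)) = (\<Sum>t\<in>?I. act (r * a t) (us t))"
    proof (rule sum.mono_neutral_right)
      show "\<forall>t\<in>{..<N} - ?I. act (r * a t) (us t) = 0"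
      proof
        fix t assume t: "t \<in> {..<N} - ?I"
        then have "ms t dvd g" unfolding g_def by (intro dvd_prodI) auto
        then have "ms t dvd r * a t" by (simp add: r_def)
        moreover have "t < N" using t by simp
        ultimately show "act (r * a t) (us t) = 0"
          using act_dvd_0[OF adaptedD(1,2)[OF us]] by blast
      qed
    qed auto
    have "act (?p ^ (l N - 1)) (us N) = act (r * a N) (us N)"
    proof -
      have "act (x * ?p ^ l N) (us N) = 0"
        using u act_dvd_0[of "us N" "?p ^ l N" "x * ?p ^ l N"] by (simp add: ker_def)
      then show ?thesis using act_add[OF mem[OF order_refl], of "r * a N" "x * ?p ^ l N"] unfolding r by simp
    qed
    then have eq: "act (?p ^ (l N - 1)) (us N) = - (\<Sum>t\<in>?I. act (r * a t) (us t))"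
      by (simp only: neg part)
    have S: "(\<Sum>t\<in>?I. act (r * a t) (us t)) \<in> U" using mem' by (intro sum_mem) simp
    have "act ?p (act (?p ^ (l N - 1)) (us N)) = act (?p ^ l N) (us N)"
      using mem[OF order_refl] by (simp only: f_power act_mult)
    also have "\<dots> = 0" using u by (simp add: ker_def)
    finally have 0: "act ?p (\<Sum>t\<in>?I. act (r * a t) (us t)) = 0"
      unfolding eq act_vuminus[OF S] by simp
    have "(\<Sum>t\<in>?I. act (?p * (r * a t)) (us t)) =
        act ?p (\<Sum>t\<in>?I. act (r * a t) (us t))"
      using mem by (subst act_vsum) (auto simp: act_mult act_mem)
    moreover note 0
    moreover have "(\<Sum>t\<in>?I. act (?p * (r * a t)) (us t)) =
        (\<Sum>t<N. act (if f t = ?p then ?p * (r * a t) else 0) (us t))"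
      using mem by (intro sum.mono_neutral_cong_left) (auto simp: act_0)
    ultimately have D: "ms t dvd (if f t = ?p then ?p * (r * a t) else 0)" if "t < N" for t
      using adaptedD(3)[OF us that, of "\<lambda>t. if f t = ?p then ?p * (r * a t) else 0"] by simp
    have D': "?p ^ (l t - 1) dvd - (r * a t)" if "t < N" "f t = ?p" for t
    proof -
      have "?p * ?p ^ (l t - 1) dvd ?p * (r * a t)"
        using D[OF that(1)] f_power[of t] that(2) by simp
      then show ?thesis using f_nonzero[of N] by simp
    qed
    define c where "c = (\<lambda>t. - (r * a t) div ?p ^ (l t - 1))"
    have c: "- (r * a t) = c t * ?p ^ (l t - 1)" if "t < N" "f t = ?p" for t
      unfolding c_def using D'[OF that] by (rule dvd_div_mult_self[symmetric])
    have "act (?p ^ (l N - 1)) (us N) = (\<Sum>t\<in>?I. act (- (r * a t)) (us t))"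
      using mem unfolding eq by (simp add: act_uminus sum_negf)
    also have "\<dots> = (\<Sum>t\<in>?I. act (c t * ?p ^ (l t - 1)) (us t))"
      using c by (intro sum.cong) auto
    finally show False using soc unfolding socle_def by blast
  qed
  show ?thesis
    unfolding adapted_def
  proof (intro conjI allI impI)
    fix t assume "t < Suc N"
    then show "us t \<in> ker (ms t)" using us u by (cases "t = N") (auto simp: adapted_def)
  next
    fix a t assume a: "(\<Sum>t<Suc N. act (a t) (us t)) = 0" and t: "t < Suc N"
    have "act (a N) (us N) = 0" using key[OF a] u act_dvd_0[of "us N" "?p ^ l N"] by (simp add: ker_def)
    then have "(\<Sum>t<N. act (a t) (us t)) = 0" using a by simp
    then show "ms t dvd a t" using key[OF a] adaptedD(3)[OF us, of t a] t by (cases "t = N") auto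
  qed
qed

text \<open>Since \<open>p * p ^ (l t - 1)\<close> kills \<open>us t\<close>, the coefficients
  matter only modulo \<open>p\<close>; by adaptedness different residues give different
  elements.\<close>

lemma card_socle:
  assumes us: "adapted ms N us"
  shows "card (socle N us p) = card (UNIV :: 'a set) ^ (degree p * card {t. t < N \<and> f t = p})"
proof (cases "\<exists>t<N. f t = p")
  case False
  then have "{t. t < N \<and> f t = p} = {}" by auto
  then show ?thesis unfolding socle_def by (simp only:) simp
next
  case True
  then obtain t0 where t0: "f t0 = p" by blast
  let ?I = "{t. t < N \<and> f t = p}"
  let ?\<phi> = "\<lambda>c. \<Sum>t\<in>?I. act (c t * p ^ (l t - 1)) (us t)"
  let ?S = "?I \<rightarrow>\<^sub>E (polys_below (degree p) :: 'a poly set)"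
  have p0: "p \<noteq> 0" using f_nonzero t0 by blast
  have fp: "ms t = p * p ^ (l t - 1)" if "t \<in> ?I" for t using that f_power[of t] by simp
  have mem: "us t \<in> U" "act (ms t) (us t) = 0" if "t \<in> ?I" for t using that adaptedD(1,2)[OF us] by auto
  have eqI: "p dvd c t - c' t" if "?\<phi> c = ?\<phi> c'" "t \<in> ?I" for c c' t
  proof -
    have "(\<Sum>t<N. act (if f t = p then (c t - c' t) * p ^ (l t - 1) else 0) (us t)) =
        (\<Sum>t\<in>?I. act ((c t - c' t) * p ^ (l t - 1)) (us t))"
      using adaptedD(1)[OF us] by (intro sum.mono_neutral_cong_right) (auto simp: act_0)
    also have "\<dots> = ?\<phi> c - ?\<phi> c'"
      using mem(1) by (simp add: left_diff_distrib act_diff sum_subtractf)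
    also have "\<dots> = 0" using that by simp
    finally have "ms t dvd (c t - c' t) * p ^ (l t - 1)"
      using adaptedD(3)[OF us, of t "\<lambda>t. if f t = p then (c t - c' t) * p ^ (l t - 1) else 0"] that(2) by simp
    then show ?thesis using p0 by (simp add: fp[OF that(2)])
  qed
  have inj: "inj_on ?\<phi> ?S"
  proof (rule inj_onI)
    fix c c' assume c: "c \<in> ?S" "c' \<in> ?S" "?\<phi> c = ?\<phi> c'"
    show "c = c'"
    proof (rule PiE_ext[OF c(1,2)])
      fix t assume t: "t \<in> ?I"
      then have "c t mod p = c' t mod p" using eqI[OF c(3) t] by (simp add: mod_eq_dvd_iff)
      moreover have "c t \<in> polys_below (degree p)" "c' t \<in> polys_below (degree p)" using c(1,2) t by blast+
      ultimately show "c t = c' t" by (simp add: polys_below_mod)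
    qed
  qed
  have img: "?\<phi> ` ?S = socle N us p"
  proof
    show "?\<phi> ` ?S \<subseteq> socle N us p" unfolding socle_def by blast
    show "socle N us p \<subseteq> ?\<phi> ` ?S"
    proof
      fix z assume "z \<in> socle N us p"
      then obtain c where c: "z = ?\<phi> c" unfolding socle_def by blast
      have "act (c t * p ^ (l t - 1)) (us t) = act ((c t mod p) * p ^ (l t - 1)) (us t)" if "t \<in> ?I" for t
      proof -
        have "c t * p ^ (l t - 1) = (c t mod p) * p ^ (l t - 1) + (c t div p) * ms t"
          unfolding fp[OF that] by (metis distrib_right mod_div_mult_eq mult.assoc)
        then show ?thesis using mem[OF that] act_dvd_0[of "us t" "ms t" "(c t div p) * ms t"] by (simp add: act_add)
      qed
      then have "z = ?\<phi> (\<lambda>t\<in>?I. c t mod p)" unfolding c by (intro sum.cong) auto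
      moreover have "(\<lambda>t\<in>?I. c t mod p) \<in> ?S"
        unfolding restrict_PiE_iff using mod_polys_below[OF p0] by blast
      ultimately show "z \<in> ?\<phi> ` ?S" by (rule image_eqI)
    qed
  qed
  have "card (socle N us p) = card ?S" unfolding img[symmetric] by (rule card_image[OF inj])
  then show ?thesis by (simp add: card_PiE card_polys_below power_mult)
qed

text \<open>The excluded \<open>u\<close> are those that \<open>f N ^ (l N - 1)\<close> sends into
  the socle. The socle lies in the image of the kernel of \<open>f N ^ l N\<close>, so the excluded
  set is parametrised by a socle element and an element of the kernel of
  \<open>f N ^ (l N - 1)\<close>. Here \<open>h i\<close> is the logarithm of the size of the kernel
  of \<open>f N ^ i\<close>, to base q^(deg f N).\<close>

lemma card_extend_adapted:
  assumes us: "adapted ms N us"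
    and h: "\<And>i. card (ker (f N ^ i)) = card (UNIV :: 'a set) ^ (degree (f N) * h i)"
  shows "card {u \<in> ker (f N ^ l N). act (f N ^ (l N - 1)) u \<notin> socle N us (f N)} =
    card (UNIV :: 'a set) ^ (degree (f N) * h (l N)) -
    card (UNIV :: 'a set) ^ (degree (f N) * (h (l N - 1) + card {t. t < N \<and> f t = f N}))"
proof -
  let ?p = "f N" and ?Z = "socle N us (f N)"
  let ?B = "{u \<in> ker (?p ^ l N). act (?p ^ (l N - 1)) u \<in> ?Z}"
  have finK: "finite (ker g)" for g using finite_U by (simp add: ker_def)
  have split: "?p ^ l N = ?p * ?p ^ (l N - 1)" by (rule f_power)
  have "\<exists>u. u \<in> ker (?p ^ l N) \<and> act (?p ^ (l N - 1)) u = z" if zZ: "z \<in> ?Z" for z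
  proof -
    let ?I = "{t. t < N \<and> f t = ?p}"
    obtain c where c: "z = (\<Sum>t\<in>?I. act (c t * ?p ^ (l t - 1)) (us t))" using zZ unfolding socle_def by blast
    have mem: "us t \<in> U" "act (ms t) (us t) = 0" "act b (us t) \<in> U" if "t \<in> ?I" for t b
      using that adaptedD(1,2)[OF us, of t] by (auto intro: act_mem)
    have le: "l N \<le> l t" if "t \<in> ?I" for t using that l_mono[of t N] by auto
    \<comment> \<open>Each exponent \<open>l t - 1\<close> in \<open>z\<close> is lowered by
      \<open>l N - 1\<close>; the subtraction is genuine by \<open>le\<close>.\<close>
    let ?u = "\<Sum>t\<in>?I. act (c t * ?p ^ (l t - l N)) (us t)"
    have uU: "?u \<in> U" using mem(3) by (intro sum_mem) auto
    have "act (?p ^ (l N - 1)) ?u = (\<Sum>t\<in>?I. act (?p ^ (l N - 1) * (c t * ?p ^ (l t - l N))) (us t))"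
      using mem by (subst act_vsum) (auto simp: act_mult act_mem)
    also have "\<dots> = z" unfolding c
    proof (rule sum.cong[OF refl])
      fix t assume t: "t \<in> ?I"
      have "l t - 1 = l N - 1 + (l t - l N)" using le[OF t] l_pos[of N] by simp
      then show "act (?p ^ (l N - 1) * (c t * ?p ^ (l t - l N))) (us t) = act (c t * ?p ^ (l t - 1)) (us t)"
        by (simp add: power_add ac_simps)
    qed
    finally have z: "act (?p ^ (l N - 1)) ?u = z" .
    have "act (?p ^ l N) ?u = (\<Sum>t\<in>?I. act (?p ^ l N * (c t * ?p ^ (l t - l N))) (us t))"
      using mem by (subst act_vsum) (auto simp: act_mult act_mem)
    also have "\<dots> = 0"
    proof (rule sum.neutral, rule ballI)
      fix t assume t: "t \<in> ?I"
      have "ms t = ?p ^ l N * ?p ^ (l t - l N)" using le[OF t] t by (simp add: power_add[symmetric])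
      then have "ms t dvd ?p ^ l N * (c t * ?p ^ (l t - l N))" by (simp add: ac_simps)
      then show "act (?p ^ l N * (c t * ?p ^ (l t - l N))) (us t) = 0" using mem[OF t] act_dvd_0 by blast
    qed
    finally show ?thesis using uU z by (auto simp: ker_def)
  qed
  then obtain s where s: "\<And>z. z \<in> ?Z \<Longrightarrow> s z \<in> ker (?p ^ l N)" "\<And>z. z \<in> ?Z \<Longrightarrow> act (?p ^ (l N - 1)) (s z) = z"
    by metis
  have "bij_betw (\<lambda>(z, y). s z + y) (?Z \<times> ker (?p ^ (l N - 1))) ?B"
  proof (rule bij_betw_byWitness[where f' = "\<lambda>u. (act (?p ^ (l N - 1)) u, u - s (act (?p ^ (l N - 1)) u))"])
    have *: "act (?p ^ (l N - 1)) (s z + y) = z" if "z \<in> ?Z" "y \<in> ker (?p ^ (l N - 1))" for z y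
      using that s by (simp add: ker_def act_vadd)
    then show "\<forall>x\<in>?Z \<times> ker (?p ^ (l N - 1)). (act (?p ^ (l N - 1)) (case x of (z, y) \<Rightarrow> s z + y),
        (case x of (z, y) \<Rightarrow> s z + y) - s (act (?p ^ (l N - 1)) (case x of (z, y) \<Rightarrow> s z + y))) = x"
      by auto
    have "s z + y \<in> ker (?p ^ l N)" if "z \<in> ?Z" "y \<in> ker (?p ^ (l N - 1))" for z y
      using s(1)[OF that(1)] that(2) by (simp add: ker_def act_vadd add_mem split act_mult act_vzero)
    with * show "(\<lambda>(z, y). s z + y) ` (?Z \<times> ker (?p ^ (l N - 1))) \<subseteq> ?B" by auto
    show "(\<lambda>u. (act (?p ^ (l N - 1)) u, u - s (act (?p ^ (l N - 1)) u))) ` ?B \<subseteq> ?Z \<times> ker (?p ^ (l N - 1))"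
      using s by (auto simp: ker_def act_vdiff diff_mem)
  qed auto
  from bij_betw_same_card[OF this]
  have "card ?B = card (UNIV :: 'a set) ^ (degree ?p * card {t. t < N \<and> f t = ?p}) *
      card (UNIV :: 'a set) ^ (degree ?p * h (l N - 1))"
    by (simp add: card_cartesian_product card_socle[OF us] h)
  moreover have "{u \<in> ker (?p ^ l N). act (?p ^ (l N - 1)) u \<notin> ?Z} = ker (?p ^ l N) - ?B" by auto
  ultimately show ?thesis
    using finK by (simp add: card_Diff_subset h power_add[symmetric] distrib_left add.commute)
qed

text \<open>By \<open>card_extend_adapted\<close> the number of choices for a generator does not
  depend on the earlier choices, so the numbers multiply.\<close>

lemma card_adapted:
  assumes h: "\<And>t i. t < N \<Longrightarrow> card (ker (f t ^ i)) = card (UNIV :: 'a set) ^ (degree (f t) * h (f t) i)"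
  shows "card {us \<in> {..<N} \<rightarrow>\<^sub>E U. adapted ms N us} =
    (\<Prod>t<N. card (UNIV :: 'a set) ^ (degree (f t) * h (f t) (l t)) -
      card (UNIV :: 'a set) ^ (degree (f t) * (h (f t) (l t - 1) + card {s. s < t \<and> f s = f t})))"
  using assms
proof (induction N)
  case 0
  have "{us \<in> {..<0::nat} \<rightarrow>\<^sub>E U. adapted ms 0 us} = {\<lambda>_. undefined}" by (auto simp: adapted_def)
  then show ?case by simp
next
  case (Suc N)
  let ?A = "\<lambda>N. {us \<in> {..<N} \<rightarrow>\<^sub>E U. adapted ms N us}"
  let ?C = "\<lambda>us. {u \<in> ker (f N ^ l N). act (f N ^ (l N - 1)) u \<notin> socle N us (f N)}"
  have soc: "socle N (us(N := u)) p = socle N us p" for us u p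
    unfolding socle_def by (intro arg_cong[where f = range] ext sum.cong) auto
  have ad: "adapted ms N (us(N := u)) \<longleftrightarrow> adapted ms N us" for us u by (rule adapted_cong) auto
  have iff: "adapted ms (Suc N) us \<longleftrightarrow> adapted ms N us \<and> us N \<in> ?C us" for us
    using adapted_SucD[of N us] adapted_SucI[of N us] by blast
  have "bij_betw (\<lambda>(us, u). us(N := u)) (SIGMA us:?A N. ?C us) (?A (Suc N))"
  proof (rule bij_betw_byWitness[where f' = "\<lambda>us. (us(N := undefined), us N)"])
    show "\<forall>x\<in>SIGMA us:?A N. ?C us. ((case x of (us, u) \<Rightarrow> us(N := u))(N := undefined),
        (case x of (us, u) \<Rightarrow> us(N := u)) N) = x"
      by (auto simp: PiE_def extensional_def fun_eq_iff)
    show "(\<lambda>(us, u). us(N := u)) ` (SIGMA us:?A N. ?C us) \<subseteq> ?A (Suc N)"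
    proof clarify
      fix us u assume us: "us \<in> {..<N} \<rightarrow>\<^sub>E U" "adapted ms N us" "u \<in> ker (f N ^ l N)"
        "act (f N ^ (l N - 1)) u \<notin> socle N us (f N)"
      then have "us(N := u) \<in> {..<Suc N} \<rightarrow>\<^sub>E U" by (auto simp: PiE_def extensional_def ker_def Pi_def less_Suc_eq)
      then show "us(N := u) \<in> {..<Suc N} \<rightarrow>\<^sub>E U \<and> adapted ms (Suc N) (us(N := u))"
        using us by (simp add: iff soc ad)
    qed
    show "(\<lambda>us. (us(N := undefined), us N)) ` ?A (Suc N) \<subseteq> (SIGMA us:?A N. ?C us)"
    proof (rule image_subsetI)
      fix us assume us: "us \<in> ?A (Suc N)"
      then have "us(N := undefined) \<in> {..<N} \<rightarrow>\<^sub>E U" by (auto simp: PiE_def extensional_def Pi_def)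
      then show "(us(N := undefined), us N) \<in> (SIGMA us:?A N. ?C us)"
        using us by (simp add: iff soc ad)
    qed
  qed auto
  from bij_betw_same_card[OF this] have "card (?A (Suc N)) = card (SIGMA us:?A N. ?C us)" by simp
  also have "\<dots> = (\<Sum>us\<in>?A N. card (?C us))"
    using finite_U by (intro card_SigmaI) (auto simp: ker_def finite_PiE)
  also have "\<dots> = (\<Sum>us\<in>?A N. card (UNIV :: 'a set) ^ (degree (f N) * h (f N) (l N)) -
      card (UNIV :: 'a set) ^ (degree (f N) * (h (f N) (l N - 1) + card {s. s < N \<and> f s = f N})))"
    using Suc.prems by (intro sum.cong card_extend_adapted) auto
  also have "\<dots> = card (?A N) * (card (UNIV :: 'a set) ^ (degree (f N) * h (f N) (l N)) -
      card (UNIV :: 'a set) ^ (degree (f N) * (h (f N) (l N - 1) + card {s. s < N \<and> f s = f N})))"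
    by simp
  also have "card (?A N) = (\<Prod>t<N. card (UNIV :: 'a set) ^ (degree (f t) * h (f t) (l t)) -
      card (UNIV :: 'a set) ^ (degree (f t) * (h (f t) (l t - 1) + card {s. s < t \<and> f s = f t})))"
    using Suc.prems by (intro Suc.IH) auto
  finally show ?case by simp
qed

end

section \<open>The characteristic matrix and the maximal invariant subspace\<close>

text \<open>A polynomial of degree at most that of \<open>g\<close> can be a multiple of
  \<open>g\<close> only as a scalar multiple. The scalar is its coefficient at
  \<open>degree g\<close>.\<close>

lemma monic_dvd_iff:
  fixes g r :: "'a::field_gcd poly"
  assumes g: "lead_coeff g = 1" and r: "r \<in> polys_below (Suc (degree g))"
  shows "g dvd r \<longleftrightarrow> (\<forall>a<degree g. coeff r a = coeff r (degree g) * coeff g a)"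
proof -
  let ?m = "degree g"
  define s where "s = r - smult (coeff r ?m) g"
  have "s \<in> polys_below ?m"
    unfolding polys_below_def
  proof (intro CollectI allI impI)
    fix i assume "?m \<le> i"
    then consider "i = ?m" | "Suc ?m \<le> i" by linarith
    then show "coeff s i = 0"
      using r g by cases (auto simp: s_def polys_below_def coeff_eq_0)
  qed
  then have "g dvd s \<longleftrightarrow> s = 0"
    by (auto simp: polys_below_iff dest: dvd_imp_degree_le)
  moreover have "g dvd s \<longleftrightarrow> g dvd r"
    unfolding s_def by (metis diff_add_cancel dvd_add_left_iff dvd_refl dvd_smult)
  moreover have "s = 0 \<longleftrightarrow> (\<forall>a<?m. coeff s a = 0)"
    using \<open>s \<in> polys_below ?m\<close> unfolding polys_below_def poly_eq_iff by (auto simp: not_less[symmetric])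
  ultimately show ?thesis by (simp add: s_def)
qed

context finite_field_space
begin

lemma sum_nth_eq:
  "distinct B \<Longrightarrow> (\<Sum>i<length B. x (B ! i)) = sum x (set B)"
  by (rule sum.reindex_bij_betw) (simp add: bij_betw_nth)

lemma independent_list_zero:
  assumes B: "distinct B" "independent (set B)" and 0: "(\<Sum>i<length B. scale (c i) (B ! i)) = 0" and i: "i < length B"
  shows "c i = 0"
proof -
  define d where "d = (\<lambda>b. c (the_inv_into {..<length B} ((!) B) b))"
  have d: "d (B ! j) = c j" if "j < length B" for j
    using that B(1) by (simp add: d_def the_inv_into_f_f inj_on_nth)
  have "(\<Sum>b\<in>set B. scale (d b) b) = (\<Sum>i<length B. scale (c i) (B ! i))"
    using d by (subst sum_nth_eq[OF B(1), symmetric]) (auto intro!: sum.cong)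
  then have "d (B ! i) = 0"
    using 0 i by (intro independentD[OF B(2), of "set B"]) auto
  then show ?thesis using d i by simp
qed

lemma sum_representation_list:
  assumes "distinct B" "independent (set B)" "x \<in> span (set B)"
  shows "(\<Sum>i<length B. scale (representation (set B) x (B ! i)) (B ! i)) = x"
  using sum_nth_eq[OF assms(1), of "\<lambda>b. scale (representation (set B) x b) b"]
    sum_representation_eq[OF assms(2,3) finite_set order_refl] by simp

lemma representation_list:
  assumes B: "distinct B" "independent (set B)" and j: "j < length B"
  shows "representation (set B) (\<Sum>i<length B. scale (c i) (B ! i)) (B ! j) = c j"
proof -
  let ?x = "\<Sum>i<length B. scale (c i) (B ! i)"
  have "?x \<in> span (set B)" by (intro span_sum span_scale span_base) auto
  from sum_representation_list[OF B this]
  have "(\<Sum>i<length B. scale (representation (set B) ?x (B ! i) - c i) (B ! i)) = 0"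
    by (simp add: scale_left_diff_distrib sum_subtractf)
  from independent_list_zero[OF B this j] show ?thesis by simp
qed

lemma lin_WV_sum:
  assumes T: "lin_WV scale W V T" and W: "subspace W" and x: "\<And>i. i \<in> I \<Longrightarrow> x i \<in> W"
  shows "T (\<Sum>i\<in>I. scale (c i) (x i)) = (\<Sum>i\<in>I. scale (c i) (T (x i)))"
  using x
proof (induction I rule: infinite_finite_induct)
  case (insert i I)
  have "(\<Sum>i\<in>I. scale (c i) (x i)) \<in> W" using insert.prems W by (intro subspace_sum subspace_scale) auto
  then show ?case using insert W by (simp add: lin_WV_simps[OF T] subspace_scale)
qed (simp_all add: lin_WV_0[OF W T])

end

locale adapted_bases = finite_field_space scale q
  for scale :: "'a::{field_gcd,finite} \<Rightarrow> 'v::ab_group_add \<Rightarrow> 'v" and q :: nat +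
  fixes V W :: "'v set" and B1 B2 :: "'v list" and n k :: nat and T :: "'v \<Rightarrow> 'v"
  assumes kn: "k \<le> n"
    and B1: "distinct B1" "length B1 = k" "independent (set B1)" "span (set B1) = W"
    and B2: "distinct B2" "length B2 = n" "take k B2 = B1" "independent (set B2)" "span (set B2) = V"
    and T: "lin_WV scale W V T"
begin

abbreviation U :: "'v set" where "U \<equiv> inv_part W T"

definition T_U :: "'v \<Rightarrow> 'v" where "T_U = (\<lambda>x. if x \<in> U then T x else 0)"

definition char_entry :: "nat \<Rightarrow> nat \<Rightarrow> 'a poly" where
  "char_entry i j = (if i = j then [:0, 1:] else 0) - [:representation (set B2) (T (B1 ! j)) (B2 ! i):]"

lemma char_mat_eq: "char_mat (mat_of_map scale B1 B2 T) = mat n k (\<lambda>(i, j). char_entry i j)"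
  unfolding char_mat_def mat_of_map_def char_entry_def using B1(2) B2(2) by (intro eq_matI) auto

lemma W_subspace: "subspace W" and V_subspace: "subspace V"
  using B1(4) B2(5) subspace_span by blast+

lemma U_subspace: "subspace U"
  using W_subspace T by (rule subspace_inv_part)

lemma U_subset: "U \<subseteq> W"
  by (rule inv_part_subset)

lemma finite_U: "finite U"
  using card_span_independent[of "set B1"] B1(3,4) finite_subset[OF U_subset] by simp

lemma lin_T_U: "lin_WV scale U U T_U"
  unfolding lin_WV_def
proof (intro conjI ballI allI impI)
  note T' = lin_WV_simps(1-3)[OF T, OF subsetD[OF U_subset]]
  fix x assume x: "x \<in> U"
  show "T_U x \<in> U" using x inv_part_invariant[of T W] by (auto simp: T_U_def)
  show "T_U (x + y) = T_U x + T_U y" if "y \<in> U" for y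
    using x that subspace_add[OF U_subspace x that] T'(2) U_subset by (simp add: T_U_def subsetD)
  show "T_U (scale c x) = scale c (T_U x)" for c
    using x subspace_scale[OF U_subspace x] T'(3) by (simp add: T_U_def)
qed (simp add: T_U_def)

text \<open>The coefficient of \<^term>\<open>x ^ a\<close> in the vector with polynomial coordinates \<^term>\<open>v\<close>.\<close>
definition coeff_vec :: "(nat \<Rightarrow> 'a poly) \<Rightarrow> nat \<Rightarrow> 'v" where
  "coeff_vec v a = (\<Sum>j<k. scale (coeff (v j) a) (B1 ! j))"

lemma coeff_vec_in: "coeff_vec v a \<in> W"
  unfolding coeff_vec_def using W_subspace B1 by (intro subspace_sum subspace_scale) (auto intro: span_base)

lemma B2_nth: "i < k \<Longrightarrow> B2 ! i = B1 ! i"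
  using B2(3) by (metis nth_take)

text \<open>The matrix entries have degree at most 1, so each row has degree at most
  \<open>degree g\<close> and \<open>monic_dvd_iff\<close> applies. The scalars there are the
  coordinates of the top coefficient vector of \<open>v\<close>. Comparing the coefficients at x^a
  in all rows at once gives one vector equation in V for each \<open>a\<close>.\<close>

lemma row_dvd_iff:
  assumes g: "lead_coeff g = 1" and v: "v \<in> {..<k} \<rightarrow>\<^sub>E polys_below (degree g)"
  shows "(\<forall>i<n. g dvd (\<Sum>j<k. char_entry i j * v j)) \<longleftrightarrow>
    (\<forall>a<degree g. T (coeff_vec v a) =
      (if a = 0 then 0 else coeff_vec v (a - 1)) - scale (coeff g a) (coeff_vec v (degree g - 1)))"
proof -
  let ?m = "degree g"
  let ?b = "\<lambda>i j. representation (set B2) (T (B1 ! j)) (B2 ! i)"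
  define r where "r = (\<lambda>i. \<Sum>j<k. char_entry i j * v j)"
  have vj: "coeff (v j) a = 0" if "j < k" "?m \<le> a" for j a
    using v that by (auto simp: polys_below_def PiE_def Pi_def)
  have r: "coeff (r i) a = (if i < k \<and> a > 0 then coeff (v i) (a - 1) else 0) - (\<Sum>j<k. ?b i j * coeff (v j) a)" for i a
  proof -
    have "coeff (char_entry i j * v j) a = (if j = i then (if a > 0 then coeff (v i) (a - 1) else 0) else 0) - ?b i j * coeff (v j) a" for j
      by (cases a) (auto simp: char_entry_def left_diff_distrib)
    then show ?thesis by (auto simp: r_def coeff_sum sum_subtractf)
  qed
  have below: "r i \<in> polys_below (Suc ?m)" for i
    using vj by (auto simp: polys_below_def r)
  have rm: "coeff (r i) ?m = (if i < k then (if ?m > 0 then coeff (v i) (?m - 1) else 0) else 0)" for i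
    using vj by (simp add: r)
  \<comment> \<open>Because \<open>B2\<close> begins with \<open>B1\<close>, the rectangular
    identity block acts as the inclusion of \<open>W\<close> in \<open>V\<close>.\<close>
  have emb: "(\<Sum>i<n. scale (if i < k then c i else 0) (B2 ! i)) = (\<Sum>i<k. scale (c i) (B1 ! i))" for c
    using kn by (intro sum.mono_neutral_cong_right) (auto simp: B2_nth)
  have TB: "T (B1 ! j) = (\<Sum>i<n. scale (?b i j) (B2 ! i))" if "j < k" for j
  proof -
    have "B1 ! j \<in> W" unfolding B1(4)[symmetric] using that B1(2) by (intro span_base) simp
    then have "T (B1 ! j) \<in> span (set B2)" unfolding B2(5) by (rule lin_WV_simps(1)[OF T])
    then show ?thesis using sum_representation_list[OF B2(1,4)] B2(2) by simp
  qed
  have vec: "(\<Sum>i<n. scale (coeff (r i) a - coeff (r i) ?m * coeff g a) (B2 ! i)) =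
      (if a = 0 then 0 else coeff_vec v (a - 1)) - T (coeff_vec v a) - scale (coeff g a) (coeff_vec v (?m - 1))"
    if a: "a < ?m" for a
  proof -
    have "(\<Sum>i<n. scale (coeff (r i) a - coeff (r i) ?m * coeff g a) (B2 ! i)) =
        (\<Sum>i<n. scale (if i < k then (if a > 0 then coeff (v i) (a - 1) else 0) else 0) (B2 ! i))
        - (\<Sum>i<n. scale (\<Sum>j<k. ?b i j * coeff (v j) a) (B2 ! i))
        - (\<Sum>i<n. scale (if i < k then coeff g a * coeff (v i) (?m - 1) else 0) (B2 ! i))"
      unfolding sum_subtractf[symmetric] scale_left_diff_distrib[symmetric] using a
      by (intro sum.cong) (auto simp: r[of _ a] rm)
    also have "(\<Sum>i<n. scale (if i < k then (if a > 0 then coeff (v i) (a - 1) else 0) else 0) (B2 ! i)) =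
        (if a = 0 then 0 else coeff_vec v (a - 1))"
      unfolding emb by (simp add: coeff_vec_def)
    also have "(\<Sum>i<n. scale (if i < k then coeff g a * coeff (v i) (?m - 1) else 0) (B2 ! i)) =
        scale (coeff g a) (coeff_vec v (?m - 1))"
      unfolding emb by (simp add: coeff_vec_def scale_sum_right)
    also have "(\<Sum>i<n. scale (\<Sum>j<k. ?b i j * coeff (v j) a) (B2 ! i)) = (\<Sum>j<k. scale (coeff (v j) a) (T (B1 ! j)))"
    proof -
      have "(\<Sum>i<n. scale (\<Sum>j<k. ?b i j * coeff (v j) a) (B2 ! i)) =
          (\<Sum>i<n. \<Sum>j<k. scale (coeff (v j) a) (scale (?b i j) (B2 ! i)))"
        by (simp add: scale_sum_left mult.commute)
      also have "\<dots> = (\<Sum>j<k. scale (coeff (v j) a) (\<Sum>i<n. scale (?b i j) (B2 ! i)))"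
        by (subst sum.swap) (simp only: scale_sum_right)
      finally show ?thesis using TB by simp
    qed
    also have "(\<Sum>j<k. scale (coeff (v j) a) (T (B1 ! j))) = T (coeff_vec v a)"
      unfolding coeff_vec_def using B1 by (intro lin_WV_sum[OF T W_subspace, symmetric]) (auto intro: span_base)
    finally show ?thesis .
  qed
  have zero_iff: "(\<forall>i<n. d i = 0) \<longleftrightarrow> (\<Sum>i<n. scale (d i) (B2 ! i)) = 0" for d
    using independent_list_zero[OF B2(1,4), unfolded B2(2), of d] by auto
  have shift: "x - t - s = 0 \<longleftrightarrow> t = x - s" for x t s :: 'v
    by (auto simp: algebra_simps)
  have "(\<forall>i<n. g dvd r i) \<longleftrightarrow> (\<forall>a<?m. \<forall>i<n. coeff (r i) a - coeff (r i) ?m * coeff g a = 0)"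
    using monic_dvd_iff[OF g below] by auto
  also have "\<dots> \<longleftrightarrow> (\<forall>a<?m. (\<Sum>i<n. scale (coeff (r i) a - coeff (r i) ?m * coeff g a) (B2 ! i)) = 0)"
    by (simp only: zero_iff)
  also have "\<dots> \<longleftrightarrow> (\<forall>a<?m. T (coeff_vec v a) =
      (if a = 0 then 0 else coeff_vec v (a - 1)) - scale (coeff g a) (coeff_vec v (?m - 1)))"
    by (intro all_cong1 imp_cong refl) (simp only: vec shift)
  finally show ?thesis unfolding r_def .
qed

text \<open>The intermediate values of Horner's scheme for g(T) u. The recursion in
  \<open>row_dvd_iff\<close> forces the coefficient vectors of a solution to be these,
  \<open>u\<close> being the top one.\<close>

definition horner :: "'a poly \<Rightarrow> 'v \<Rightarrow> nat \<Rightarrow> 'v" where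
  "horner g u a = poly_act scale T_U (poly_shift a g) u"

lemma horner_rec: "horner g u a = scale (coeff g a) u + T_U (horner g u (Suc a))"
proof -
  have "poly_shift a g = pCons (coeff g a) (poly_shift (Suc a) g)"
    by (rule poly_eqI) (simp add: coeff_poly_shift coeff_pCons split: nat.split)
  then show ?thesis using poly_act_pCons[of T_U] lin_WV_0[OF U_subspace lin_T_U] by (simp add: horner_def)
qed

interpretation pm: poly_module "poly_act scale T_U" U
  using lin_T_U U_subspace finite_U by (rule poly_module_poly_act)

lemma horner_in: "u \<in> U \<Longrightarrow> horner g u a \<in> U"
  unfolding horner_def by (rule pm.act_mem)

lemma horner_degree:
  assumes "lead_coeff g = 1" "u \<in> U"
  shows "horner g u (degree g) = u"
proof -
  have "poly_shift (degree g) g = 1"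
    using assms(1) by (intro poly_eqI) (auto simp: coeff_poly_shift coeff_eq_0)
  then show ?thesis using assms(2) pm.act_1 by (simp add: horner_def)
qed

text \<open>A solution corresponds to its top coefficient vector \<open>u\<close>. Descending from
  the top, the equations for \<open>a > 0\<close> determine all other coefficient vectors, and the
  equation for \<open>a = 0\<close> says g(T) u = 0. Positive degree ensures that there is a top
  coefficient.\<close>

lemma card_mod_solutions_char_entry:
  assumes g: "lead_coeff g = 1" "degree g > 0"
  shows "card (mod_solutions n k g char_entry) = card {u \<in> U. poly_act scale T_U g u = 0}"
proof -
  let ?S = "mod_solutions n k g char_entry" and ?K = "{u \<in> U. poly_act scale T_U g u = 0}"
  let ?m = "degree g"
  let ?F = "\<lambda>v. coeff_vec v (?m - 1)"
  let ?c = "\<lambda>u a. representation (set B1) (horner g u (Suc a))"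
  let ?G = "\<lambda>u. \<lambda>j\<in>{..<k}. \<Sum>a<?m. monom (?c u a (B1 ! j)) a"
  have T_UI: "T_U x = T x" if "x \<in> U" for x using that by (simp add: T_U_def)
  have sol: "v \<in> ?S \<longleftrightarrow> v \<in> {..<k} \<rightarrow>\<^sub>E polys_below ?m \<and>
      (\<forall>a<?m. T (coeff_vec v a) = (if a = 0 then 0 else coeff_vec v (a - 1)) - scale (coeff g a) (?F v))" for v
    using row_dvd_iff[OF g(1)] unfolding mod_solutions_def by blast
  have inU: "coeff_vec v a \<in> U" if v: "v \<in> ?S" and a: "a < ?m" for v a
  proof -
    let ?X = "span (coeff_vec v ` {..<?m})"
    have XW: "?X \<subseteq> W" using coeff_vec_in W_subspace by (intro span_minimal) auto
    have base: "coeff_vec v a \<in> ?X" if "a < ?m" for a using that by (intro span_base) auto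
    have "?X \<subseteq> {x \<in> W. T x \<in> ?X}"
    proof (rule span_minimal)
      have "T (coeff_vec v a) \<in> ?X" if "a < ?m" for a
      proof -
        have "T (coeff_vec v a) = (if a = 0 then 0 else coeff_vec v (a - 1)) - scale (coeff g a) (?F v)"
          using v that unfolding sol by blast
        also have "\<dots> \<in> ?X" using that g(2) by (intro span_diff span_scale) (auto intro: base span_zero)
        finally show ?thesis .
      qed
      then show "coeff_vec v ` {..<?m} \<subseteq> {x \<in> W. T x \<in> ?X}" using coeff_vec_in by auto
      show "subspace {x \<in> W. T x \<in> ?X}"
        using W_subspace lin_WV_0[OF W_subspace T] lin_WV_simps[OF T]
        by (intro subspaceI) (auto simp: subspace_0 subspace_add subspace_scale span_add span_scale span_zero)
    qed
    then have "?X \<subseteq> U" using XW by (intro subset_inv_part) auto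
    then show ?thesis using base[OF a] by blast
  qed
  have hor: "coeff_vec v a = horner g (?F v) (Suc a)" if v: "v \<in> ?S" and a: "a < ?m" for v a
  proof -
    have "a \<le> ?m - 1" using a by simp
    then show ?thesis
    proof (induction a rule: inc_induct)
      case base
      have "Suc (?m - 1) = ?m" using g(2) by simp
      then show ?case using horner_degree[OF g(1) inU[OF v, of "?m - 1"]] g(2) by simp
    next
      case (step a)
      have "T (coeff_vec v (Suc a)) =
          (if Suc a = 0 then 0 else coeff_vec v (Suc a - 1)) - scale (coeff g (Suc a)) (?F v)"
        using v step(2) unfolding sol by (metis Suc_less_eq2 Suc_pred' g(2))
      then have "T (coeff_vec v (Suc a)) = coeff_vec v a - scale (coeff g (Suc a)) (?F v)" by simp
      moreover have "T (coeff_vec v (Suc a)) = T_U (coeff_vec v (Suc a))"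
        using step inU[OF v, of "Suc a"] by (intro T_UI[symmetric]) simp
      ultimately have "coeff_vec v a = scale (coeff g (Suc a)) (?F v) + T_U (coeff_vec v (Suc a))"
        by (simp add: algebra_simps)
      then show ?case unfolding step.IH by (simp only: horner_rec[of g _ "Suc a"])
    qed
  qed
  have coeff_G: "coeff_vec (?G u) a = horner g u (Suc a)" if u: "u \<in> U" and a: "a < ?m" for u a
  proof -
    have "coeff_vec (?G u) a = (\<Sum>j<k. scale (?c u a (B1 ! j)) (B1 ! j))"
      using a unfolding coeff_vec_def by (intro sum.cong) (auto simp: coeff_sum)
    also have "\<dots> = horner g u (Suc a)"
      using sum_representation_list[OF B1(1,3)] horner_in[OF u] U_subset B1(2,4) by auto
    finally show ?thesis .
  qed
  have "bij_betw ?F (?S) ?K"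
  proof (rule bij_betw_byWitness[where f' = ?G])
    show "\<forall>v\<in>?S. ?G (?F v) = v"
    proof
      fix v assume v: "v \<in> ?S"
      then have vP: "v \<in> {..<k} \<rightarrow>\<^sub>E polys_below ?m" by (simp add: sol)
      have *: "?G (?F v) \<in> {..<k} \<rightarrow>\<^sub>E (UNIV :: 'a poly set)" by simp
      show "?G (?F v) = v"
      proof (rule PiE_ext[OF *])
        show "v \<in> {..<k} \<rightarrow>\<^sub>E (UNIV :: 'a poly set)" using vP by (auto simp: PiE_def)
        fix j assume j: "j \<in> {..<k}"
        show "?G (?F v) j = v j"
        proof (rule poly_eqI)
          fix a
          have "coeff (?G (?F v) j) a = (if a < ?m then ?c (?F v) a (B1 ! j) else 0)"
            using j by (simp add: coeff_sum)
          also have "\<dots> = coeff (v j) a"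
          proof (cases "a < ?m")
            case True
            have "horner g (?F v) (Suc a) = (\<Sum>i<length B1. scale (coeff (v i) a) (B1 ! i))"
              using hor[OF v True] by (simp add: coeff_vec_def B1(2))
            then show ?thesis using True j representation_list[OF B1(1,3), of j "\<lambda>i. coeff (v i) a"] B1(2) by simp
          next
            case False
            have "v j \<in> polys_below ?m" using vP j by blast
            then show ?thesis using False by (auto simp: polys_below_def)
          qed
          finally show "coeff (?G (?F v) j) a = coeff (v j) a" .
        qed
      qed
    qed
    show "\<forall>u\<in>?K. ?F (?G u) = u"
      using coeff_G[of _ "?m - 1"] horner_degree[OF g(1)] g(2) by simp
    show "?F ` ?S \<subseteq> ?K"
    proof (rule image_subsetI)
      fix v assume v: "v \<in> ?S"
      have "poly_act scale T_U g (?F v) = horner g (?F v) 0" by (simp add: horner_def)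
      also have "\<dots> = scale (coeff g 0) (?F v) + T_U (coeff_vec v 0)"
        using hor[OF v g(2)] by (subst horner_rec) simp
      also have "T_U (coeff_vec v 0) = T (coeff_vec v 0)" using inU[OF v g(2)] by (rule T_UI)
      also have "\<dots> = (if 0 = (0::nat) then 0 else coeff_vec v (0 - 1)) - scale (coeff g 0) (?F v)"
        using v g(2) unfolding sol by blast
      finally show "?F v \<in> ?K" using inU[OF v, of "?m - 1"] g(2) by simp
    qed
    show "?G ` ?K \<subseteq> ?S"
    proof (rule image_subsetI)
      fix u assume u: "u \<in> ?K"
      have "?G u \<in> {..<k} \<rightarrow>\<^sub>E polys_below ?m"
        by (auto simp: polys_below_def coeff_sum)
      moreover have "T (coeff_vec (?G u) a) =
          (if a = 0 then 0 else coeff_vec (?G u) (a - 1)) - scale (coeff g a) (?F (?G u))" if a: "a < ?m" for a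
      proof -
        have FG: "?F (?G u) = u" using u coeff_G[of u "?m - 1"] horner_degree[OF g(1)] g(2) by simp
        have "T (coeff_vec (?G u) a) = T_U (horner g u (Suc a))"
          using u a coeff_G[of u a] horner_in[of u] T_UI by simp
        also have "\<dots> = horner g u a - scale (coeff g a) u" by (subst (2) horner_rec) simp
        \<comment> \<open>At \<open>a = 0\<close> the Horner value is g(T) u itself, which vanishes
          because \<open>u\<close> is in the kernel.\<close>
        also have "horner g u a = (if a = 0 then 0 else coeff_vec (?G u) (a - 1))"
          using u a coeff_G[of u "a - 1"] by (auto simp: horner_def)
        finally show ?thesis unfolding FG .
      qed
      ultimately show "?G u \<in> ?S" unfolding sol by blast
    qed
  qed
  then show ?thesis by (rule bij_betw_same_card)
qed

end

section \<open>Bases and the general linear group\<close>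

lemma invertible_mat_iff_det:
  fixes A :: "'a::field mat"
  assumes A: "A \<in> carrier_mat d d"
  shows "invertible_mat A \<longleftrightarrow> det A \<noteq> 0"
proof
  assume "invertible_mat A"
  then obtain B where B: "A * B = 1\<^sub>m d" "B * A = 1\<^sub>m (dim_row B)"
    using A by (auto simp: invertible_mat_def inverts_mat_def)
  have "dim_row B = d" using arg_cong[OF B(2), of dim_col] A by simp
  moreover have "dim_col B = d" using arg_cong[OF B(1), of dim_col] by simp
  ultimately have "B \<in> carrier_mat d d" by auto
  then have "det A * det B = 1" using det_mult[OF A, of B] B(1) by simp
  then show "det A \<noteq> 0" by auto
next
  assume det: "det A \<noteq> 0"
  define B where "B = inverse (det A) \<cdot>\<^sub>m adj_mat A"
  note adj = adj_mat[OF A]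
  have "inverse (det A) \<cdot>\<^sub>m (det A \<cdot>\<^sub>m 1\<^sub>m d) = 1\<^sub>m d"
    using det by (intro eq_matI) auto
  then have "A * B = 1\<^sub>m d" "B * A = 1\<^sub>m d" "dim_row B = d"
    using adj A det by (simp_all add: B_def mult_smult_distrib[of A d d "adj_mat A" d] mult_smult_assoc_mat[of "adj_mat A" d d A d])
  then show "invertible_mat A" using A by (auto simp: invertible_mat_def inverts_mat_def)
qed

context finite_field_space
begin

text \<open>Independence of the family rather than of its image: a repeated vector makes it
  dependent. The count of bases needs them indexed.\<close>

definition indep_family :: "'i set \<Rightarrow> ('i \<Rightarrow> 'v) \<Rightarrow> bool" where
  "indep_family I y \<longleftrightarrow> (\<forall>c. (\<Sum>i\<in>I. scale (c i) (y i)) = 0 \<longrightarrow> (\<forall>i\<in>I. c i = 0))"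

lemma indep_familyD: "indep_family I y \<Longrightarrow> (\<Sum>i\<in>I. scale (c i) (y i)) = 0 \<Longrightarrow> i \<in> I \<Longrightarrow> c i = 0"
  unfolding indep_family_def by blast

lemma indep_family_eqD:
  assumes "indep_family I y" "(\<Sum>i\<in>I. scale (c i) (y i)) = (\<Sum>i\<in>I. scale (c' i) (y i))" "i \<in> I"
  shows "c i = c' i"
proof -
  have "(\<Sum>i\<in>I. scale (c i - c' i) (y i)) = 0"
    using assms(2) by (simp add: scale_left_diff_distrib sum_subtractf)
  from indep_familyD[OF assms(1) this assms(3)] show ?thesis by simp
qed

lemma indep_family_spans:
  assumes U: "subspace U" "finite U" "card U = q ^ card I" and I: "finite I"
    and y: "indep_family I y" "y \<in> I \<rightarrow>\<^sub>E U" and u: "u \<in> U"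
  shows "\<exists>c. u = (\<Sum>i\<in>I. scale (c i) (y i))"
proof -
  let ?\<phi> = "\<lambda>c. \<Sum>i\<in>I. scale (c i) (y i)"
  let ?S = "I \<rightarrow>\<^sub>E (UNIV :: 'a set)"
  have inj: "inj_on ?\<phi> ?S"
  proof (rule inj_onI)
    fix c c' assume c: "c \<in> ?S" "c' \<in> ?S" "?\<phi> c = ?\<phi> c'"
    show "c = c'" by (rule PiE_ext[OF c(1,2)]) (rule indep_family_eqD[OF y(1) c(3)])
  qed
  have "?\<phi> ` ?S \<subseteq> U" using y(2) U(1) by (auto intro!: subspace_sum subspace_scale)
  moreover have "card (?\<phi> ` ?S) = card U"
    by (subst card_image[OF inj]) (simp add: card_PiE I U(3) q)
  ultimately have "?\<phi> ` ?S = U" using U(2) by (simp add: card_subset_eq)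
  then show ?thesis using u by blast
qed

lemma linear_extension_exists:
  assumes U: "subspace U" "finite U" "card U = q ^ card I" and I: "finite I"
    and y: "indep_family I y" "y \<in> I \<rightarrow>\<^sub>E U" and z: "\<And>i. i \<in> I \<Longrightarrow> z i \<in> U"
  shows "\<exists>T. lin_WV scale U U T \<and> (\<forall>i\<in>I. T (y i) = z i)"
proof -
  define C where "C = (\<lambda>u. SOME c. u = (\<Sum>i\<in>I. scale (c i) (y i)))"
  have C: "u = (\<Sum>i\<in>I. scale (C u i) (y i))" if "u \<in> U" for u
    unfolding C_def by (rule someI_ex[OF indep_family_spans[OF U I y that]])
  have CI: "C u i = c i" if "u \<in> U" "u = (\<Sum>i\<in>I. scale (c i) (y i))" "i \<in> I" for u c i
  proof -
    have "(\<Sum>i\<in>I. scale (C u i) (y i)) = (\<Sum>i\<in>I. scale (c i) (y i))"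
      using C[OF that(1)] that(2) by simp
    from indep_family_eqD[OF y(1) this that(3)] show ?thesis .
  qed
  define T where "T = (\<lambda>u. if u \<in> U then \<Sum>i\<in>I. scale (C u i) (z i) else 0)"
  have "lin_WV scale U U T"
    unfolding lin_WV_def
  proof (intro conjI ballI allI impI)
    fix u assume u: "u \<in> U"
    show "T u \<in> U" using u z U(1) by (auto simp: T_def intro!: subspace_sum subspace_scale)
    show "T (u + v) = T u + T v" if v: "v \<in> U" for v
    proof -
      have "u + v = (\<Sum>i\<in>I. scale (C u i + C v i) (y i))"
        using C[OF u] C[OF v] by (simp add: scale_left_distrib sum.distrib)
      then have "C (u + v) i = C u i + C v i" if "i \<in> I" for i
        using that u v U(1) by (intro CI subspace_add)
      then show ?thesis using u v U(1) by (simp add: T_def subspace_add scale_left_distrib sum.distrib)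
    qed
    show "T (scale c u) = scale c (T u)" for c
    proof -
      have "scale c u = scale c (\<Sum>i\<in>I. scale (C u i) (y i))" using C[OF u] by simp
      also have "\<dots> = (\<Sum>i\<in>I. scale (c * C u i) (y i))" by (simp add: scale_sum_right)
      finally have "C (scale c u) i = c * C u i" if "i \<in> I" for i
        using that u U(1) by (intro CI subspace_scale)
      then show ?thesis using u U(1) by (simp add: T_def subspace_scale scale_sum_right)
    qed
  qed (simp add: T_def)
  moreover have "T (y i) = z i" if i: "i \<in> I" for i
  proof -
    have yi: "y i \<in> U" using y(2) i by blast
    have "y i = (\<Sum>j\<in>I. scale (if j = i then 1 else 0) (y j))"
      using i I by (simp add: if_distrib[of "\<lambda>c. scale c _"] cong: if_cong)
    then have "C (y i) j = (if j = i then 1 else 0)" if "j \<in> I" for j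
      using yi that by (intro CI)
    then show ?thesis using yi i I by (simp add: T_def if_distrib[of "\<lambda>c. scale c _"] cong: if_cong)
  qed
  ultimately show ?thesis by blast
qed

text \<open>The coordinates of the vector with index \<open>i\<close> form column
  \<open>\<beta> i\<close> of a square matrix. Independence of the family says that the matrix has
  trivial kernel. The bijection is there because the index set used later consists of pairs.\<close>

lemma card_indep_families:
  assumes b: "distinct b" "independent (set b)" "span (set b) = U" and I: "finite I" "card I = length b"
  shows "card {y \<in> I \<rightarrow>\<^sub>E U. indep_family I y} = GL_card (length b) TYPE('a)"
proof -
  let ?d = "length b"
  obtain \<beta> where \<beta>: "bij_betw \<beta> I {..<?d}"
    using I by (metis finite_same_card_bij finite_lessThan card_lessThan)
  define \<beta>' where "\<beta>' = the_inv_into I \<beta>"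
  have \<beta>'\<beta>: "\<beta>' (\<beta> i) = i" if "i \<in> I" for i
    using \<beta> that by (auto simp: \<beta>'_def bij_betw_def the_inv_into_f_f)
  have \<beta>\<beta>': "\<beta> (\<beta>' r) = r" "\<beta>' r \<in> I" if "r < ?d" for r
    using \<beta> that f_the_inv_into_f[of \<beta> I r] the_inv_into_into[of \<beta> I r I] by (auto simp: \<beta>'_def bij_betw_def)
  have \<beta>_lt: "\<beta> i < ?d" if "i \<in> I" for i using \<beta> that by (auto simp: bij_betw_def)
  define Y where "Y = (\<lambda>A :: 'a mat. \<lambda>i\<in>I. \<Sum>r<?d. scale (A $$ (r, \<beta> i)) (b ! r))"
  define M where "M = (\<lambda>y. mat ?d ?d (\<lambda>(r, s). representation (set b) (y (\<beta>' s)) (b ! r)))"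
  have b_in: "b ! r \<in> U" if "r < ?d" for r using b(3) that span_base[of "b ! r" "set b"] by auto
  have Us: "subspace U" using b(3) by auto
  have Y_in: "Y A \<in> I \<rightarrow>\<^sub>E U" for A
    using b_in Us by (auto simp: Y_def intro!: subspace_sum subspace_scale)
  have MY: "M (Y A) = A" if "A \<in> carrier_mat ?d ?d" for A
  proof (rule eq_matI)
    fix r s assume "r < dim_row A" "s < dim_col A"
    then have rs: "r < ?d" "s < ?d" using that by auto
    then have "M (Y A) $$ (r, s) = representation (set b) (\<Sum>r<?d. scale (A $$ (r, s)) (b ! r)) (b ! r)"
      by (simp add: M_def Y_def \<beta>\<beta>')
    then show "M (Y A) $$ (r, s) = A $$ (r, s)"
      using representation_list[OF b(1,2) rs(1)] by simp
  qed (use that in \<open>auto simp: M_def\<close>)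
  have YM: "Y (M y) = y" if y: "y \<in> I \<rightarrow>\<^sub>E U" for y
  proof (rule PiE_ext[OF Y_in y])
    fix i assume i: "i \<in> I"
    then have "Y (M y) i = (\<Sum>r<?d. scale (representation (set b) (y i) (b ! r)) (b ! r))"
      by (auto simp: Y_def M_def \<beta>_lt \<beta>'\<beta> intro!: sum.cong)
    also have "\<dots> = y i" using y i b(3) by (intro sum_representation_list b) auto
    finally show "Y (M y) i = y i" .
  qed
  have inv: "invertible_mat A \<longleftrightarrow> indep_family I (Y A)" if A: "A \<in> carrier_mat ?d ?d" for A
  proof -
    have comb: "(\<Sum>i\<in>I. scale (c i) (Y A i)) = (\<Sum>r<?d. scale ((A *\<^sub>v vec ?d (\<lambda>s. c (\<beta>' s))) $ r) (b ! r))" for c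
    proof -
      have "(\<Sum>i\<in>I. scale (c i) (Y A i)) = (\<Sum>i\<in>I. \<Sum>r<?d. scale (A $$ (r, \<beta> i) * c i) (b ! r))"
        by (simp add: Y_def scale_sum_right mult.commute)
      also have "\<dots> = (\<Sum>r<?d. scale (\<Sum>i\<in>I. A $$ (r, \<beta> i) * c i) (b ! r))"
        by (subst sum.swap) (simp add: scale_sum_left)
      also have "\<dots> = (\<Sum>r<?d. scale ((A *\<^sub>v vec ?d (\<lambda>s. c (\<beta>' s))) $ r) (b ! r))"
      proof (intro sum.cong refl arg_cong2[where f = scale])
        fix r assume r: "r \<in> {..<?d}"
        have "(A *\<^sub>v vec ?d (\<lambda>s. c (\<beta>' s))) $ r = (\<Sum>s<?d. A $$ (r, s) * c (\<beta>' s))"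
          using A r by (simp add: scalar_prod_def lessThan_atLeast0)
        also have "\<dots> = (\<Sum>i\<in>I. A $$ (r, \<beta> i) * c (\<beta>' (\<beta> i)))"
          by (rule sum.reindex_bij_betw[OF \<beta>, symmetric])
        finally show "(\<Sum>i\<in>I. A $$ (r, \<beta> i) * c i) = (A *\<^sub>v vec ?d (\<lambda>s. c (\<beta>' s))) $ r"
          by (simp add: \<beta>'\<beta>)
      qed
      finally show ?thesis .
    qed
    have zero: "(\<Sum>i\<in>I. scale (c i) (Y A i)) = 0 \<longleftrightarrow> A *\<^sub>v vec ?d (\<lambda>s. c (\<beta>' s)) = 0\<^sub>v ?d" for c
    proof
      assume "(\<Sum>i\<in>I. scale (c i) (Y A i)) = 0"
      from independent_list_zero[OF b(1,2) this[unfolded comb]]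
      show "A *\<^sub>v vec ?d (\<lambda>s. c (\<beta>' s)) = 0\<^sub>v ?d" using A by (intro eq_vecI) auto
    qed (simp add: comb)
    have "indep_family I (Y A) \<longleftrightarrow> \<not> (\<exists>v. v \<in> carrier_vec ?d \<and> v \<noteq> 0\<^sub>v ?d \<and> A *\<^sub>v v = 0\<^sub>v ?d)"
    proof (intro iffI notI)
      assume ind: "indep_family I (Y A)" and "\<exists>v. v \<in> carrier_vec ?d \<and> v \<noteq> 0\<^sub>v ?d \<and> A *\<^sub>v v = 0\<^sub>v ?d"
      then obtain v where v: "v \<in> carrier_vec ?d" "v \<noteq> 0\<^sub>v ?d" "A *\<^sub>v v = 0\<^sub>v ?d" by blast
      have "vec ?d (\<lambda>s. v $ \<beta> (\<beta>' s)) = v" using v(1) by (intro eq_vecI) (auto simp: \<beta>\<beta>')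
      then have "v $ \<beta> i = 0" if "i \<in> I" for i
        using indep_familyD[OF ind _ that, of "\<lambda>i. v $ \<beta> i"] zero[of "\<lambda>i. v $ \<beta> i"] v(3) by simp
      then have "v $ s = 0" if "s < ?d" for s using \<beta>\<beta>'[OF that] by metis
      then show False using v by (auto intro!: eq_vecI)
    next
      assume *: "\<not> (\<exists>v. v \<in> carrier_vec ?d \<and> v \<noteq> 0\<^sub>v ?d \<and> A *\<^sub>v v = 0\<^sub>v ?d)"
      show "indep_family I (Y A)"
        unfolding indep_family_def
      proof (intro allI impI ballI)
        fix c i assume c: "(\<Sum>i\<in>I. scale (c i) (Y A i)) = 0" and i: "i \<in> I"
        then have "vec ?d (\<lambda>s. c (\<beta>' s)) = 0\<^sub>v ?d" using * zero[of c] by (metis vec_carrier)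
        then have "vec ?d (\<lambda>s. c (\<beta>' s)) $ \<beta> i = 0" using \<beta>_lt[OF i] by simp
        then show "c i = 0" using \<beta>_lt[OF i] \<beta>'\<beta>[OF i] by simp
      qed
    qed
    then show ?thesis
      using invertible_mat_iff_det[OF A] det_0_iff_vec_prod_zero_field[OF A] by blast
  qed
  let ?GL = "{A :: 'a mat. A \<in> carrier_mat ?d ?d \<and> invertible_mat A}" and ?B = "{y \<in> I \<rightarrow>\<^sub>E U. indep_family I y}"
  have "bij_betw Y ?GL ?B"
  proof (rule bij_betw_byWitness[where f' = M])
    have Mc: "M y \<in> carrier_mat ?d ?d" for y by (simp add: M_def)
    show "\<forall>A\<in>?GL. M (Y A) = A" using MY by blast
    show "\<forall>y\<in>?B. Y (M y) = y" using YM by blast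
    show "Y ` ?GL \<subseteq> ?B"
      using Y_in inv by blast
    show "M ` ?B \<subseteq> ?GL"
      using Mc inv YM by auto
  qed
  from bij_betw_same_card[OF this] show ?thesis by (simp add: GL_card_def)
qed

end

section \<open>Endomorphisms with generators correspond to bases\<close>

context finite_field_space
begin

lemma funpow_mem: "lin_WV scale U U T \<Longrightarrow> u \<in> U \<Longrightarrow> (T ^^ a) u \<in> U"
  by (induction a) (auto simp: lin_WV_simps)

text \<open>An endomorphism with an adapted family is the same thing as a basis of \<^term>\<open>U\<close>: the vectors
  \<^term>\<open>(T ^^ a) (us t)\<close> with \<^term>\<open>a < degree (ms t)\<close>.\<close>
lemma card_adapted_pairs:
  fixes ms :: "nat \<Rightarrow> 'a poly"
  assumes b: "distinct b" "independent (set b)" "span (set b) = U"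
    and ms: "\<And>t. t < N \<Longrightarrow> lead_coeff (ms t) = 1" "\<And>t. t < N \<Longrightarrow> degree (ms t) > 0"
    and d: "(\<Sum>t<N. degree (ms t)) = length b"
  shows "card (SIGMA T:{T. lin_WV scale U U T}.
      {us \<in> {..<N} \<rightarrow>\<^sub>E U. poly_module.adapted (poly_act scale T) U ms N us}) = GL_card (length b) TYPE('a)"
proof -
  define I where "I = (SIGMA t:{..<N}. {..<degree (ms t)})"
  let ?ad = "\<lambda>T. poly_module.adapted (poly_act scale T) U ms N"
  let ?P = "SIGMA T:{T. lin_WV scale U U T}. {us \<in> {..<N} \<rightarrow>\<^sub>E U. ?ad T us}"
  let ?Y = "{y \<in> I \<rightarrow>\<^sub>E U. indep_family I y}"
  define \<Phi> where "\<Phi> = (\<lambda>(T :: 'v \<Rightarrow> 'v, us :: nat \<Rightarrow> 'v). \<lambda>(t, a)\<in>I. (T ^^ a) (us t))"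
  have I: "finite I" "card I = length b" using d by (auto simp: I_def)
  have U: "subspace U" "finite U" "card U = q ^ card I"
    using card_span_independent[of "set b"] b I by (auto simp: distinct_card)
  have sumI: "(\<Sum>i\<in>I. g i) = (\<Sum>t<N. \<Sum>a<degree (ms t). g (t, a))" for g :: "nat \<times> nat \<Rightarrow> 'v"
    unfolding I_def by (subst sum.Sigma) auto
  have \<Phi>_in: "\<Phi> (T, us) \<in> I \<rightarrow>\<^sub>E U" if "lin_WV scale U U T" "us \<in> {..<N} \<rightarrow>\<^sub>E U" for T us
    using that funpow_mem[OF that(1)] by (auto simp: \<Phi>_def I_def)
  have \<Phi>_I: "\<Phi> (T, us) (t, a) = (T ^^ a) (us t)" if "t < N" "a < degree (ms t)" for T us t a
    using that by (simp add: \<Phi>_def I_def)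
  have act: "poly_act scale T p (us t) = (\<Sum>a<degree (ms t). scale (coeff p a) (\<Phi> (T, us) (t, a)))"
    if "lin_WV scale U U T" "us \<in> {..<N} \<rightarrow>\<^sub>E U" "t < N" "p \<in> polys_below (degree (ms t))" for T us t p
    using poly_act_sum[OF that(1) U(1) _ that(4), of "us t"] that \<Phi>_I by auto
  have \<Phi>_indep: "indep_family I (\<Phi> (T, us)) \<longleftrightarrow> (\<forall>a. (\<Sum>t<N. poly_act scale T (a t) (us t)) = 0 \<longrightarrow> (\<forall>t<N. ms t dvd a t))"
    if T: "lin_WV scale U U T" and us: "us \<in> {..<N} \<rightarrow>\<^sub>E U" and k: "\<And>t. t < N \<Longrightarrow> poly_act scale T (ms t) (us t) = 0" for T us
  proof -
    interpret pm: poly_module "poly_act scale T" U by (rule poly_module_poly_act[OF T U(1,2)])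
    have nz: "ms t \<noteq> 0" if "t < N" for t using ms(1)[OF that] by auto
    show ?thesis
    proof (intro iffI allI impI)
      fix a t assume ind: "indep_family I (\<Phi> (T, us))" and a: "(\<Sum>t<N. poly_act scale T (a t) (us t)) = 0" and t: "t < N"
      \<comment> \<open>Reducing each coefficient modulo \<open>ms t\<close> turns a relation over
        polynomials into a linear relation within the family.\<close>
      have "(\<Sum>i\<in>I. scale (coeff (a (fst i) mod ms (fst i)) (snd i)) (\<Phi> (T, us) i)) =
          (\<Sum>t<N. poly_act scale T (a t mod ms t) (us t))"
        unfolding sumI using act[OF T us _ mod_polys_below[OF nz]] by (intro sum.cong) auto
      also have "\<dots> = (\<Sum>t<N. poly_act scale T (a t) (us t))"
        using us k by (intro sum.cong pm.act_mod) auto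
      finally have "(\<Sum>i\<in>I. scale (coeff (a (fst i) mod ms (fst i)) (snd i)) (\<Phi> (T, us) i)) = 0" using a by simp
      from indep_familyD[OF ind this] have "coeff (a t mod ms t) j = 0" if "j < degree (ms t)" for j
        using t that by (force simp: I_def)
      moreover have "coeff (a t mod ms t) j = 0" if "\<not> j < degree (ms t)" for j
        using mod_polys_below[OF nz[OF t], of "a t"] that by (simp add: polys_below_def)
      ultimately have "a t mod ms t = 0" by (metis poly_eqI coeff_0)
      then show "ms t dvd a t" by (simp add: dvd_eq_mod_eq_0)
    next
      assume *: "\<forall>a. (\<Sum>t<N. poly_act scale T (a t) (us t)) = 0 \<longrightarrow> (\<forall>t<N. ms t dvd a t)"
      show "indep_family I (\<Phi> (T, us))"
        unfolding indep_family_def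
      proof (intro allI impI ballI)
        fix c i assume c: "(\<Sum>i\<in>I. scale (c i) (\<Phi> (T, us) i)) = 0" and i: "i \<in> I"
        define p where "p = (\<lambda>t. \<Sum>a<degree (ms t). monom (c (t, a)) a)"
        have cp: "coeff (p t) a = (if a < degree (ms t) then c (t, a) else 0)" for t a by (simp add: p_def coeff_sum)
        have below: "p t \<in> polys_below (degree (ms t))" for t by (simp add: polys_below_def cp)
        have "(\<Sum>t<N. poly_act scale T (p t) (us t)) = 0"
          using act[OF T us _ below] c unfolding sumI by (simp add: cp)
        then have "ms t dvd p t" if "t < N" for t using * that by blast
        then have "p t = 0" if "t < N" for t
          using polys_below_mod[OF below[of t]] that by (simp add: dvd_eq_mod_eq_0)
        then show "c i = 0" using i cp[of "fst i" "snd i"] by (auto simp: I_def)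
      qed
    qed
  qed
  have kill: "poly_act scale T (ms t) (us t) =
      (\<Sum>a<degree (ms t). scale (coeff (ms t) a) ((T ^^ a) (us t))) + (T ^^ degree (ms t)) (us t)"
    if T: "lin_WV scale U U T" and u: "us t \<in> U" and t: "t < N" for T us t
  proof -
    have "ms t \<in> polys_below (Suc (degree (ms t)))" by (simp add: polys_below_iff)
    from poly_act_sum[OF T U(1) u this] show ?thesis using ms(1)[OF t] by simp
  qed
  have "bij_betw \<Phi> ?P ?Y"
    unfolding bij_betw_def
  proof
    \<comment> \<open>The family determines \<open>T\<close> on itself: \<open>T\<close> moves a
      vector to the next power, and past the last power the relation given by \<open>ms t\<close>
      expresses the image through the same vectors.\<close>
    have step: "T (\<Phi> (T, us) i) = T' (\<Phi> (T', us') i)"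
      if p: "(T, us) \<in> ?P" "(T', us') \<in> ?P" and eq: "\<Phi> (T, us) = \<Phi> (T', us')" and i: "i \<in> I" for T us T' us' i
    proof -
      obtain t a where ta: "i = (t, a)" "t < N" "a < degree (ms t)" using i by (auto simp: I_def)
      show ?thesis
      proof (cases "Suc a < degree (ms t)")
        case True
        have "(T ^^ Suc a) (us t) = (T' ^^ Suc a) (us' t)"
          using fun_cong[OF eq, of "(t, Suc a)"] \<Phi>_I[OF ta(2) True] by metis
        then show ?thesis using ta \<Phi>_I by simp
      next
        case False
        then have a: "degree (ms t) = Suc a" using ta by simp
        have *: "T (\<Phi> (T, us) i) = - (\<Sum>a<degree (ms t). scale (coeff (ms t) a) (\<Phi> (T, us) (t, a)))"
          if "(T, us) \<in> ?P" for T us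
        proof -
          have T: "lin_WV scale U U T" and us: "us \<in> {..<N} \<rightarrow>\<^sub>E U" and ad: "?ad T us" using that by auto
          interpret pm: poly_module "poly_act scale T" U by (rule poly_module_poly_act[OF T U(1,2)])
          have "poly_act scale T (ms t) (us t) = 0" using pm.adaptedD(2)[OF ad ta(2)] .
          moreover have "us t \<in> U" using us ta(2) by blast
          ultimately show ?thesis
            using kill[OF T _ ta(2), of us] ta \<Phi>_I[OF ta(2)] a by (simp add: add_eq_0_iff add_eq_0_iff2)
        qed
        show ?thesis using *[OF p(1)] *[OF p(2)] eq by simp
      qed
    qed
    show "inj_on \<Phi> ?P"
    proof (rule inj_onI)
      fix x x' assume x: "x \<in> ?P" "x' \<in> ?P" and eq: "\<Phi> x = \<Phi> x'"
      obtain T us T' us' where xs: "x = (T, us)" "x' = (T', us')" by (cases x, cases x')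
      have T: "lin_WV scale U U T" "us \<in> {..<N} \<rightarrow>\<^sub>E U" "?ad T us" using x(1) xs by auto
      have T': "lin_WV scale U U T'" "us' \<in> {..<N} \<rightarrow>\<^sub>E U" "?ad T' us'" using x(2) xs by auto
      have "us = us'"
      proof (rule PiE_ext[OF T(2) T'(2)])
        fix t assume "t \<in> {..<N}"
        then show "us t = us' t" using fun_cong[OF eq, of "(t, 0)"] \<Phi>_I[of t 0] ms(2) xs by simp
      qed
      moreover have "T = T'"
      proof
        fix u show "T u = T' u"
        proof (cases "u \<in> U")
          case True
          interpret pm: poly_module "poly_act scale T" U by (rule poly_module_poly_act[OF T(1) U(1,2)])
          have ind: "indep_family I (\<Phi> (T, us))"
            using \<Phi>_indep[OF T(1,2)] T(3) pm.adaptedD(2)[OF T(3)] unfolding pm.adapted_def by blast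
          obtain c where c: "u = (\<Sum>i\<in>I. scale (c i) (\<Phi> (T, us) i))"
            using indep_family_spans[OF U I(1) ind \<Phi>_in[OF T(1,2)] True] by blast
          have mem: "\<Phi> (T, us) i \<in> U" if "i \<in> I" for i using \<Phi>_in[OF T(1,2)] that by blast
          have "T u = (\<Sum>i\<in>I. scale (c i) (T (\<Phi> (T, us) i)))"
            unfolding c using mem by (intro lin_WV_sum[OF T(1) U(1)])
          also have "\<dots> = (\<Sum>i\<in>I. scale (c i) (T' (\<Phi> (T, us) i)))"
          proof (intro sum.cong refl arg_cong[where f = "scale _"])
            fix i assume "i \<in> I"
            from step[OF x(1)[unfolded xs] x(2)[unfolded xs] eq[unfolded xs] this]
            show "T (\<Phi> (T, us) i) = T' (\<Phi> (T, us) i)" using eq xs by simp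
          qed
          also have "\<dots> = T' u"
            unfolding c using mem by (intro lin_WV_sum[OF T'(1) U(1), symmetric])
          finally show ?thesis .
        qed (use T(1) T'(1) lin_WV_simps(4) in metis)
      qed
      ultimately show "x = x'" by (simp add: xs)
    qed
    show "\<Phi> ` ?P = ?Y"
    proof (intro subset_antisym subsetI)
      fix y assume "y \<in> \<Phi> ` ?P"
      then obtain T us where T: "lin_WV scale U U T" "us \<in> {..<N} \<rightarrow>\<^sub>E U" "?ad T us" and y: "y = \<Phi> (T, us)" by auto
      interpret pm: poly_module "poly_act scale T" U by (rule poly_module_poly_act[OF T(1) U(1,2)])
      have "indep_family I y"
        using \<Phi>_indep[OF T(1,2)] T(3) pm.adaptedD(2)[OF T(3)] unfolding pm.adapted_def y by blast
      then show "y \<in> ?Y" using \<Phi>_in[OF T(1,2)] y by blast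
    next
      fix y assume "y \<in> ?Y"
      then have y: "y \<in> I \<rightarrow>\<^sub>E U" "indep_family I y" by auto
      have yU: "y (t, a) \<in> U" if "t < N" "a < degree (ms t)" for t a using y(1) that by (auto simp: I_def)
      \<comment> \<open>The action of the companion matrices of the \<open>ms t\<close>, prescribed
        on the given basis.\<close>
      define z where "z = (\<lambda>(t, a). if Suc a < degree (ms t) then y (t, Suc a)
        else - (\<Sum>b<degree (ms t). scale (coeff (ms t) b) (y (t, b))))"
      have "z i \<in> U" if "i \<in> I" for i
      proof -
        obtain t a where ta: "i = (t, a)" "t < N" using \<open>i \<in> I\<close> by (auto simp: I_def)
        have "- (\<Sum>b<degree (ms t). scale (coeff (ms t) b) (y (t, b))) \<in> U"
          using yU[OF ta(2)] U(1) by (intro subspace_neg subspace_sum subspace_scale) auto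
        then show ?thesis using ta yU by (simp add: z_def)
      qed
      then obtain T where T: "lin_WV scale U U T" "\<And>i. i \<in> I \<Longrightarrow> T (y i) = z i"
        using linear_extension_exists[OF U I(1) y(2,1), of z] by blast
      interpret pm: poly_module "poly_act scale T" U by (rule poly_module_poly_act[OF T(1) U(1,2)])
      define us where "us = (\<lambda>t\<in>{..<N}. y (t, 0))"
      have us: "us \<in> {..<N} \<rightarrow>\<^sub>E U" using yU ms(2) by (auto simp: us_def)
      have pow: "(T ^^ a) (us t) = y (t, a)" if "t < N" "a < degree (ms t)" for t a
        using that(2)
      proof (induction a)
        case (Suc a)
        then show ?case using T(2)[of "(t, a)"] that(1) by (simp add: I_def z_def)
      qed (use that in \<open>simp add: us_def\<close>)
      have y_eq: "\<Phi> (T, us) = y"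
      proof (rule PiE_ext[OF \<Phi>_in[OF T(1) us] y(1)])
        fix i assume "i \<in> I"
        then show "\<Phi> (T, us) i = y i" using pow \<Phi>_I by (auto simp: I_def)
      qed
      have ker: "poly_act scale T (ms t) (us t) = 0" if t: "t < N" for t
      proof -
        obtain D where D: "degree (ms t) = Suc D" using ms(2)[OF t] by (cases "degree (ms t)") auto
        have "(T ^^ degree (ms t)) (us t) = T (y (t, D))" using pow[OF t, of D] D by simp
        also have "\<dots> = - (\<Sum>b<degree (ms t). scale (coeff (ms t) b) (y (t, b)))"
          using T(2)[of "(t, D)"] t D by (simp add: I_def z_def)
        finally show ?thesis using kill[OF T(1) _ t, of us] us t pow[OF t] by auto
      qed
      have "?ad T us"
        unfolding pm.adapted_def pm.ker_def
        using \<Phi>_indep[OF T(1) us ker] y(2) ker us unfolding y_eq by auto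
      then have "(T, us) \<in> ?P" using T(1) us by blast
      then show "y \<in> \<Phi> ` ?P" using y_eq by blast
    qed
  qed
  from bij_betw_same_card[OF this] show ?thesis
    using card_indep_families[OF b I] by simp
qed

end

section \<open>Partitions attached to invariant factors\<close>

lemma prime_iff_monic_irreducible:
  fixes f :: "'a::field_gcd poly"
  shows "prime f \<longleftrightarrow> irreducible f \<and> lead_coeff f = 1"
proof
  assume "prime f"
  then show "irreducible f \<and> lead_coeff f = 1"
    using lead_coeff_normalize_field[of f] by (auto simp: prime_def prime_elem_imp_irreducible)
next
  assume f: "irreducible f \<and> lead_coeff f = 1"
  then have "unit_factor f = 1" by (simp add: unit_factor_poly_def monom_0)
  then have "normalize f = f" by (metis mult_1 unit_factor_mult_normalize)
  then show "prime f" using f by (simp add: prime_def irreducible_imp_prime_elem)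
qed

lemma degree_irreducible_pos:
  fixes f :: "'a::field_gcd poly"
  assumes "irreducible f"
  shows "degree f > 0"
proof (rule ccontr)
  assume "\<not> degree f > 0"
  then obtain c where "f = [:c:]" by (auto elim: degree_eq_zeroE)
  then show False using assms by (cases "c = 0") (auto simp: irreducible_def is_unit_const_poly_iff dvd_field_iff)
qed

lemma degree_gcd_prime_power:
  fixes f p :: "'a::field_gcd poly"
  assumes f: "prime f" and p: "p \<noteq> 0"
  shows "degree (gcd p (f ^ i)) = degree f * min i (multiplicity f p)"
proof -
  define m where "m = multiplicity f p"
  have f0: "f \<noteq> 0" using f by auto
  obtain p' where p': "p = f ^ m * p'" "\<not> f dvd p'"
    using multiplicity_decompose'[of p f] p f unfolding m_def by (metis not_prime_unit)
  show ?thesis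
  proof (cases "i \<le> m")
    case True
    then have "f ^ i dvd p" using multiplicity_dvd'[of i f p] by (simp add: m_def)
    then have "gcd p (f ^ i) = normalize (f ^ i)" by (rule gcd_proj2_if_dvd)
    then show ?thesis using True f0 by (simp add: degree_normalize_field degree_power_eq m_def)
  next
    case False
    then have "gcd p (f ^ i) = gcd (f ^ m * p') (f ^ m * f ^ (i - m))"
      by (simp add: p'(1) power_add[symmetric])
    also have "\<dots> = normalize (f ^ m) * gcd p' (f ^ (i - m))"
      by (simp add: gcd_mult_left normalize_mult)
    also have "gcd p' (f ^ (i - m)) = 1"
      using prime_imp_coprime[OF f p'(2)] by (simp add: coprime_commute)
    finally show ?thesis using False f0 by (simp add: degree_normalize_field degree_power_eq m_def)
  qed
qed

text \<open>Passing from \<open>i\<close> to \<open>i + 1\<close> raises the sum by the number of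
  entries above \<open>i\<close>. In a weakly increasing sequence these are the last ones, so their
  number decides for each position whether its entry exceeds \<open>i\<close>.\<close>

lemma sum_min_eq_imp_eq:
  fixes a b :: "nat \<Rightarrow> nat"
  assumes a: "\<And>i j. i \<le> j \<Longrightarrow> j < k \<Longrightarrow> a i \<le> a j" and b: "\<And>i j. i \<le> j \<Longrightarrow> j < k \<Longrightarrow> b i \<le> b j"
    and eq: "\<And>i. (\<Sum>j<k. min i (a j)) = (\<Sum>j<k. min i (b j))" and j: "j < k"
  shows "a j = b j"
proof -
  have count: "(\<Sum>j<k. min (Suc i) (c j)) = (\<Sum>j<k. min i (c j)) + card {j. j < k \<and> Suc i \<le> c j}" for i and c :: "nat \<Rightarrow> nat"
  proof -
    have "(\<Sum>j<k. min (Suc i) (c j)) = (\<Sum>j<k. min i (c j) + (if Suc i \<le> c j then 1 else 0))"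
      by (intro sum.cong) auto
    moreover have "(\<Sum>j<k. (if Suc i \<le> c j then 1 else 0)) = card {j. j < k \<and> Suc i \<le> c j}"
      by (simp add: sum.If_cases Int_def)
    ultimately show ?thesis by (simp only: sum.distrib)
  qed
  have iff: "Suc i \<le> c j \<longleftrightarrow> k - card {j. j < k \<and> Suc i \<le> c j} \<le> j"
    if c: "\<And>i j. i \<le> j \<Longrightarrow> j < k \<Longrightarrow> c i \<le> c j" for i and c :: "nat \<Rightarrow> nat"
  proof
    assume "Suc i \<le> c j"
    then have "{j..<k} \<subseteq> {j. j < k \<and> Suc i \<le> c j}" using c by (auto intro: order_trans)
    then have "card {j..<k} \<le> card {j. j < k \<and> Suc i \<le> c j}" by (intro card_mono) auto
    then show "k - card {j. j < k \<and> Suc i \<le> c j} \<le> j" by simp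
  next
    assume le: "k - card {j. j < k \<and> Suc i \<le> c j} \<le> j"
    show "Suc i \<le> c j"
    proof (rule ccontr)
      assume "\<not> Suc i \<le> c j"
      then have "{j. j < k \<and> Suc i \<le> c j} \<subseteq> {Suc j..<k}"
        using c[of _ j] j by (force simp: not_le Suc_le_eq)
      then have "card {j. j < k \<and> Suc i \<le> c j} \<le> card {Suc j..<k}" by (intro card_mono) auto
      then show False using le j by simp
    qed
  qed
  have suc: "Suc i \<le> a j \<longleftrightarrow> Suc i \<le> b j" for i
  proof -
    have "card {j. j < k \<and> Suc i \<le> a j} = card {j. j < k \<and> Suc i \<le> b j}"
      using count[of i a] count[of i b] eq[of i] eq[of "Suc i"] by simp
    then show ?thesis using iff[of a i, OF a] iff[of b i, OF b] by presburger
  qed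
  show ?thesis using suc[of "a j - 1"] suc[of "b j - 1"] by (cases "a j"; cases "b j") auto
qed

lemma inv_factor_tuple_dvd:
  assumes "inv_factor_tuple k ps" "i \<le> j" "j < k"
  shows "ps ! i dvd ps ! j"
  using assms(2,3)
proof (induction j rule: dec_induct)
  case (step j)
  then have "ps ! j dvd ps ! Suc j" using assms(1) by (simp add: inv_factor_tuple_def)
  then show ?case using step by (meson Suc_lessD dvd_trans)
qed simp

lemma inv_factor_tuple_nonzero:
  assumes "inv_factor_tuple k ps" "j < k"
  shows "ps ! j \<noteq> 0" "lead_coeff (ps ! j) = 1"
proof -
  have "ps ! j \<in> set ps" using assms by (simp add: inv_factor_tuple_def)
  then show "lead_coeff (ps ! j) = 1" using assms(1) by (simp add: inv_factor_tuple_def)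
  then show "ps ! j \<noteq> 0" by auto
qed

lemma inv_factor_tuple_multiplicity_mono:
  assumes "inv_factor_tuple k ps" "i \<le> j" "j < k"
  shows "multiplicity f (ps ! i) \<le> multiplicity f (ps ! j)"
  using inv_factor_tuple_dvd[OF assms] inv_factor_tuple_nonzero[OF assms(1,3)] by (intro dvd_imp_multiplicity_le)

lemma inv_factor_tuple_eqI:
  fixes ps ps' :: "'a::field_gcd poly list"
  assumes ps: "inv_factor_tuple k ps" and ps': "inv_factor_tuple k ps'"
    and eq: "\<And>f i. prime f \<Longrightarrow> (\<Sum>j<k. min i (multiplicity f (ps ! j))) = (\<Sum>j<k. min i (multiplicity f (ps' ! j)))"
  shows "ps = ps'"
proof (rule nth_equalityI)
  show "length ps = length ps'" using ps ps' by (simp add: inv_factor_tuple_def)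
  fix j assume "j < length ps"
  then have j: "j < k" using ps by (simp add: inv_factor_tuple_def)
  note nz = inv_factor_tuple_nonzero[OF ps j] inv_factor_tuple_nonzero[OF ps' j]
  have "multiplicity f (ps ! j) = multiplicity f (ps' ! j)" if "prime f" for f
    using inv_factor_tuple_multiplicity_mono[OF ps] inv_factor_tuple_multiplicity_mono[OF ps'] eq[OF that] j
    by (rule sum_min_eq_imp_eq)
  then have "normalize (ps ! j) = normalize (ps' ! j)" using nz by (intro multiplicity_eq_imp_eq)
  moreover have "unit_factor (ps ! j) = unit_factor (ps' ! j)" using nz by (simp add: unit_factor_poly_def)
  ultimately show "ps ! j = ps' ! j" by (metis unit_factor_mult_normalize)
qed

text \<open>Both sides count the boxes in the first \<open>i\<close> columns of the Young diagram.
  The right-hand form is the exponent that governs the kernel of f^i.\<close>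

lemma h_part_eq: "h_part lam i = (\<Sum>s<length lam. min i (lam ! s))"
proof -
  have "h_part lam i = (\<Sum>l\<in>{1..i}. \<Sum>s<length lam. if l \<le> lam ! s then 1 else 0)"
    unfolding h_part_def conj_part_def by (intro sum.cong refl) (simp add: sum.If_cases Int_def)
  also have "\<dots> = (\<Sum>s<length lam. \<Sum>l\<in>{1..i}. if l \<le> lam ! s then 1 else 0)"
    by (rule sum.swap)
  also have "\<dots> = (\<Sum>s<length lam. min i (lam ! s))"
  proof (intro sum.cong refl)
    fix s
    have "{1..i} \<inter> {l. l \<le> lam ! s} = {1..min i (lam ! s)}" by auto
    then show "(\<Sum>l\<in>{1..i}. if l \<le> lam ! s then 1 else 0) = min i (lam ! s)" by (simp add: sum.If_cases)
  qed
  finally show ?thesis .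
qed

lemma conj_part_antimono: "i \<le> i' \<Longrightarrow> conj_part lam i' \<le> conj_part lam i"
  unfolding conj_part_def by (intro card_mono) auto

lemma conj_part_le_length: "conj_part lam i \<le> length lam"
proof -
  have "conj_part lam i \<le> card {..<length lam}" unfolding conj_part_def by (intro card_mono) auto
  then show ?thesis by simp
qed

lemma le_nth_iff_less_conj_part:
  assumes "sorted_wrt (\<ge>) lam" "s < length lam"
  shows "i \<le> lam ! s \<longleftrightarrow> s < conj_part lam i"
proof -
  have mono: "lam ! t \<le> lam ! r" if "r \<le> t" "t < length lam" for r t
    using that assms(1) by (cases "r = t") (auto simp: sorted_wrt_iff_nth_less)
  show ?thesis
  proof
    assume i: "i \<le> lam ! s"
    have "{..s} \<subseteq> {j. j < length lam \<and> i \<le> lam ! j}"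
    proof
      fix r assume "r \<in> {..s}"
      then show "r \<in> {j. j < length lam \<and> i \<le> lam ! j}" using mono[of r s] assms(2) i by auto
    qed
    then have "card {..s} \<le> conj_part lam i" unfolding conj_part_def by (intro card_mono) auto
    then show "s < conj_part lam i" by simp
  next
    assume less: "s < conj_part lam i"
    show "i \<le> lam ! s"
    proof (rule ccontr)
      assume "\<not> i \<le> lam ! s"
      then have "r < s" if "r < length lam" "i \<le> lam ! r" for r
        using mono[of s r] that by linarith
      then have "{j. j < length lam \<and> i \<le> lam ! j} \<subseteq> {..<s}" by blast
      then have "conj_part lam i \<le> card {..<s}" unfolding conj_part_def by (intro card_mono) auto
      then show False using less by simp
    qed
  qed
qed

text \<open>The parts equal to \<^term>\<open>i\<close> occupy the positions \<^term>\<open>{conj_part lam (Suc i)..<conj_part lam i}\<close>;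
  the index \<^term>\<open>j\<close> of \<^const>\<open>c_part\<close> counts them backwards.\<close>
lemma c_part_eq_prod_positions:
  assumes lam: "sorted_wrt (\<ge>) lam" "\<forall>x\<in>set lam. 0 < x"
  shows "c_part q e lam = (\<Prod>s<length lam. q ^ (e * h_part lam (lam ! s)) - q ^ (e * (h_part lam (lam ! s - 1) + s)))"
proof -
  let ?F = "\<lambda>s. q ^ (e * h_part lam (lam ! s)) - q ^ (e * (h_part lam (lam ! s - 1) + s))"
  have in_range: "lam ! s \<in> {1..sum_list lam}" if "s < length lam" for s
    using that lam(2) by (auto simp: Suc_le_eq intro: member_le_sum_list)
  have part: "(\<Prod>j\<in>{1..mult_part lam i}. q ^ (e * h_part lam i) - q ^ (e * (h_part lam i - j))) =
      (\<Prod>s | s < length lam \<and> lam ! s = i. ?F s)" if i: "i \<ge> 1" for i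
  proof -
    have pos: "s < length lam \<and> lam ! s = i \<longleftrightarrow> conj_part lam (Suc i) \<le> s \<and> s < conj_part lam i" for s
    proof (cases "s < length lam")
      case True
      have "lam ! s = i \<longleftrightarrow> \<not> Suc i \<le> lam ! s \<and> i \<le> lam ! s" by linarith
      then show ?thesis using True by (simp only: le_nth_iff_less_conj_part[OF lam(1) True] not_less simp_thms)
    next
      case False
      then show ?thesis using conj_part_le_length[of lam i] by linarith
    qed
    note anti = conj_part_antimono[of i "Suc i" lam]
    have h: "h_part lam i = h_part lam (i - 1) + conj_part lam i"
      using i unfolding h_part_def by (cases i) auto
    show ?thesis
    proof (rule prod.reindex_bij_witness[where i = "\<lambda>s. conj_part lam i - s" and j = "\<lambda>j. conj_part lam i - j"])
      fix j assume "j \<in> {1..mult_part lam i}"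
      then have j: "1 \<le> j" "j \<le> conj_part lam i - conj_part lam (Suc i)" by (auto simp: mult_part_def)
      show "conj_part lam i - (conj_part lam i - j) = j" using j by simp
      have p: "conj_part lam i - j < length lam \<and> lam ! (conj_part lam i - j) = i"
        unfolding pos using j anti by linarith
      then show "conj_part lam i - j \<in> {s. s < length lam \<and> lam ! s = i}" by simp
      have "h_part lam (i - 1) + (conj_part lam i - j) = h_part lam i - j"
        using h j by linarith
      then show "?F (conj_part lam i - j) = q ^ (e * h_part lam i) - q ^ (e * (h_part lam i - j))"
        using p by simp
    next
      fix s assume "s \<in> {s. s < length lam \<and> lam ! s = i}"
      then have "conj_part lam (Suc i) \<le> s" "s < conj_part lam i" unfolding mem_Collect_eq pos by auto
      then show "conj_part lam i - (conj_part lam i - s) = s" "conj_part lam i - s \<in> {1..mult_part lam i}"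
        by (auto simp: mult_part_def)
    qed
  qed
  have "c_part q e lam = (\<Prod>i\<in>{1..sum_list lam}. \<Prod>s | s < length lam \<and> lam ! s = i. ?F s)"
    unfolding c_part_def by (intro prod.cong refl part) auto
  also have "\<dots> = (\<Prod>i\<in>{1..sum_list lam}. \<Prod>s | s \<in> {..<length lam} \<and> lam ! s = i. ?F s)" by simp
  also have "\<dots> = (\<Prod>s<length lam. ?F s)"
    using in_range by (intro prod.group) auto
  finally show ?thesis .
qed

lemma c_part_pos:
  assumes "q \<ge> 2" "e > 0"
  shows "c_part q e lam > 0"
proof -
  have "q ^ (e * (h_part lam i - j)) < q ^ (e * h_part lam i)" if "i \<in> {1..sum_list lam}" "j \<in> {1..mult_part lam i}" for i j
  proof -
    have "conj_part lam i \<le> h_part lam i"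
      unfolding h_part_def using that(1) by (intro member_le_sum) auto
    then have "h_part lam i - j < h_part lam i" using that(2) unfolding mult_part_def by auto
    then show ?thesis using assms by (intro power_strict_increasing) auto
  qed
  then show ?thesis unfolding c_part_def by (intro prod_pos) auto
qed

lemma S_set_iff: "f \<in> S_set ps \<longleftrightarrow> prime f \<and> f dvd prod_list ps"
  unfolding S_set_def prime_iff_monic_irreducible by blast

lemma S_set_eq_prime_factors:
  assumes "inv_factor_tuple k ps"
  shows "S_set ps = prime_factors (prod_list ps)"
proof -
  have "prod_list ps \<noteq> 0" using inv_factor_tuple_nonzero[OF assms] assms
    by (auto simp: prod_list_zero_iff inv_factor_tuple_def in_set_conv_nth)
  then show ?thesis by (auto simp: S_set_iff prime_factors_dvd)
qed

lemma multiplicity_prod_list: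
  assumes "prime f" "0 \<notin> set ps"
  shows "multiplicity f (prod_list ps) = (\<Sum>j<length ps. multiplicity f (ps ! j))"
proof -
  have "multiplicity f (prod_list ps) = (\<Sum>p\<leftarrow>ps. multiplicity f p)"
    using assms by (induction ps) (auto simp: prime_elem_multiplicity_mult_distrib prod_list_zero_iff)
  then show ?thesis by (simp add: sum_list_sum_nth lessThan_atLeast0)
qed

lemma mem_dvd_prod_list: "p \<in> set ps \<Longrightarrow> p dvd prod_list ps" for p :: "'a::comm_monoid_mult"
  by (induction ps) auto

lemma inv_factor_tuple_0_notin: "inv_factor_tuple k ps \<Longrightarrow> 0 \<notin> set ps"
  by (auto simp: inv_factor_tuple_def)

lemma degree_prod_list_S_set:
  fixes ps :: "'a::field_gcd poly list"
  assumes ps: "inv_factor_tuple k ps"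
  shows "degree (prod_list ps) = (\<Sum>f\<in>S_set ps. degree f * (\<Sum>j<k. multiplicity f (ps ! j)))"
proof -
  have len: "length ps = k" using ps by (simp add: inv_factor_tuple_def)
  have nz: "prod_list ps \<noteq> 0" using inv_factor_tuple_0_notin[OF ps] by (simp add: prod_list_zero_iff)
  have "degree (prod_list ps) = degree (\<Prod>f\<in>prime_factors (prod_list ps). f ^ multiplicity f (prod_list ps))"
    using prod_prime_factors[OF nz] by (simp add: degree_normalize_field)
  also have "\<dots> = (\<Sum>f\<in>prime_factors (prod_list ps). degree (f ^ multiplicity f (prod_list ps)))"
    by (intro degree_prod_sum_eq) (auto dest: in_prime_factors_imp_prime)
  also have "\<dots> = (\<Sum>f\<in>prime_factors (prod_list ps). degree f * (\<Sum>j<k. multiplicity f (ps ! j)))"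
  proof (intro sum.cong refl)
    fix f assume "f \<in> prime_factors (prod_list ps)"
    then have "prime f" by auto
    then have "f \<noteq> 0" by auto
    then show "degree (f ^ multiplicity f (prod_list ps)) = degree f * (\<Sum>j<k. multiplicity f (ps ! j))"
      using multiplicity_prod_list[OF \<open>prime f\<close> inv_factor_tuple_0_notin[OF ps]] by (simp add: degree_power_eq len)
  qed
  finally show ?thesis using S_set_eq_prime_factors[OF ps] by simp
qed

text \<open>\<open>Phi\<close> drops the invariant factors not divisible by \<open>f\<close>. As
  they come first in the chain, only zero multiplicities are dropped, and
  \<open>\<phi> 0 = 0\<close> puts them back into a sum.\<close>

lemma
  fixes ps :: "'a::field_gcd poly list"
  assumes ps: "inv_factor_tuple k ps" and f: "f \<in> S_set ps"
  shows Phi_sorted: "sorted_wrt (\<ge>) (Phi ps f)"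
    and Phi_pos: "\<forall>x\<in>set (Phi ps f). 0 < x"
    and Phi_sum: "\<phi> 0 = (0::nat) \<Longrightarrow> (\<Sum>x\<leftarrow>Phi ps f. \<phi> x) = (\<Sum>j<k. \<phi> (multiplicity f (ps ! j)))"
proof -
  define \<mu> where "\<mu> = (\<lambda>j. multiplicity f (ps ! j))"
  have len: "length ps = k" using ps by (simp add: inv_factor_tuple_def)
  have "prime f" and dvd: "f dvd prod_list ps"
    using f by (auto simp: S_set_iff)
  have mono: "\<mu> i \<le> \<mu> j" if "i \<le> j" "j < k" for i j
    unfolding \<mu>_def using inv_factor_tuple_multiplicity_mono[OF ps that] .
  have "prod_list ps \<noteq> 0" using inv_factor_tuple_0_notin[OF ps] by (simp add: prod_list_zero_iff)
  then have "multiplicity f (prod_list ps) \<noteq> 0"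
    using dvd \<open>prime f\<close> by (simp add: prime_multiplicity_gt_zero_iff[symmetric] flip: neq0_conv)
  then have "(\<Sum>j<k. \<mu> j) \<noteq> 0"
    using multiplicity_prod_list[OF \<open>prime f\<close> inv_factor_tuple_0_notin[OF ps]] by (simp add: len \<mu>_def)
  then obtain j0 where j0: "j0 < k" "\<mu> j0 > 0" by auto
  define r where "r = (LEAST i. 1 \<le> i \<and> 0 < \<mu> (i - 1))"
  have ex: "1 \<le> Suc j0 \<and> 0 < \<mu> (Suc j0 - 1)" using j0 by simp
  have r: "1 \<le> r" "0 < \<mu> (r - 1)" unfolding r_def using LeastI[of "\<lambda>i. 1 \<le> i \<and> 0 < \<mu> (i - 1)", OF ex] by auto
  have zero: "\<mu> j = 0" if "j < r - 1" for j
  proof -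
    have "Suc j < r" using that by simp
    then show ?thesis using not_less_Least[of "Suc j" "\<lambda>i. 1 \<le> i \<and> 0 < \<mu> (i - 1)"] unfolding r_def by simp
  qed
  have Phi: "Phi ps f = map (\<lambda>i. \<mu> (i - 1)) (rev [r..<k + 1])"
    unfolding Phi_def r_def \<mu>_def len Let_def ..
  show "sorted_wrt (\<ge>) (Phi ps f)"
    unfolding Phi sorted_wrt_iff_nth_less using mono by (auto simp: rev_nth simp del: upt_Suc)
  show "\<forall>x\<in>set (Phi ps f). 0 < x"
    unfolding Phi using r mono[of "r - 1"] by (force simp del: upt_Suc intro: less_le_trans)
  show "(\<Sum>x\<leftarrow>Phi ps f. \<phi> x) = (\<Sum>j<k. \<phi> (multiplicity f (ps ! j)))" if "\<phi> 0 = (0::nat)"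
  proof -
    have "(\<Sum>x\<leftarrow>Phi ps f. \<phi> x) = (\<Sum>i\<in>{r..<k+1}. \<phi> (\<mu> (i - 1)))"
      unfolding Phi by (simp add: rev_map[symmetric] comp_def interv_sum_list_conv_sum_set_nat del: upt_Suc)
    also have "\<dots> = (\<Sum>j\<in>{r - 1..<k}. \<phi> (\<mu> j))"
      using r(1) by (intro sum.reindex_bij_witness[where i = Suc and j = "\<lambda>i. i - 1"]) auto
    also have "\<dots> = (\<Sum>j<k. \<phi> (\<mu> j))"
      using zero that by (intro sum.mono_neutral_left) auto
    finally show ?thesis by (simp add: \<mu>_def)
  qed
qed

text \<open>The last argument of \<open>G\<close> is the number of earlier entries with the same
  first component, that is, of generators already chosen for the same prime in
  \<open>card_adapted\<close>.\<close>

definition position_prod :: "('b \<Rightarrow> nat \<Rightarrow> nat \<Rightarrow> nat) \<Rightarrow> ('b \<times> nat) list \<Rightarrow> nat" where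
  "position_prod G xs = (\<Prod>t<length xs. G (fst (xs ! t)) (snd (xs ! t)) (card {s. s < t \<and> fst (xs ! s) = fst (xs ! t)}))"

lemma position_prod_append:
  assumes "fst ` set xs \<inter> fst ` set ys = {}"
  shows "position_prod G (xs @ ys) = position_prod G xs * position_prod G ys"
proof -
  let ?n = "length xs"
  let ?g = "\<lambda>zs t. G (fst (zs ! t)) (snd (zs ! t)) (card {s. s < t \<and> fst (zs ! s) = fst (zs ! t)})"
  have "(\<Prod>t<?n + m. h t) = (\<Prod>t<?n. h t) * (\<Prod>t<m. h (?n + t))" for m and h :: "nat \<Rightarrow> nat"
    by (induction m) auto
  then have "(\<Prod>t<?n + length ys. ?g (xs @ ys) t) = (\<Prod>t<?n. ?g (xs @ ys) t) * (\<Prod>t<length ys. ?g (xs @ ys) (?n + t))" .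
  also have "(\<Prod>t<?n. ?g (xs @ ys) t) = (\<Prod>t<?n. ?g xs t)"
  proof (rule prod.cong)
    fix t assume "t \<in> {..<?n}"
    then have that: "t < ?n" by simp
    show "?g (xs @ ys) t = ?g xs t"
    proof -
      have "{s. s < t \<and> fst ((xs @ ys) ! s) = fst ((xs @ ys) ! t)} = {s. s < t \<and> fst (xs ! s) = fst (xs ! t)}"
        using that by (auto simp: nth_append)
      then show ?thesis using that by (simp add: nth_append)
    qed
  qed simp
  also have "(\<Prod>t<length ys. ?g (xs @ ys) (?n + t)) = (\<Prod>t<length ys. ?g ys t)"
  proof (rule prod.cong)
    fix t assume "t \<in> {..<length ys}"
    then have t: "t < length ys" by simp
    show "?g (xs @ ys) (?n + t) = ?g ys t"
    proof -
      have "{s. s < ?n + t \<and> fst ((xs @ ys) ! s) = fst (ys ! t)} = (+) ?n ` {s. s < t \<and> fst (ys ! s) = fst (ys ! t)}"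
      proof (intro subset_antisym subsetI)
        fix s assume s: "s \<in> {s. s < ?n + t \<and> fst ((xs @ ys) ! s) = fst (ys ! t)}"
        have "?n \<le> s"
        proof (rule ccontr)
          assume "\<not> ?n \<le> s"
          then have "fst (ys ! t) \<in> fst ` set xs" using s by (auto simp: nth_append intro!: rev_image_eqI[of "xs ! s"])
          moreover have "fst (ys ! t) \<in> fst ` set ys" using t by simp
          ultimately show False using assms by blast
        qed
        then show "s \<in> (+) ?n ` {s. s < t \<and> fst (ys ! s) = fst (ys ! t)}"
          using s by (intro rev_image_eqI[of "s - ?n"]) (auto simp: nth_append)
      qed (auto simp: nth_append)
      then show ?thesis by (simp add: card_image)
    qed
  qed simp
  finally show ?thesis by (simp add: position_prod_def)
qed

lemma position_prod_Pair: "position_prod G (map (Pair f) lam) = (\<Prod>s<length lam. G f (lam ! s) s)"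
  unfolding position_prod_def
proof (intro prod.cong)
  fix t assume "t \<in> {..<length lam}"
  then have t: "t < length lam" by simp
  then have "{s. s < t \<and> fst (map (Pair f) lam ! s) = fst (map (Pair f) lam ! t)} = {..<t}" by auto
  then show "G (fst (map (Pair f) lam ! t)) (snd (map (Pair f) lam ! t))
      (card {s. s < t \<and> fst (map (Pair f) lam ! s) = fst (map (Pair f) lam ! t)}) = G f (lam ! t) t"
    using t by simp
qed simp

definition pair_list :: "'b list \<Rightarrow> ('b \<Rightarrow> nat list) \<Rightarrow> ('b \<times> nat) list" where
  "pair_list fs \<Lambda> = concat (map (\<lambda>f. map (Pair f) (\<Lambda> f)) fs)"

lemma pair_list_simps [simp]:
  "pair_list [] \<Lambda> = []"
  "pair_list (f # fs) \<Lambda> = map (Pair f) (\<Lambda> f) @ pair_list fs \<Lambda>"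
  by (simp_all add: pair_list_def)

lemma set_pair_list: "set (pair_list fs \<Lambda>) = {(f, x). f \<in> set fs \<and> x \<in> set (\<Lambda> f)}"
  by (auto simp: pair_list_def)

lemma position_prod_pair_list:
  assumes "distinct fs"
  shows "position_prod G (pair_list fs \<Lambda>) = (\<Prod>f\<in>set fs. \<Prod>s<length (\<Lambda> f). G f (\<Lambda> f ! s) s)"
  using assms
proof (induction fs)
  case (Cons f fs)
  have "fst ` set (map (Pair f) (\<Lambda> f)) \<inter> fst ` set (pair_list fs \<Lambda>) = {}"
    using Cons.prems by (auto simp: set_pair_list)
  then show ?case using Cons by (simp add: position_prod_append position_prod_Pair)
qed (simp add: position_prod_def)

lemma sum_pair_list:
  "distinct fs \<Longrightarrow> (\<Sum>x\<leftarrow>pair_list fs \<Lambda>. \<phi> x) = (\<Sum>f\<in>set fs. \<Sum>x\<leftarrow>\<Lambda> f. \<phi> (f, x) :: nat)"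
  by (induction fs) (auto simp: comp_def)

lemma sorted_pair_list:
  assumes "distinct fs" "\<And>f. f \<in> set fs \<Longrightarrow> sorted_wrt (\<ge>) (\<Lambda> f)"
  shows "sorted_wrt (\<lambda>x y. fst x = fst y \<longrightarrow> snd y \<le> snd x) (pair_list fs \<Lambda>)"
  using assms by (induction fs) (auto simp: sorted_wrt_append sorted_wrt_map set_pair_list)

section \<open>Endomorphisms of U with prescribed kernel sizes\<close>

context finite_field_space
begin

text \<open>The condition, expressed through kernels, that \<^term>\<open>T\<close> has invariant factors \<^term>\<open>ps\<close>.\<close>
definition has_kernel_type :: "'v set \<Rightarrow> 'a poly list \<Rightarrow> ('v \<Rightarrow> 'v) \<Rightarrow> bool" where
  "has_kernel_type U ps T \<longleftrightarrow> (\<forall>f i. prime f \<longrightarrow> card {u \<in> U. poly_act scale T (f ^ i) u = 0} =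
     q ^ (degree f * (\<Sum>j<length ps. min i (multiplicity f (ps ! j)))))"

text \<open>The pairs of \<open>card_adapted_pairs\<close> are counted by their endomorphism. The
  cyclic summands are listed prime by prime with the parts of \<open>Phi ps f\<close> as exponents;
  the degrees of their annihilators add up to the dimension of \<open>U\<close>.\<close>

lemma card_has_kernel_type:
  assumes b: "distinct b" "independent (set b)" "span (set b) = U"
    and ps: "inv_factor_tuple k ps" and d: "degree (prod_list ps) = length b"
  shows "card {T. lin_WV scale U U T \<and> has_kernel_type U ps T} * (\<Prod>f\<in>S_set ps. c_part q (degree f) (Phi ps f)) =
    GL_card (length b) TYPE('a)"
proof -
  have len: "length ps = k" using ps by (simp add: inv_factor_tuple_def)
  have Us: "subspace U" "finite U" "card U = q ^ length b"
    using card_span_independent[of "set b"] b by (auto simp: distinct_card)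
  have "finite (S_set ps)" unfolding S_set_eq_prime_factors[OF ps] by simp
  then obtain fs where fs: "set fs = S_set ps" "distinct fs" using finite_distinct_list by blast
  define fl where "fl = pair_list fs (Phi ps)"
  define N where "N = length fl"
  \<comment> \<open>\<open>prime_powers\<close> speaks about all indices, so the list is continued
    by the prime x with exponent 1, the smallest exponent possible, which respects the decreasing
    order.\<close>
  define f where "f = (\<lambda>t. if t < N then fst (fl ! t) else [:0, 1:])"
  define l where "l = (\<lambda>t. if t < N then snd (fl ! t) else 1)"
  have S_prime: "prime p" if "p \<in> S_set ps" for p
    using that by (simp add: S_set_iff)
  have set_fl: "set fl = {(p, x). p \<in> S_set ps \<and> x \<in> set (Phi ps p)}"
    unfolding fl_def set_pair_list fs(1) ..
  have fl_mem: "fst (fl ! t) \<in> S_set ps" "snd (fl ! t) \<in> set (Phi ps (fst (fl ! t)))" if "t < N" for t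
  proof -
    have "fl ! t \<in> {(p, x). p \<in> S_set ps \<and> x \<in> set (Phi ps p)}"
      unfolding set_fl[symmetric] using that by (simp add: N_def)
    then show "fst (fl ! t) \<in> S_set ps" "snd (fl ! t) \<in> set (Phi ps (fst (fl ! t)))"
      by (cases "fl ! t", simp)+
  qed
  have prime_X: "prime [:0, 1 :: 'a:]"
    unfolding prime_iff_monic_irreducible using irreducible_linear_field_poly[of 1 0] by simp
  have f_prime: "prime (f t)" for t
    using S_prime fl_mem(1) prime_X by (auto simp: f_def)
  have l_pos: "0 < l t" for t
    using Phi_pos[OF ps fl_mem(1)] fl_mem(2) by (auto simp: l_def)
  have l_mono: "l t \<le> l s" if "s \<le> t" "f s = f t" for s t
  proof (cases "s < t \<and> t < N")
    case True
    have "sorted_wrt (\<lambda>x y. fst x = fst y \<longrightarrow> snd y \<le> snd x) fl"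
      unfolding fl_def using fs Phi_sorted[OF ps] by (intro sorted_pair_list) auto
    then show ?thesis using True that unfolding sorted_wrt_iff_nth_less N_def f_def l_def by auto
  next
    case False
    then show ?thesis using that l_pos[of s] by (cases "s = t") (auto simp: l_def)
  qed
  have sum_fl: "(\<Sum>t<N. \<phi> (f t) (l t)) = (\<Sum>p\<in>S_set ps. \<Sum>j<k. \<phi> p (multiplicity p (ps ! j)))"
    if "\<And>p. \<phi> p 0 = 0" for \<phi> :: "'a poly \<Rightarrow> nat \<Rightarrow> nat"
  proof -
    have "(\<Sum>t<N. \<phi> (f t) (l t)) = (\<Sum>x\<leftarrow>fl. \<phi> (fst x) (snd x))"
      by (simp add: sum_list_sum_nth N_def f_def l_def lessThan_atLeast0)
    also have "\<dots> = (\<Sum>p\<in>S_set ps. \<Sum>x\<leftarrow>Phi ps p. \<phi> p x)"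
      unfolding fl_def by (simp add: sum_pair_list fs)
    also have "\<dots> = (\<Sum>p\<in>S_set ps. \<Sum>j<k. \<phi> p (multiplicity p (ps ! j)))"
      using that by (intro sum.cong Phi_sum[OF ps]) auto
    finally show ?thesis .
  qed
  let ?ms = "\<lambda>t. f t ^ l t"
  have f0: "f t \<noteq> 0" for t using f_prime[of t] by auto
  have deg_ms: "degree (?ms t) = degree (f t) * l t" for t using f0 by (simp add: degree_power_eq)
  have total: "(\<Sum>t<N. degree (?ms t)) = length b"
    unfolding deg_ms using sum_fl[of "\<lambda>p x. degree p * x"] degree_prod_list_S_set[OF ps] d
    by (simp add: sum_distrib_left)
  have gcd_sum: "(\<Sum>t<N. degree (gcd (p ^ i) (?ms t))) = degree p * (\<Sum>j<k. min i (multiplicity p (ps ! j)))"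
    if p: "prime p" for p i
  proof -
    have "degree (gcd (p ^ i) (?ms t)) = (if f t = p then degree p * min i (l t) else 0)" for t
    proof (cases "f t = p")
      case True
      then show ?thesis using degree_gcd_prime_power[OF p, of "?ms t" i] f0[of t] p
        by (simp add: gcd.commute multiplicity_prime_power)
    next
      case False
      then have "gcd (p ^ i) (?ms t) = 1" using p f_prime[of t] by (simp add: primes_coprime)
      then show ?thesis using False by simp
    qed
    then have "(\<Sum>t<N. degree (gcd (p ^ i) (?ms t))) = (\<Sum>r\<in>S_set ps. \<Sum>j<k. if r = p then degree p * min i (multiplicity r (ps ! j)) else 0)"
      using sum_fl[of "\<lambda>r x. if r = p then degree p * min i x else 0"] by simp
    also have "\<dots> = (if p \<in> S_set ps then degree p * (\<Sum>j<k. min i (multiplicity p (ps ! j))) else 0)"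
    proof -
      have "(\<Sum>j<k. if r = p then degree p * min i (multiplicity r (ps ! j)) else 0) =
          (if r = p then degree p * (\<Sum>j<k. min i (multiplicity p (ps ! j))) else 0)" for r
        by (simp add: sum_distrib_left)
      then show ?thesis using \<open>finite (S_set ps)\<close> by simp
    qed
    also have "\<dots> = degree p * (\<Sum>j<k. min i (multiplicity p (ps ! j)))"
    proof (cases "p \<in> S_set ps")
      case False
      then have "\<not> p dvd prod_list ps" using p by (simp add: S_set_iff)
      then have "multiplicity p (ps ! j) = 0" if "j < k" for j
        using that len by (intro not_dvd_imp_multiplicity_0) (meson dvd_trans nth_mem mem_dvd_prod_list)
      then show ?thesis using False by simp
    qed simp
    finally show ?thesis .
  qed
  let ?ad = "\<lambda>T. {us \<in> {..<N} \<rightarrow>\<^sub>E U. poly_module.adapted (poly_act scale T) U ?ms N us}"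
  let ?h = "\<lambda>p i. \<Sum>j<k. min i (multiplicity p (ps ! j))"
  have card_ad: "card (?ad T) = (if has_kernel_type U ps T then \<Prod>p\<in>S_set ps. c_part q (degree p) (Phi ps p) else 0)"
    if T: "lin_WV scale U U T" for T
  proof -
    interpret pm: poly_module "poly_act scale T" U by (rule poly_module_poly_act[OF T Us(1,2)])
    interpret prime_powers "poly_act scale T" U f l
    proof
      show "irreducible (f t)" for t using f_prime unfolding prime_iff_monic_irreducible by blast
      show "coprime (f s) (f t)" if "f s \<noteq> f t" for s t using f_prime that by (intro primes_coprime)
    qed (use l_pos l_mono in auto)
    show ?thesis
    proof (cases "has_kernel_type U ps T")
      case True
      then have h: "card (pm.ker (f t ^ i)) = card (UNIV :: 'a set) ^ (degree (f t) * ?h (f t) i)" for t i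
        using f_prime unfolding has_kernel_type_def pm.ker_def len unfolding q by blast
      let ?G = "\<lambda>p x s. q ^ (degree p * ?h p x) - q ^ (degree p * (?h p (x - 1) + s))"
      have "card (?ad T) = (\<Prod>t<N. ?G (f t) (l t) (card {s. s < t \<and> f s = f t}))"
        using card_adapted[of N "\<lambda>p i. ?h p i", OF h] unfolding q .
      also have "\<dots> = position_prod ?G fl"
        unfolding position_prod_def N_def[symmetric]
      proof (rule prod.cong)
        fix t assume "t \<in> {..<N}"
        then have "{s. s < t \<and> f s = f t} = {s. s < t \<and> fst (fl ! s) = fst (fl ! t)}" "f t = fst (fl ! t)" "l t = snd (fl ! t)"
          by (auto simp: f_def l_def)
        then show "?G (f t) (l t) (card {s. s < t \<and> f s = f t}) =
          ?G (fst (fl ! t)) (snd (fl ! t)) (card {s. s < t \<and> fst (fl ! s) = fst (fl ! t)})" by simp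
      qed simp
      also have "\<dots> = (\<Prod>p\<in>S_set ps. \<Prod>s<length (Phi ps p). ?G p (Phi ps p ! s) s)"
        unfolding fl_def position_prod_pair_list[OF fs(2)] fs(1) ..
      also have "\<dots> = (\<Prod>p\<in>S_set ps. c_part q (degree p) (Phi ps p))"
      proof (intro prod.cong refl)
        fix p assume p: "p \<in> S_set ps"
        have "?h p i = h_part (Phi ps p) i" for i
          using Phi_sum[OF ps p, of "min i"] by (simp add: h_part_eq sum_list_sum_nth lessThan_atLeast0)
        then show "(\<Prod>s<length (Phi ps p). ?G p (Phi ps p ! s) s) = c_part q (degree p) (Phi ps p)"
          using c_part_eq_prod_positions[OF Phi_sorted[OF ps p] Phi_pos[OF ps p], of q "degree p"] by simp
      qed
      finally show ?thesis using True by simp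
    next
      case False
      \<comment> \<open>An adapted family fixes all kernel sizes, so an endomorphism of another type
        has none.\<close>
      have "has_kernel_type U ps T" if us: "pm.adapted ?ms N us" for us
      proof -
        have "card U = card (UNIV :: 'a set) ^ (\<Sum>t<N. degree (?ms t))" using Us(3) total q by simp
        from pm.card_ker_adapted[OF us _ this] f0
        have "card (pm.ker g) = card (UNIV :: 'a set) ^ (\<Sum>t<N. degree (gcd g (?ms t)))" for g by simp
        then show ?thesis unfolding has_kernel_type_def pm.ker_def[symmetric] len unfolding q using gcd_sum by simp
      qed
      then have empty: "?ad T = {}" using False by blast
      show ?thesis unfolding empty using False by simp
    qed
  qed
  let ?L = "{T. lin_WV scale U U T}"
  have finL: "finite ?L" using Us(2) by (rule finite_lin_WV) (rule Us(2))
  have "GL_card (length b) TYPE('a) = card (SIGMA T:?L. ?ad T)"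
  proof (rule card_adapted_pairs[OF b _ _ total, symmetric])
    show "lead_coeff (?ms t) = 1" for t
      using f_prime[of t] unfolding prime_iff_monic_irreducible by (simp add: lead_coeff_power)
    show "0 < degree (?ms t)" for t
      using l_pos degree_irreducible_pos[of "f t"] f_prime[of t] unfolding prime_iff_monic_irreducible deg_ms by simp
  qed
  also have "\<dots> = (\<Sum>T\<in>?L. card (?ad T))"
    using finL Us(2) by (intro card_SigmaI) (auto simp: finite_PiE)
  also have "\<dots> = (\<Sum>T\<in>?L. if has_kernel_type U ps T then \<Prod>p\<in>S_set ps. c_part q (degree p) (Phi ps p) else 0)"
    using card_ad by (intro sum.cong) auto
  also have "\<dots> = card {T. lin_WV scale U U T \<and> has_kernel_type U ps T} * (\<Prod>p\<in>S_set ps. c_part q (degree p) (Phi ps p))"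
    using finL by (simp add: sum.If_cases Int_def)
  finally show ?thesis by simp
qed

end

section \<open>The counting formula\<close>

context adapted_bases
begin

text \<open>For the modulus f^i the number of solutions is a kernel size on one side and, on the
  other, q to the power deg f times the sum of the minima of \<open>i\<close> and the multiplicities
  of f. By \<open>inv_factor_tuple_eqI\<close> these sums determine the tuple.\<close>

lemma invariant_factors_eq_iff:
  assumes ps: "inv_factor_tuple k ps"
  shows "invariant_factors (char_mat (mat_of_map scale B1 B2 T)) = ps \<longleftrightarrow> has_kernel_type U ps T_U"
proof -
  define ps' where "ps' = invariant_factors (char_mat (mat_of_map scale B1 B2 T))"
  interpret pm: poly_module "poly_act scale T_U" U
    using lin_T_U U_subspace finite_U by (rule poly_module_poly_act)
  \<comment> \<open>Its degree exceeds the dimension of \<open>U\<close>, so its kernel, a subset of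
    \<open>U\<close>, has fewer than q^(degree g0) elements.\<close>
  define g0 :: "'a poly" where "g0 = monom 1 (Suc (dim U))"
  have g0: "lead_coeff g0 = 1" "degree g0 = Suc (dim U)" "g0 \<noteq> 0" by (simp_all add: g0_def degree_monom_eq)
  have "card (mod_solutions n k g0 char_entry) = card {u \<in> U. poly_act scale T_U g0 u = 0}"
    using g0 by (intro card_mod_solutions_char_entry) auto
  also have "\<dots> \<le> card U" using finite_U by (intro card_mono) auto
  also have "\<dots> = q ^ dim U" by (rule subspace_card_dim[OF U_subspace finite_U])
  also have "\<dots> < q ^ degree g0" using q_ge_2 by (simp add: g0)
  finally have small: "card (mod_solutions n k g0 char_entry) < card (UNIV :: 'a set) ^ degree g0" unfolding q .
  note inv = invariant_factors_mod_solutions[OF kn g0(3) small, folded char_mat_eq, folded ps'_def]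
  have ker: "card {u \<in> U. poly_act scale T_U (f ^ i) u = 0} = q ^ (degree f * (\<Sum>j<k. min i (multiplicity f (ps' ! j))))"
    if f: "prime f" for f i
  \<comment> \<open>The modulus f^0 = 1 has no top coefficient below its degree and is outside
    \<open>card_mod_solutions_char_entry\<close>.\<close>
  proof (cases "i = 0")
    case True
    have "{u \<in> U. poly_act scale T_U (f ^ i) u = 0} = {0}"
      using True pm.act_1 pm.zero_mem by auto
    then show ?thesis using True by simp
  next
    case False
    have irr: "irreducible f" and lc: "lead_coeff f = 1" using f unfolding prime_iff_monic_irreducible by auto
    have "card {u \<in> U. poly_act scale T_U (f ^ i) u = 0} = card (mod_solutions n k (f ^ i) char_entry)"
    proof (rule card_mod_solutions_char_entry[symmetric])
      show "lead_coeff (f ^ i) = 1" using lc by (simp add: lead_coeff_power)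
      show "degree (f ^ i) > 0"
        using degree_irreducible_pos[OF irr] False f degree_power_eq[of f i] by fastforce
    qed
    also have "\<dots> = q ^ (\<Sum>j<k. degree (gcd (ps' ! j) (f ^ i)))"
      unfolding q using f by (intro inv(2)) auto
    also have "(\<Sum>j<k. degree (gcd (ps' ! j) (f ^ i))) = (\<Sum>j<k. degree f * min i (multiplicity f (ps' ! j)))"
      using inv_factor_tuple_nonzero(1)[OF inv(1)] by (intro sum.cong) (auto simp: degree_gcd_prime_power[OF f])
    finally show ?thesis by (simp add: sum_distrib_left)
  qed
  have len: "length ps = k" "length ps' = k" using ps inv(1) by (auto simp: inv_factor_tuple_def)
  show ?thesis
    unfolding ps'_def[symmetric]
  proof
    assume "ps' = ps"
    then show "has_kernel_type U ps T_U" using ker len unfolding has_kernel_type_def by simp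
  next
    assume type: "has_kernel_type U ps T_U"
    show "ps' = ps"
    proof (rule inv_factor_tuple_eqI[OF inv(1) ps])
      fix f :: "'a poly" and i assume f: "prime f"
      then have "q ^ (degree f * (\<Sum>j<k. min i (multiplicity f (ps' ! j)))) = q ^ (degree f * (\<Sum>j<k. min i (multiplicity f (ps ! j))))"
        using type ker[OF f, of i] len unfolding has_kernel_type_def by simp
      moreover have "degree f > 0" using f unfolding prime_iff_monic_irreducible by (simp add: degree_irreducible_pos)
      ultimately show "(\<Sum>j<k. min i (multiplicity f (ps' ! j))) = (\<Sum>j<k. min i (multiplicity f (ps ! j)))"
        using q_ge_2 by (simp add: power_inject_exp)
    qed
  qed
qed

end

theorem theorem3:
  fixes scale :: "'a::{field_gcd,finite} \<Rightarrow> 'v::ab_group_add \<Rightarrow> 'v"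
    and V W U :: "'v set" and B1 B2 :: "'v list" and n k d q :: nat and ps :: "'a poly list"
  assumes q: "q = card (UNIV :: 'a set)"
    and vs: "vector_space scale"
    and kn: "0 < k" "k \<le> n"
    and V: "module.subspace scale V" "vector_space.dim scale V = n"
    and W: "module.subspace scale W" "W \<subseteq> V" "vector_space.dim scale W = k"
    and B1: "distinct B1" "length B1 = k" "module.independent scale (set B1)"
            "module.span scale (set B1) = W"
    and B2: "distinct B2" "length B2 = n" "take k B2 = B1" "module.independent scale (set B2)"
            "module.span scale (set B2) = V"
    and U: "module.subspace scale U" "U \<subseteq> W" "vector_space.dim scale U = d"
    and I: "inv_factor_tuple k ps" "degree (prod_list ps) = d"
  shows "real (card {T. lin_WV scale W V T \<and> is_max_inv_sub scale W T U
                   \<and> invariant_factors (char_mat (mat_of_map scale B1 B2 T)) = ps})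
       = real (GL_card d TYPE('a))
         / real (\<Prod>f\<in>S_set ps. c_part q (degree f) (Phi ps f))
         * (\<Prod>i\<in>{d+1..k}. (real q ^ n - real q ^ i))"
proof -
  interpret finite_field_space scale q
    using vs q by (simp add: finite_field_space_def finite_field_space_axioms_def)
  have finV: "finite V" "card V = q ^ n"
    using card_span_independent[of "set B2"] B2 by (auto simp: distinct_card)
  have finW: "finite W" "card W = q ^ k"
    using card_span_independent[of "set B1"] B1 by (auto simp: distinct_card)
  have finU: "finite U" using U(2) finW(1) finite_subset by blast
  then have cardU: "card U = q ^ d" using subspace_card_dim[OF U(1)] U(3) by simp
  \<comment> \<open>The given basis of \<open>W\<close> need not contain a basis of
    \<open>U\<close>. The extension chain uses a basis of its own, while \<open>B1\<close> and
    \<open>B2\<close> serve only the matrix of \<open>T\<close>.\<close>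
  obtain B where B: "B \<subseteq> U" "independent B" "U \<subseteq> span B" "card B = d"
    using basis_exists[of U] U(3) by blast
  have finB: "finite B" using B(1) finU finite_subset by blast
  have spanB: "span B = U" using B(1,3) U(1) span_minimal by blast
  obtain b where b: "set b = B" "distinct b" using finB finite_distinct_list by blast
  then have lenb: "length b = d" using B(4) distinct_card by fastforce
  obtain C where C: "B \<subseteq> C" "C \<subseteq> W" "independent C" "W \<subseteq> span C"
    using maximal_independent_subset_extend[of B W] B(1,2) U(2) by blast
  have spanC: "span C = W" using C(2,4) W(1) span_minimal by blast
  have finC: "finite C" using C(2) finW(1) finite_subset by blast
  have "q ^ card C = q ^ k" using card_span_independent[OF finC C(3)] spanC finW(2) by simp
  then have "card C = k" using q_ge_2 by (simp add: power_inject_exp)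
  define A where "A = C - B"
  have A: "finite A" "B \<union> A = C" "B \<inter> A = {}" "card A = k - d"
    using finC C(1) finB B(4) \<open>card C = k\<close> by (auto simp: A_def card_Diff_subset)
  have dk: "d \<le> k" using card_mono[OF finC C(1)] B(4) \<open>card C = k\<close> by simp
  \<comment> \<open>The argument is \<open>T_U\<close> when \<open>U\<close> is the invariant part
    of \<open>T\<close>; cutting off outside \<open>U\<close> makes \<open>P\<close> depend on the
    values on \<open>U\<close> only.\<close>
  define P where "P = (\<lambda>T. has_kernel_type U ps (\<lambda>x. if x \<in> U then T x else 0))"
  have P_cong: "P T \<longleftrightarrow> P T'" if "\<forall>u\<in>U. T u = T' u" for T T'
  proof -
    have "(\<lambda>x. if x \<in> U then T x else 0) = (\<lambda>x. if x \<in> U then T' x else 0)" using that by auto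
    then show ?thesis by (simp add: P_def)
  qed
  have "{T. lin_WV scale W V T \<and> is_max_inv_sub scale W T U
      \<and> invariant_factors (char_mat (mat_of_map scale B1 B2 T)) = ps} =
    {T. lin_WV scale (span (B \<union> A)) V T \<and> inv_part (span (B \<union> A)) T = U \<and> P T}"
  proof (intro Collect_cong conj_cong)
    fix T
    show "lin_WV scale W V T \<longleftrightarrow> lin_WV scale (span (B \<union> A)) V T" by (simp add: A(2) spanC)
    assume "lin_WV scale (span (B \<union> A)) V T"
    then have T: "lin_WV scale W V T" by (simp add: A(2) spanC)
    show "is_max_inv_sub scale W T U \<longleftrightarrow> inv_part (span (B \<union> A)) T = U"
      using is_max_inv_sub_iff[OF W(1) T] by (auto simp: A(2) spanC)
    assume "inv_part (span (B \<union> A)) T = U"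
    then have UT: "inv_part W T = U" by (simp add: A(2) spanC)
    interpret adapted_bases scale q V W B1 B2 n k T
      using kn(2) B1 B2 T by unfold_locales
    show "invariant_factors (char_mat (mat_of_map scale B1 B2 T)) = ps \<longleftrightarrow> P T"
      using invariant_factors_eq_iff[OF I(1)] unfolding T_U_def P_def UT .
  qed
  also have "card \<dots> = card {T. lin_WV scale U U T \<and> P T} * (\<Prod>i\<in>{d+1..d + card A}. q ^ n - q ^ i)"
    by (rule card_extensions_chain[OF V(1) finV U(1) cardU A(1) _ A(3) spanB _ finB P_cong])
      (use A(2) C(2,3) W(2) in auto)
  also have "d + card A = k" using A(4) dk by simp
  also have "{T. lin_WV scale U U T \<and> P T} = {T. lin_WV scale U U T \<and> has_kernel_type U ps T}"
  proof (intro Collect_cong conj_cong refl)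
    fix T assume "lin_WV scale U U T"
    then have "(\<lambda>x. if x \<in> U then T x else 0) = T" using lin_WV_simps(4) by fastforce
    then show "P T \<longleftrightarrow> has_kernel_type U ps T" by (simp add: P_def)
  qed
  finally have count: "card {T. lin_WV scale W V T \<and> is_max_inv_sub scale W T U
      \<and> invariant_factors (char_mat (mat_of_map scale B1 B2 T)) = ps} =
    card {T. lin_WV scale U U T \<and> has_kernel_type U ps T} * (\<Prod>i\<in>{d+1..k}. q ^ n - q ^ i)" .
  let ?c = "\<Prod>f\<in>S_set ps. c_part q (degree f) (Phi ps f)"
  have class_eq: "card {T. lin_WV scale U U T \<and> has_kernel_type U ps T} * ?c = GL_card d TYPE('a)"
    using card_has_kernel_type[of b U k ps] b B(2) spanB I lenb by simp
  have "?c > 0"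
    using q_ge_2 by (intro prod_pos c_part_pos) (auto simp: S_set_def degree_irreducible_pos)
  then have "real (card {T. lin_WV scale U U T \<and> has_kernel_type U ps T}) = real (GL_card d TYPE('a)) / real ?c"
    unfolding class_eq[symmetric] by (simp only: of_nat_mult nonzero_mult_div_cancel_right of_nat_eq_0_iff)
  \<comment> \<open>All exponents are at most \<open>k\<close> and hence at most \<open>n\<close>,
    so subtraction of naturals agrees with that of reals.\<close>
  moreover have "real (\<Prod>i\<in>{d+1..k}. q ^ n - q ^ i) = (\<Prod>i\<in>{d+1..k}. real q ^ n - real q ^ i)"
  proof -
    have "q ^ i \<le> q ^ n" if "i \<le> k" for i using q_ge_2 kn(2) that by (intro power_increasing) auto
    then show ?thesis by (simp add: of_nat_diff)
  qed
  ultimately show ?thesis unfolding count of_nat_mult by simp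
qed

end
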